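(* A shift space $X$ is the natural coding of a regular $3$-interval exchange transformation if and only if there exist a permutation $\pi_0\in\Sigma_3$, a sequence $(\sigma_n)_{n\ge1}$ of morphisms in $\Sigma_3\mathcal{S}_3\Sigma_3$ and a sequence $(v_n)_{n\ge1}$ of vertices of the graph $\mathcal{G}_{\mathrm{IET}}$ described below such that for every $n$, $\sigma_n$ labels an edge of $\mathcal{G}_{\mathrm{IET}}$ from $v_n$ to $v_{n+1}$, and the directive sequence $(\pi_0,\sigma_1,\sigma_2,\dots)$ is primitive and is an $\mathcal{S}$-adic representation of $X$.
   Context: Interval exchange transformations: let $I=[l,r)$, $\lambda=(\lambda_1,\dots,\lambda_d)$ positive with $\sum\lambda_i=r-l$, and $\pi_0,\pi_1$ permutations of $\{1,\dots,d\}$. Set $\mu_0=l$, $\mu_i=l+\sum_{\pi_0^{-1}(j)\le i}\lambda_j$, $\nu_0=l$, $\nu_i=l+\sum_{\pi_1^{-1}(j)\le i}\lambda_j$, $I_{\pi_0(i)}=[\mu_{i-1},\mu_i)$, $J_{\pi_1(i)}=[\nu_{i-1},\nu_i)$. The IET $T=T_{\lambda,\pi_0,\pi_1}:I\to I$ is the piecewise translation mapping $I_i$ onto $J_i$ for each $i$. It is regular if the orbits $\{T^n(\mu_i):n\in\mathbb{Z}\}$, $1\le i<d$, are infinite and pairwise disjoint. A word $b_0\cdots b_{m-1}$ over $\{1,\dots,d\}$ is admissible if $I_{b_0}\cap T^{-1}(I_{b_1})\cap\cdots\cap T^{-m+1}(I_{b_{m-1}})\ne\emptyset$; the natural coding of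 $T$ is $X_T=\{x\in\{1,\dots,d\}^{\mathbb{Z}}:\text{all factors of }x\text{ are admissible}\}$. A $3$-IET is one with $d=3$. Shift spaces, morphisms (non-erasing), directive sequences: $\boldsymbol\sigma=(\sigma_n)$ is primitive if for each $n$ there is $N>n$ such that all letters occur in every $\sigma_n\cdots\sigma_{N-1}(b)$; a primitive $\boldsymbol\sigma$ is a representation of the shift $X_{\boldsymbol\sigma}$ of bi-infinite words all of whose factors occur in some $\sigma_1\cdots\sigma_{N-1}(a)$. $\pi_{abc}$ is the morphism $1\mapsto a,2\mapsto b,3\mapsto c$ ($\{a,b,c\}=\{1,2,3\}$), $\Sigma_3$ the set of these; juxtaposition is composition. $\mathcal{S}_3=\{\alpha,\beta,\gamma,\eta\}\cup\{\delta^{(k)},\zeta^{(k)}:k\ge1\}$ with $\alpha:1\mapsto1,2\mapsto12,3\mapsto13$; $\beta:1\mapsto1,2\mapsto12,3\mapsto132$; $\gamma:1\mapsto1,2\mapsto12,3\mapsto123$; $\delta^{(k)}:1\mapsto1,2\mapsto123^k,3\mapsto123^{k+1}$; $\zeta^{(k)}:1\mapsto13^k,2\mapsto12,3\mapsto13^{k+1}$; $\eta:1\mapsto13,2\mapsto12,3\mapsto123$. The graph $\mathcal{G}_{\mathrm{IET}}$ has vertices $[3,2]$ and $[3,3]$ (each with entering edges labeled by every permutation, corresponding to $\pi_0$), and edges ($k\ge1$): loops at $[3,2]$ labeled $\alpha$ and $\pi_{132}\eta\pi_{321}$; loops at $[3,3]$ labeled $\alpha$, $\pi_{213}\alpha\pi_{213}$,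 $\zeta^{(k)}\pi_{213}$, $\pi_{213}\zeta^{(k)}\pi_{213}$; edges from $[3,2]$ to $[3,3]$ labeled $\pi_{312}\beta\pi_{213}$, $\pi_{213}\gamma$, $\pi_{213}\delta^{(k)}$. There are no edges from $[3,3]$ to $[3,2]$. *)

theory Defs
  imports "HOL-Analysis.Analysis" "HOL-Library.Sublist" "HOL-Combinatorics.Permutations"
begin

definition is_IET :: "nat \<Rightarrow> real \<Rightarrow> real \<Rightarrow> (nat \<Rightarrow> real) \<Rightarrow> (nat \<Rightarrow> nat) \<Rightarrow> (nat \<Rightarrow> nat) \<Rightarrow> bool" where
  "is_IET d l r lam p0 p1 \<longleftrightarrow>
     l < r \<and> (\<forall>i\<in>{1..d}. 0 < lam i) \<and> (\<Sum>i=1..d. lam i) = r - l \<and>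
     p0 permutes {1..d} \<and> p1 permutes {1..d}"

definition iet_pt :: "real \<Rightarrow> (nat \<Rightarrow> real) \<Rightarrow> (nat \<Rightarrow> nat) \<Rightarrow> nat \<Rightarrow> real" where
  "iet_pt l lam p i = l + (\<Sum>j\<in>p ` {1..i}. lam j)"

definition in_I :: "nat \<Rightarrow> real \<Rightarrow> (nat \<Rightarrow> real) \<Rightarrow> (nat \<Rightarrow> nat) \<Rightarrow> nat \<Rightarrow> real \<Rightarrow> bool" where
  "in_I d l lam p0 a x \<longleftrightarrow>
     (\<exists>i\<in>{1..d}. p0 i = a \<and> iet_pt l lam p0 (i - 1) \<le> x \<and> x < iet_pt l lam p0 i)"

text \<open>The IET: translation of I_a onto J_a (identity outside [l,r), irrelevant).\<close>
definition iet_map :: "nat \<Rightarrow> real \<Rightarrow> (nat \<Rightarrow> real) \<Rightarrow> (nat \<Rightarrow> nat) \<Rightarrow> (nat \<Rightarrow> nat) \<Rightarrow> real \<Rightarrow> real" where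
  "iet_map d l lam p0 p1 x =
     (if \<exists>a. in_I d l lam p0 a x then
        (let a = (SOME a. in_I d l lam p0 a x) in
           x - iet_pt l lam p0 (inv p0 a - 1) + iet_pt l lam p1 (inv p1 a - 1))
      else x)"

text \<open>Full orbit {T^n(y) : n in Z} of a point y of I (T is a bijection of I = [l,r)).\<close>
definition iet_orbit :: "nat \<Rightarrow> real \<Rightarrow> real \<Rightarrow> (nat \<Rightarrow> real) \<Rightarrow> (nat \<Rightarrow> nat) \<Rightarrow> (nat \<Rightarrow> nat) \<Rightarrow> real \<Rightarrow> real set" where
  "iet_orbit d l r lam p0 p1 y =
     {(iet_map d l lam p0 p1 ^^ n) y | n. True} \<union>
     {z \<in> {l..<r}. \<exists>n. (iet_map d l lam p0 p1 ^^ n) z = y}"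

definition iet_regular :: "nat \<Rightarrow> real \<Rightarrow> real \<Rightarrow> (nat \<Rightarrow> real) \<Rightarrow> (nat \<Rightarrow> nat) \<Rightarrow> (nat \<Rightarrow> nat) \<Rightarrow> bool" where
  "iet_regular d l r lam p0 p1 \<longleftrightarrow>
     (\<forall>i\<in>{1..<d}. infinite (iet_orbit d l r lam p0 p1 (iet_pt l lam p0 i))) \<and>
     (\<forall>i\<in>{1..<d}. \<forall>j\<in>{1..<d}. i \<noteq> j \<longrightarrow>
        iet_orbit d l r lam p0 p1 (iet_pt l lam p0 i) \<inter> iet_orbit d l r lam p0 p1 (iet_pt l lam p0 j) = {})"

definition iet_admissible :: "nat \<Rightarrow> real \<Rightarrow> (nat \<Rightarrow> real) \<Rightarrow> (nat \<Rightarrow> nat) \<Rightarrow> (nat \<Rightarrow> nat) \<Rightarrow> nat list \<Rightarrow> bool" where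
  "iet_admissible d l lam p0 p1 w \<longleftrightarrow>
     (\<exists>x. \<forall>k<length w. in_I d l lam p0 (w ! k) ((iet_map d l lam p0 p1 ^^ k) x))"

definition factor_at :: "(int \<Rightarrow> nat) \<Rightarrow> int \<Rightarrow> nat \<Rightarrow> nat list" where
  "factor_at x i m = map (\<lambda>k. x (i + int k)) [0..<m]"

definition natural_coding :: "nat \<Rightarrow> real \<Rightarrow> (nat \<Rightarrow> real) \<Rightarrow> (nat \<Rightarrow> nat) \<Rightarrow> (nat \<Rightarrow> nat) \<Rightarrow> (int \<Rightarrow> nat) set" where
  "natural_coding d l lam p0 p1 =
     {x. (\<forall>i. x i \<in> {1..d}) \<and> (\<forall>i m. iet_admissible d l lam p0 p1 (factor_at x i m))}"

definition shift_space :: "(int \<Rightarrow> nat) set \<Rightarrow> bool" where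
  "shift_space X \<longleftrightarrow> closed X \<and> (\<forall>x\<in>X. (\<lambda>i. x (i + 1)) \<in> X \<and> (\<lambda>i. x (i - 1)) \<in> X)"

type_synonym morph = "nat \<Rightarrow> nat list"

definition mk3 :: "nat list \<Rightarrow> nat list \<Rightarrow> nat list \<Rightarrow> morph" where
  "mk3 u v w = (\<lambda>a. if a = 1 then u else if a = 2 then v else if a = 3 then w else [])"

definition morph_word :: "morph \<Rightarrow> nat list \<Rightarrow> nat list" where
  "morph_word s w = concat (map s w)"

definition mcomp :: "morph \<Rightarrow> morph \<Rightarrow> morph" where
  "mcomp s t = (\<lambda>a. morph_word s (t a))"

definition perm3 :: "nat \<Rightarrow> nat \<Rightarrow> nat \<Rightarrow> morph" where
  "perm3 a b c = mk3 [a] [b] [c]"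

definition Sigma3 :: "morph set" where
  "Sigma3 = {perm3 a b c | a b c. {a, b, c} = {1, 2, 3}}"

definition m_alpha :: morph where "m_alpha = mk3 [1] [1,2] [1,3]"
definition m_beta :: morph where "m_beta = mk3 [1] [1,2] [1,3,2]"
definition m_gamma :: morph where "m_gamma = mk3 [1] [1,2] [1,2,3]"
definition m_delta :: "nat \<Rightarrow> morph" where
  "m_delta k = mk3 [1] ([1,2] @ replicate k 3) ([1,2] @ replicate (k + 1) 3)"
definition m_zeta :: "nat \<Rightarrow> morph" where
  "m_zeta k = mk3 (1 # replicate k 3) [1,2] (1 # replicate (k + 1) 3)"
definition m_eta :: morph where "m_eta = mk3 [1,3] [1,2] [1,2,3]"

definition S3 :: "morph set" where
  "S3 = {m_alpha, m_beta, m_gamma, m_eta} \<union> {m_delta k | k. k \<ge> 1} \<union> {m_zeta k | k. k \<ge> 1}"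

definition Sigma3_S3_Sigma3 :: "morph set" where
  "Sigma3_S3_Sigma3 = {mcomp p (mcomp s q) | p s q. p \<in> Sigma3 \<and> s \<in> S3 \<and> q \<in> Sigma3}"

datatype vertex = V32 | V33

definition edge_labels :: "vertex \<Rightarrow> vertex \<Rightarrow> morph set" where
  "edge_labels v w =
    (if v = V32 \<and> w = V32 then
       {m_alpha, mcomp (perm3 1 3 2) (mcomp m_eta (perm3 3 2 1))}
     else if v = V33 \<and> w = V33 then
       {m_alpha, mcomp (perm3 2 1 3) (mcomp m_alpha (perm3 2 1 3))}
       \<union> {mcomp (m_zeta k) (perm3 2 1 3) | k. k \<ge> 1}
       \<union> {mcomp (perm3 2 1 3) (mcomp (m_zeta k) (perm3 2 1 3)) | k. k \<ge> 1}
     else if v = V32 \<and> w = V33 then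
       {mcomp (perm3 3 1 2) (mcomp m_beta (perm3 2 1 3)), mcomp (perm3 2 1 3) m_gamma}
       \<union> {mcomp (perm3 2 1 3) (m_delta k) | k. k \<ge> 1}
     else {})"

fun mprod :: "(nat \<Rightarrow> morph) \<Rightarrow> nat \<Rightarrow> nat \<Rightarrow> morph" where
  "mprod t n 0 = (\<lambda>a. [a])"
| "mprod t n (Suc k) = mcomp (mprod t n k) (t (n + k))"

definition primitive_seq :: "(nat \<Rightarrow> morph) \<Rightarrow> bool" where
  "primitive_seq t \<longleftrightarrow>
     (\<forall>n. \<exists>N>n. \<forall>b\<in>{1,2,3}. \<forall>a\<in>{1,2,3}. a \<in> set (mprod t n (N - n) b))"

definition shift_of_seq :: "(nat \<Rightarrow> morph) \<Rightarrow> (int \<Rightarrow> nat) set" where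
  "shift_of_seq t =
     {x. \<forall>i m. \<exists>N. \<exists>a\<in>{1,2,3}. sublist (factor_at x i m) (mprod t 0 N a)}"

end

(* Up to relabelling and reflection, a regular 3-interval exchange has one of two combinatorial types: V32, with top
   order 1 2 3 and bottom order 2 3 1, and V33, with top order 1 3 2 and bottom order 2 3 1. An edge of the graph
   is a first return map: if s labels an edge v -> w and the lengths satisfy L = M_s L', then the exchange (w, L')
   is, up to x |-> c + e x with e = 1 or e = -1, the map induced by (v, L) on the interval of one letter, and s lists
   the return words. Endpoints do not matter for languages, so open intervals are used and reflections are harmless.
   Regularity becomes the absence of a connection, that is, of an orbit segment from a discontinuity of T^-1 to one
   of T. Return maps of connection-free exchanges are connection-free and the length inequalities select an edge,
   so a regular exchange can be renormalized forever. The resulting sequence is primitive because otherwise some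
   length would stay constant while the total length drops by that amount at each step. Conversely, a compactness
   argument gives lengths for every primitive sequence of edges, and a connection would descend to ever shorter
   connections. In both directions the levels of the towers over the n-th base are disjoint and have full total
   length while the bases shrink to 0, so every cylinder of T meets a level far below the top of its tower, and
   its word occurs in the n-th product of morphisms. *)
theory Submission
  imports Defs
begin

text \<open>Every dynamical object is a \<open>run\<close>: a word read along an orbit through open
  intervals, with both end points recorded. Cylinders, return words, tower floors and connections
  are all runs, and they are compared by two cancellation rules, \<open>run_det\<close> forwards and
  \<open>run_codet\<close> backwards. The obstacle is that points on the orbits of discontinuities
  have no complete itinerary, so an induced map cannot be handled as a total function on its base;
  \<open>induces\<close> therefore also records how the marked points of the two levels are joined
  by runs. That every cylinder is met by the towers comes from comparing lengths: floors of total
  length \<open>tot L\<close> leave no room for a long cylinder that avoids all but the top ones.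
  Both directions rest on one object, a sequence of positive length vectors linked by incidence
  matrices. The existence of edges builds it from an exchange, compactness builds it from a
  directive sequence, and the statements on languages, connections and primitivity start from such a
  sequence.\<close>

section \<open>Runs of interval exchanges\<close>

declare One_nat_def [simp del]

text \<open>The inequalities are strict at every letter read, while the final point \<open>y\<close>
  need not lie in any interval. So a run may end at a discontinuity but never pass through one,
  which makes a connection expressible as a run.\<close>

primrec run :: "(nat \<Rightarrow> real) \<Rightarrow> (nat \<Rightarrow> real) \<Rightarrow> (nat \<Rightarrow> real) \<Rightarrow> real \<Rightarrow> nat list \<Rightarrow> real \<Rightarrow> bool" where
  "run lo len tr x [] y \<longleftrightarrow> x = y"
| "run lo len tr x (a # w) y \<longleftrightarrow>
     a \<in> {1,2,3} \<and> lo a < x \<and> x < lo a + len a \<and> run lo len tr (x + tr a) w y"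

lemma run_append: "run lo len tr x (u @ w) z \<longleftrightarrow> (\<exists>y. run lo len tr x u y \<and> run lo len tr y w z)"
  by (induction u arbitrary: x) auto

lemma run_letters: "run lo len tr x w y \<Longrightarrow> set w \<subseteq> {1,2,3}"
  by (induction w arbitrary: x) auto

lemma run_end: "run lo len tr x w y \<Longrightarrow> y = x + sum_list (map tr w)"
proof (induction w arbitrary: x)
  case (Cons a w)
  have "y = (x + tr a) + sum_list (map tr w)" by (rule Cons.IH) (use Cons.prems in simp)
  then show ?case by simp
qed simp

lemma run_take: "run lo len tr x w y \<Longrightarrow> \<exists>z. run lo len tr x (take n w) z \<and> run lo len tr z (drop n w) y"
  using run_append[of lo len tr x "take n w" "drop n w" y] by simp

text \<open>The interval of \<open>c\<close> is crossed in \<open>k\<close> equal steps, so only the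
  entry and the last step need bounds. Such blocks are the powers of 3 in delta and zeta. The end
  point is a separate equation so that the rule applies whatever the syntactic form of the
  target.\<close>

lemma run_replicate_down:
  assumes "c \<in> {1,2,3}" "tr c = - s" "0 < s" "x < lo c + len c" "lo c + real k * s - s < x"
  and y: "y = x - real k * s"
  shows "run lo len tr x (replicate k c) y"
  unfolding y using assms(4,5)
proof (induction k arbitrary: x)
  case (Suc k)
  have ks: "0 \<le> real k * s" "real (Suc k) * s = real k * s + s" using assms by (simp_all add: algebra_simps)
  have "run lo len tr (x - s) (replicate k c) (x - s - real k * s)"
    by (rule Suc.IH) (use Suc.prems ks assms(3) in linarith)+
  then have "run lo len tr (x - s) (replicate k c) (x - real (Suc k) * s)"
    by (simp only: ks) (simp add: algebra_simps)
  moreover have "lo c < x" "x < lo c + len c" using Suc.prems ks assms(3) by linarith+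
  ultimately show ?case using assms(1,2) by simp
qed auto

lemma run_replicate_up:
  assumes "c \<in> {1,2,3}" "tr c = s" "0 < s" "lo c < x" "x + real k * s - s < lo c + len c"
  and y: "y = x + real k * s"
  shows "run lo len tr x (replicate k c) y"
  unfolding y using assms(4,5)
proof (induction k arbitrary: x)
  case (Suc k)
  have ks: "0 \<le> real k * s" "real (Suc k) * s = real k * s + s" using assms by (simp_all add: algebra_simps)
  have "run lo len tr (x + s) (replicate k c) (x + s + real k * s)"
    by (rule Suc.IH) (use Suc.prems ks assms(3) in linarith)+
  then have "run lo len tr (x + s) (replicate k c) (x + real (Suc k) * s)"
    by (simp only: ks) (simp add: algebra_simps)
  moreover have "lo c < x" "x < lo c + len c" using Suc.prems ks assms(3) by linarith+
  ultimately show ?case using assms(1,2) by simp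
qed auto

text \<open>Applied to the translated intervals \<open>lo a + tr a\<close>, this is determinism of the inverse map.\<close>
definition forward_det :: "(nat \<Rightarrow> real) \<Rightarrow> (nat \<Rightarrow> real) \<Rightarrow> bool" where
  "forward_det lo len \<longleftrightarrow> (\<forall>a\<in>{1,2,3}. \<forall>b\<in>{1,2,3}. \<forall>x.
     lo a < x \<longrightarrow> x < lo a + len a \<longrightarrow> lo b < x \<longrightarrow> x < lo b + len b \<longrightarrow> a = b)"

lemma run_det:
  assumes "forward_det lo len" "run lo len tr x u y" "run lo len tr x w z" "length u \<le> length w"
  shows "\<exists>w'. w = u @ w' \<and> run lo len tr y w' z"
  using assms(2-4)
proof (induction u arbitrary: x w)
  case (Cons a u)
  from Cons.prems obtain b w1 where w: "w = b # w1" by (cases w) auto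
  have "a = b" using Cons.prems(1,2) assms(1) unfolding w forward_det_def run.simps by blast
  then have "\<exists>w'. w1 = u @ w' \<and> run lo len tr y w' z"
    using Cons.prems w by (intro Cons.IH[of "x + tr a"]) simp_all
  then show ?case using w \<open>a = b\<close> by simp
qed auto

text \<open>Mirror image of \<open>run_det\<close>: the last letter of a run is decided by the
  translated interval that contains its end point, so of two runs with a common end the shorter is a
  suffix of the longer.\<close>

lemma run_codet:
  assumes "forward_det (\<lambda>a. lo a + tr a) len" "run lo len tr x u z" "run lo len tr y w z"
    "length u \<le> length w"
  shows "\<exists>w'. w = w' @ u \<and> run lo len tr y w' x"
  using assms(2-4)
proof (induction u arbitrary: z w rule: rev_induct)
  case (snoc a u)
  from snoc.prems obtain b w1 where w: "w = w1 @ [b]" by (cases w rule: rev_cases) auto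
  from snoc.prems obtain z1 where z1: "run lo len tr x u z1" "a \<in> {1,2,3}" "lo a < z1" "z1 < lo a + len a" "z = z1 + tr a"
    by (auto simp: run_append)
  from snoc.prems w obtain z2 where z2: "run lo len tr y w1 z2" "b \<in> {1,2,3}" "lo b < z2" "z2 < lo b + len b" "z = z2 + tr b"
    by (auto simp: run_append)
  have "lo a + tr a < z" "z < lo a + tr a + len a" using z1(3-5) by simp_all
  moreover have "lo b + tr b < z" "z < lo b + tr b + len b" using z2(3-5) by simp_all
  ultimately have "a = b" using assms(1) z1(2) z2(2) unfolding forward_det_def by blast
  then have "z1 = z2" using z1(5) z2(5) by simp
  then have "\<exists>w'. w1 = w' @ u \<and> run lo len tr y w' x"
    using z1(1) z2(1) snoc.prems(3) w by (intro snoc.IH[of z1]) simp_all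
  then show ?case using w \<open>a = b\<close> by auto
qed auto

lemma run_affine:
  assumes "e = 1 \<or> e = - 1"
    and "\<And>b x. b \<in> {1,2,3} \<Longrightarrow> lo b < x \<and> x < lo b + len b \<longleftrightarrow>
           p b \<in> {1,2,3} \<and> lo' (p b) < c + e * x \<and> c + e * x < lo' (p b) + len' (p b)"
    and "\<And>b. b \<in> {1,2,3} \<Longrightarrow> tr' (p b) = e * tr b"
    and "set w \<subseteq> {1,2,3}"
  shows "run lo len tr x w y \<longleftrightarrow> run lo' len' tr' (c + e * x) (map p w) (c + e * y)"
  using assms(4)
proof (induction w arbitrary: x)
  case Nil
  then show ?case using assms(1) by auto
next
  case (Cons a w)
  then have a: "a \<in> {1,2,3}" by auto
  have "c + e * (x + tr a) = c + e * x + tr' (p a)" using assms(3)[OF a] by (simp add: algebra_simps)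
  moreover have "set w \<subseteq> {1,2,3}" using Cons.prems by simp
  ultimately have "run lo len tr (x + tr a) w y \<longleftrightarrow>
      run lo' len' tr' (c + e * x + tr' (p a)) (map p w) (c + e * y)"
    using Cons.IH[of "x + tr a"] by (simp add: add.assoc)
  then show ?case using assms(2)[OF a, of x] a unfolding run.simps list.map by argo
qed

section \<open>The two combinatorial types on open intervals\<close>

fun left :: "vertex \<Rightarrow> (nat \<Rightarrow> real) \<Rightarrow> nat \<Rightarrow> real" where
  "left V32 L a = (if a = 1 then 0 else if a = 2 then L 1 else L 1 + L 2)"
| "left V33 L a = (if a = 1 then 0 else if a = 3 then L 1 else L 1 + L 3)"

fun shift :: "vertex \<Rightarrow> (nat \<Rightarrow> real) \<Rightarrow> nat \<Rightarrow> real" where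
  "shift V32 L a = (if a = 1 then L 2 + L 3 else - L 1)"
| "shift V33 L a = (if a = 1 then L 2 + L 3 else if a = 3 then L 2 - L 1 else - L 1 - L 3)"

fun disc :: "vertex \<Rightarrow> (nat \<Rightarrow> real) \<Rightarrow> nat \<Rightarrow> real" where
  "disc V32 L i = (if i = 1 then L 1 else L 1 + L 2)"
| "disc V33 L i = (if i = 1 then L 1 else L 1 + L 3)"

text \<open>The discontinuities of the inverse map. Both vertices have the bottom order 2 3 1, hence
  there is no vertex argument.\<close>

definition codisc :: "(nat \<Rightarrow> real) \<Rightarrow> nat \<Rightarrow> real" where
  "codisc L i = (if i = 1 then L 2 else L 2 + L 3)"

abbreviation vrun :: "vertex \<Rightarrow> (nat \<Rightarrow> real) \<Rightarrow> real \<Rightarrow> nat list \<Rightarrow> real \<Rightarrow> bool" where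
  "vrun v L \<equiv> run (left v L) L (shift v L)"

definition pos :: "(nat \<Rightarrow> real) \<Rightarrow> bool" where
  "pos L \<longleftrightarrow> L 1 > 0 \<and> L 2 > 0 \<and> L 3 > 0"

definition tot :: "(nat \<Rightarrow> real) \<Rightarrow> real" where
  "tot L = L 1 + L 2 + L 3"

lemma forward_det_left: "pos L \<Longrightarrow> forward_det (left v L) L"
  by (cases v) (auto simp: forward_det_def pos_def)

lemma backward_det_left: "pos L \<Longrightarrow> forward_det (\<lambda>a. left v L a + shift v L a) L"
  by (cases v) (auto simp: forward_det_def pos_def)

lemma left_range:
  assumes "pos L" "a \<in> {1,2,3}" "left v L a < x" "x < left v L a + L a"
  shows "0 < x" "x < tot L" "0 < x + shift v L a" "x + shift v L a < tot L"
  using assms by (cases v; auto simp: pos_def tot_def)+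

text \<open>A codiscontinuity separates two translated intervals, so no nonempty run ends there.
  This is what stops a connection from being prolonged backwards through its starting point.\<close>

lemma codisc_not_interior:
  assumes "pos L" "i \<in> {1,2}" "a \<in> {1,2,3}" "left v L a + shift v L a < codisc L i"
    "codisc L i < left v L a + shift v L a + L a"
  shows False
  using assms by (cases v) (auto simp: pos_def codisc_def split: if_splits)

lemma interior_cases:
  assumes "0 < x" "x < tot L"
  obtains i where "i \<in> {1,2}" "x = disc v L i" | a where "a \<in> {1,2,3}" "left v L a < x" "x < left v L a + L a"
proof (cases v)
  case V32
  have "x = disc v L 1 \<or> x = disc v L 2 \<or> (left v L 1 < x \<and> x < left v L 1 + L 1) \<or> 
     (left v L 2 < x \<and> x < left v L 2 + L 2) \<or> (left v L 3 < x \<and> x < left v L 3 + L 3)"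
    using assms V32 by (auto simp: tot_def)
  then show ?thesis using that by blast
next
  case V33
  have "x = disc v L 1 \<or> x = disc v L 2 \<or> (left v L 1 < x \<and> x < left v L 1 + L 1) \<or> 
     (left v L 2 < x \<and> x < left v L 2 + L 2) \<or> (left v L 3 < x \<and> x < left v L 3 + L 3)"
    using assms V33 by (auto simp: tot_def)
  then show ?thesis using that by blast
qed

lemma disc_range: "pos L \<Longrightarrow> i \<in> {1,2} \<Longrightarrow> 0 < disc v L i \<and> disc v L i < tot L"
  by (cases v) (auto simp: pos_def tot_def)

lemma codisc_range: "pos L \<Longrightarrow> i \<in> {1,2} \<Longrightarrow> 0 < codisc L i \<and> codisc L i < tot L"
  by (auto simp: pos_def tot_def codisc_def)

text \<open>Row \<open>a\<close> of the incidence matrix of \<open>s\<close> applied to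
  \<open>L\<close>: when \<open>s\<close> lists return words, the interval of \<open>a\<close> is
  filled by one copy of the base interval of \<open>b\<close> for each occurrence of
  \<open>a\<close> in \<open>s b\<close>.\<close>

definition mval :: "morph \<Rightarrow> (nat \<Rightarrow> real) \<Rightarrow> nat \<Rightarrow> real" where
  "mval s L a = real (count_list (s 1) a) * L 1 + real (count_list (s 2) a) * L 2 + real (count_list (s 3) a) * L 3"

text \<open>\<open>a\<close> is the letter of the inducing interval, and \<open>c\<close>,
  \<open>e\<close> embed the smaller exchange into it; return words contain \<open>a\<close> only in
  first place, so they are first returns. The last two clauses join marked points: codiscontinuities
  of \<open>L\<close> reach those of \<open>L'\<close> along words without \<open>a\<close>, and
  discontinuities of \<open>L'\<close> reach those of \<open>L\<close> along nonempty words. Since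
  \<open>q\<close> is onto, connections can be both lifted and projected, and the nonempty words
  make the projected ones shorter.\<close>

definition induces ::
  "vertex \<Rightarrow> (nat \<Rightarrow> real) \<Rightarrow> vertex \<Rightarrow> (nat \<Rightarrow> real) \<Rightarrow> morph \<Rightarrow> real \<Rightarrow> real \<Rightarrow> nat \<Rightarrow> bool" where
  "induces v L w L' s c e a \<longleftrightarrow>
     (e = 1 \<or> e = - 1) \<and> a \<in> {1,2,3} \<and>
     (\<forall>b\<in>{1,2,3}. \<exists>u. s b = a # u \<and> a \<notin> set u) \<and>
     (\<forall>x. 0 < x \<and> x < tot L' \<longrightarrow> left v L a < c + e * x \<and> c + e * x < left v L a + L a) \<and>
     (\<forall>b\<in>{1,2,3}. \<forall>x. left w L' b < x \<and> x < left w L' b + L' b \<longrightarrow>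
        vrun v L (c + e * x) (s b) (c + e * (x + shift w L' b))) \<and>
     (\<exists>q u. (\<forall>i\<in>{1,2}. a \<notin> set (u i) \<and> vrun v L (codisc L (q i)) (u i) (c + e * codisc L' i)) \<and> q ` {1,2} = {1,2::nat}) \<and>
     (\<exists>q u. (\<forall>i\<in>{1,2}. u i \<noteq> [] \<and> vrun v L (c + e * disc w L' i) (u i) (disc v L (q i))) \<and> q ` {1,2} = {1,2::nat})"

text \<open>Splits the quantifiers into single letters and single marked points, so that each edge
  reduces to linear inequalities. \<open>s1\<close>, \<open>s2\<close>, \<open>t1\<close>,
  \<open>t2\<close> are the words that join marked points; \<open>i1\<close>, \<open>i2\<close>,
  \<open>j1\<close>, \<open>j2\<close> tell which marked points of \<open>L\<close> they
  join.\<close>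

lemma inducesI:
  assumes "e = 1 \<or> e = - 1" "a \<in> {1,2,3}"
    "s 1 = a # u1" "s 2 = a # u2" "s 3 = a # u3" "a \<notin> set u1 \<union> set u2 \<union> set u3"
    "\<And>x. 0 < x \<Longrightarrow> x < tot L' \<Longrightarrow> left v L a < c + e * x \<and> c + e * x < left v L a + L a"
    "\<And>x. left w L' 1 < x \<Longrightarrow> x < left w L' 1 + L' 1 \<Longrightarrow>
        vrun v L (c + e * x) (a # u1) (c + e * (x + shift w L' 1))"
    "\<And>x. left w L' 2 < x \<Longrightarrow> x < left w L' 2 + L' 2 \<Longrightarrow>
        vrun v L (c + e * x) (a # u2) (c + e * (x + shift w L' 2))"
    "\<And>x. left w L' 3 < x \<Longrightarrow> x < left w L' 3 + L' 3 \<Longrightarrow>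
        vrun v L (c + e * x) (a # u3) (c + e * (x + shift w L' 3))"
    "a \<notin> set s1 \<union> set s2"
    "{i1,i2} = {1,2::nat}"
    "vrun v L (codisc L i1) s1 (c + e * codisc L' 1)"
    "vrun v L (codisc L i2) s2 (c + e * codisc L' 2)"
    "t1 \<noteq> []" "t2 \<noteq> []"
    "{j1,j2} = {1,2::nat}"
    "vrun v L (c + e * disc w L' 1) t1 (disc v L j1)"
    "vrun v L (c + e * disc w L' 2) t2 (disc v L j2)"
  shows "induces v L w L' s c e a"
proof -
  have "\<exists>q u. (\<forall>i\<in>{1,2}. a \<notin> set (u i) \<and> vrun v L (codisc L (q i)) (u i) (c + e * codisc L' i)) \<and> q ` {1,2} = {1,2::nat}"
    by (rule exI[of _ "\<lambda>i::nat. if i = 1 then i1 else i2"], rule exI[of _ "\<lambda>i::nat. if i = 1 then s1 else s2"])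
       (use assms in auto)
  moreover have "\<exists>q u. (\<forall>i\<in>{1,2}. u i \<noteq> [] \<and> vrun v L (c + e * disc w L' i) (u i) (disc v L (q i))) \<and> q ` {1,2} = {1,2::nat}"
    by (rule exI[of _ "\<lambda>i::nat. if i = 1 then j1 else j2"], rule exI[of _ "\<lambda>i::nat. if i = 1 then t1 else t2"])
       (use assms in auto)
  moreover have "\<forall>b\<in>{1,2,3}. \<forall>x. left w L' b < x \<and> x < left w L' b + L' b \<longrightarrow>
        vrun v L (c + e * x) (s b) (c + e * (x + shift w L' b))"
    using assms(3-5,8-10) by auto
  moreover have "\<forall>b\<in>{1,2,3}. \<exists>u. s b = a # u \<and> a \<notin> set u"
    using assms(3-6) by auto
  ultimately show ?thesis unfolding induces_def using assms(1,2,7) by blast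
qed

section \<open>Morphisms and the explicit edge labels\<close>

lemma morph_word_simps [simp]: "morph_word s [] = []" "morph_word s (a # w) = s a @ morph_word s w"
  "morph_word s (u @ w) = morph_word s u @ morph_word s w"
  by (auto simp: morph_word_def)

lemma mk3_simps [simp]: "mk3 u v w 1 = u" "mk3 u v w 2 = v" "mk3 u v w 3 = w" 
  by (auto simp: mk3_def)

lemma morph_word_replicate_singleton: "s a = [b] \<Longrightarrow> morph_word s (replicate k a) = replicate k b"
  by (induction k) auto

lemma mcomp_mk3: "mcomp s (mk3 u v w) = mk3 (morph_word s u) (morph_word s v) (morph_word s w)"
  by (auto simp: mcomp_def mk3_def)

lemmas edge_morph_defs = m_alpha_def m_beta_def m_gamma_def m_delta_def m_zeta_def m_eta_def perm3_def

lemma edge_labels_V32_V32: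
  "edge_labels V32 V32 = {mk3 [1] [1,2] [1,3], mk3 [1,3,2] [1,3] [1,2]}"
  by (auto simp: edge_labels_def edge_morph_defs mcomp_mk3)

lemma edge_labels_V33_V33:
  "edge_labels V33 V33 = {mk3 [1] [1,2] [1,3], mk3 [2,1] [2] [2,3]} \<union>
     {mk3 [1,2] (1 # replicate k 3) (1 # 3 # replicate k 3) | k. k \<ge> 1} \<union>
     {mk3 [2,1] (2 # replicate k 3) (2 # 3 # replicate k 3) | k. k \<ge> 1}"
  by (simp add: edge_labels_def edge_morph_defs mcomp_mk3 morph_word_replicate_singleton Suc_eq_plus1 [symmetric])

lemma edge_labels_V32_V33:
  "edge_labels V32 V33 = {mk3 [3,1] [3] [3,2,1], mk3 [2] [2,1] [2,1,3]} \<union>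
     {mk3 [2] (2 # 1 # replicate k 3) (2 # 1 # 3 # replicate k 3) | k. k \<ge> 1}"
  by (simp add: edge_labels_def edge_morph_defs mcomp_mk3 morph_word_replicate_singleton Suc_eq_plus1 [symmetric])

lemma edge_labels_V33_V32: "edge_labels V33 V32 = {}"
  by (simp add: edge_labels_def)

lemma count_list_replicate [simp]: "count_list (replicate k a) b = (if a = b then k else 0)"
  by (induction k) auto

lemma induces_alpha_V32:
  assumes "pos L'" "L 1 = L' 1 + L' 2 + L' 3" "L 2 = L' 2" "L 3 = L' 3"
  shows "induces V32 L V32 L' (mk3 [1] [1,2] [1,3]) 0 1 1"
  by (rule inducesI[where ?s1.0="[]" and ?s2.0="[]" and ?i1.0=1 and ?i2.0=2 and ?t1.0="[1]" and ?t2.0="[1]" and ?j1.0=1 and ?j2.0=2])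
    (use assms in \<open>auto simp: pos_def tot_def codisc_def\<close>)

text \<open>The return map to the interval of 1 has type V32 only after a reflection, hence
  \<open>c = L 1\<close> and \<open>e = -1\<close>. The second codiscontinuity of \<open>L\<close>
  lies in the interval of 2 and enters the base after reading that letter.\<close>

lemma induces_eta:
  assumes "pos L'" "L 1 = L' 1 + L' 2 + L' 3" "L 2 = L' 1 + L' 3" "L 3 = L' 1 + L' 2"
  shows "induces V32 L V32 L' (mk3 [1,3,2] [1,3] [1,2]) (L 1) (-1) 1"
  by (rule inducesI[where ?s1.0="[]" and ?s2.0="[2]" and ?i1.0=1 and ?i2.0=2 and ?t1.0="[1,3]" and ?t2.0="[1]" and ?j1.0=1 and ?j2.0=2])
    (use assms in \<open>auto simp: pos_def tot_def codisc_def\<close>)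

section \<open>Induction along the edges of the graph\<close>

lemma induces_beta:
  assumes "pos L'" "L 1 = L' 1 + L' 3" "L 2 = L' 3" "L 3 = L' 1 + L' 2 + L' 3"
  shows "induces V32 L V33 L' (mk3 [3,1] [3] [3,2,1]) (L 1 + L 2) 1 3"
  by (rule inducesI[where ?s1.0="[]" and ?s2.0="[1]" and ?i1.0=2 and ?i2.0=1 and ?t1.0="[3]" and ?t2.0="[3]" and ?j1.0=1 and ?j2.0=2])
    (use assms in \<open>auto simp: pos_def tot_def codisc_def\<close>)

lemma induces_gamma:
  assumes "pos L'" "L 1 = L' 2 + L' 3" "L 2 = L' 1 + L' 2 + L' 3" "L 3 = L' 3"
  shows "induces V32 L V33 L' (mk3 [2] [2,1] [2,1,3]) (L 1 + L 2) (-1) 2"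
  by (rule inducesI[where ?s1.0="[]" and ?s2.0="[]" and ?i1.0=2 and ?i2.0=1 and ?t1.0="[2]" and ?t2.0="[2,1]" and ?j1.0=1 and ?j2.0=2])
    (use assms in \<open>auto simp: pos_def tot_def codisc_def\<close>)

lemma induces_alpha_V33:
  assumes "pos L'" "L 1 = L' 1 + L' 2 + L' 3" "L 2 = L' 2" "L 3 = L' 3"
  shows "induces V33 L V33 L' (mk3 [1] [1,2] [1,3]) 0 1 1"
  by (rule inducesI[where ?s1.0="[]" and ?s2.0="[]" and ?i1.0=1 and ?i2.0=2 and ?t1.0="[1]" and ?t2.0="[1]" and ?j1.0=1 and ?j2.0=2])
    (use assms in \<open>auto simp: pos_def tot_def codisc_def\<close>)

lemma induces_alpha'_V33:
  assumes "pos L'" "L 1 = L' 1" "L 2 = L' 1 + L' 2 + L' 3" "L 3 = L' 3"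
  shows "induces V33 L V33 L' (mk3 [2,1] [2] [2,3]) (L 1 + L 3) 1 2"
  by (rule inducesI[where ?s1.0="[]" and ?s2.0="[]" and ?i1.0=1 and ?i2.0=2 and ?t1.0="[2]" and ?t2.0="[2]" and ?j1.0=1 and ?j2.0=2])
    (use assms in \<open>auto simp: pos_def tot_def codisc_def\<close>)

text \<open>Letter 3 moves every point down by \<open>L 1 - L 2 = L' 2 + L' 3\<close>, and
  \<open>L 3\<close> is \<open>k\<close> such steps plus \<open>L' 3\<close>. A point that enters
  interval 3 needs \<open>k\<close> or \<open>k + 1\<close> steps to leave it, which is where the
  exponents of zeta come from.\<close>

lemma induces_zeta:
  assumes "pos L'" "L 1 = L' 1 + L' 2 + L' 3" "L 2 = L' 1" "L 3 = real k * L' 2 + (real k + 1) * L' 3"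
  shows "induces V33 L V33 L' (mk3 [1,2] (1 # replicate k 3) (1 # 3 # replicate k 3)) (L 1) (-1) 1"
proof -
  \<comment> \<open>In distributed form the products \<open>real k * L' 2\<close> and
    \<open>real k * L' 3\<close> are atoms for linear arithmetic.\<close>
  have ks: "real k * (L' 2 + L' 3) = real k * L' 2 + real k * L' 3" 
    and L3: "L 3 = real k * L' 2 + real k * L' 3 + L' 3" 
    and nn: "0 \<le> real k * L' 2" "0 \<le> real k * L' 3"
    using assms by (auto simp: algebra_simps pos_def)
  note A = assms(1-3) L3 nn
  show ?thesis
    apply (rule inducesI[where ?s1.0="replicate k 3" and ?s2.0="[]" and ?i1.0=2 and ?i2.0=1 and ?t1.0="[1]" and ?t2.0="1 # replicate k 3" and ?j1.0=2 and ?j2.0=1])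
    using A
    by (auto simp: pos_def tot_def codisc_def ks intro!: run_replicate_down[where s="L' 2 + L' 3"])
      (use nn in linarith)
qed

text \<open>Now the base is the interval of 2 and letter 3 moves points up by
  \<open>L 2 - L 1 = L' 2 + L' 3\<close>; the embedding preserves orientation.\<close>

lemma induces_zeta':
  assumes "pos L'" "L 1 = L' 1" "L 2 = L' 1 + L' 2 + L' 3" "L 3 = real k * L' 2 + (real k + 1) * L' 3"
  shows "induces V33 L V33 L' (mk3 [2,1] (2 # replicate k 3) (2 # 3 # replicate k 3)) (L 1 + L 3) 1 2"
proof -
  have ks: "real k * (L' 2 + L' 3) = real k * L' 2 + real k * L' 3" 
    and L3: "L 3 = real k * L' 2 + real k * L' 3 + L' 3" 
    and nn: "0 \<le> real k * L' 2" "0 \<le> real k * L' 3"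
    using assms by (auto simp: algebra_simps pos_def)
  note A = assms(1-3) L3 nn
  show ?thesis
    apply (rule inducesI[where ?s1.0="replicate k 3" and ?s2.0="[]" and ?i1.0=1 and ?i2.0=2 and ?t1.0="[2]" and ?t2.0="2 # replicate k 3" and ?j1.0=1 and ?j2.0=2])
    using A
    by (auto simp: pos_def tot_def codisc_def ks intro!: run_replicate_up[where s="L' 2 + L' 3"])
      (use nn in linarith)
qed

text \<open>As for zeta, with the step \<open>L 1 = L' 2 + L' 3\<close> of letter 3 in type V32; the
  longer return words to interval 2 pass through 1 before the block of 3s.\<close>

lemma induces_delta:
  assumes "pos L'" "L 1 = L' 2 + L' 3" "L 2 = L' 1 + L' 2 + L' 3" "L 3 = real k * L' 2 + (real k + 1) * L' 3"
  shows "induces V32 L V33 L' (mk3 [2] (2 # 1 # replicate k 3) (2 # 1 # 3 # replicate k 3)) (L 1 + L 2) (-1) 2"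
proof -
  have ks: "real k * (L' 2 + L' 3) = real k * L' 2 + real k * L' 3" 
    and L3: "L 3 = real k * L' 2 + real k * L' 3 + L' 3" 
    and nn: "0 \<le> real k * L' 2" "0 \<le> real k * L' 3"
    using assms by (auto simp: algebra_simps pos_def)
  note A = assms(1-3) L3 nn
  show ?thesis
    apply (rule inducesI[where ?s1.0="replicate k 3" and ?s2.0="[]" and ?i1.0=2 and ?i2.0=1 and ?t1.0="[2]" and ?t2.0="2 # 1 # replicate k 3" and ?j1.0=1 and ?j2.0=2])
    using A
    by (auto simp: pos_def tot_def codisc_def ks intro!: run_replicate_down[where s="L' 2 + L' 3"])
      (use nn in linarith)
qed

lemma edge_labels_cases:
  assumes "s \<in> edge_labels v w"
  obtains "v = V32" "w = V32" "s = mk3 [1] [1,2] [1,3]"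
  | "v = V32" "w = V32" "s = mk3 [1,3,2] [1,3] [1,2]"
  | "v = V32" "w = V33" "s = mk3 [3,1] [3] [3,2,1]"
  | "v = V32" "w = V33" "s = mk3 [2] [2,1] [2,1,3]"
  | k where "v = V32" "w = V33" "s = mk3 [2] (2 # 1 # replicate k 3) (2 # 1 # 3 # replicate k 3)" "k \<ge> 1"
  | "v = V33" "w = V33" "s = mk3 [1] [1,2] [1,3]"
  | "v = V33" "w = V33" "s = mk3 [2,1] [2] [2,3]"
  | k where "v = V33" "w = V33" "s = mk3 [1,2] (1 # replicate k 3) (1 # 3 # replicate k 3)" "k \<ge> 1"
  | k where "v = V33" "w = V33" "s = mk3 [2,1] (2 # replicate k 3) (2 # 3 # replicate k 3)" "k \<ge> 1"
  using assms
  by (cases v; cases w) (auto simp: edge_labels_V32_V32 edge_labels_V32_V33 edge_labels_V33_V32 edge_labels_V33_V33)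

lemma edge_induces:
  assumes "s \<in> edge_labels v w" "pos L'" "\<forall>a\<in>{1,2,3}. L a = mval s L' a"
  shows "\<exists>c e a. induces v L w L' s c e a"
proof -
  have L: "L 1 = mval s L' 1" "L 2 = mval s L' 2" "L 3 = mval s L' 3" using assms(3) by auto
  from assms(1) show ?thesis
  proof (cases rule: edge_labels_cases)
    case 1 with L assms(2) induces_alpha_V32[of L' L] show ?thesis by (auto simp: mval_def)
  next
    case 2 with L assms(2) induces_eta[of L' L] show ?thesis by (auto simp: mval_def)
  next
    case 3 with L assms(2) induces_beta[of L' L] show ?thesis by (auto simp: mval_def)
  next
    case 4 with L assms(2) induces_gamma[of L' L] show ?thesis by (auto simp: mval_def)
  next
    case (5 k) with L assms(2) induces_delta[of L' L k] show ?thesis by (auto simp: mval_def)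
  next
    case 6 with L assms(2) induces_alpha_V33[of L' L] show ?thesis by (auto simp: mval_def)
  next
    case 7 with L assms(2) induces_alpha'_V33[of L' L] show ?thesis by (auto simp: mval_def)
  next
    case (8 k) with L assms(2) induces_zeta[of L' L k] show ?thesis by (auto simp: mval_def)
  next
    case (9 k) with L assms(2) induces_zeta'[of L' L k] show ?thesis by (auto simp: mval_def)
  qed
qed

section \<open>Towers\<close>

abbreviation lies_in :: "vertex \<Rightarrow> (nat \<Rightarrow> real) \<Rightarrow> nat \<Rightarrow> real \<Rightarrow> bool" where
  "lies_in v L a x \<equiv> left v L a < x \<and> x < left v L a + L a"

lemma lies_in_unique:
  "pos L \<Longrightarrow> a \<in> {1,2,3} \<Longrightarrow> b \<in> {1,2,3} \<Longrightarrow> lies_in v L a x \<Longrightarrow> lies_in v L b x \<Longrightarrow> a = b"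
  using forward_det_left[of L v] unfolding forward_det_def by blast

lemma run_end_unique: "run lo len tr x w y \<Longrightarrow> run lo len tr x w z \<Longrightarrow> y = z"
  using run_end[of lo len tr x w y] run_end[of lo len tr x w z] by simp

text \<open>Disjointness is stated for points: a point \<open>z\<close> reached from the base by a
  proper prefix of a tower word determines the tower, the base point and the height. The last clause
  counts lengths by letters, whence the floors have total length \<open>tot L\<close>.\<close>

definition tower ::
  "vertex \<Rightarrow> (nat \<Rightarrow> real) \<Rightarrow> vertex \<Rightarrow> (nat \<Rightarrow> real) \<Rightarrow> morph \<Rightarrow> real \<Rightarrow> real \<Rightarrow> bool" where
  "tower v L w L' s c e \<longleftrightarrow>
     (e = 1 \<or> e = - 1) \<and>
     (\<forall>b\<in>{1,2,3}. \<forall>x. lies_in w L' b x \<longrightarrow> vrun v L (c + e * x) (s b) (c + e * (x + shift w L' b))) \<and>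
     (\<forall>b\<in>{1,2,3}. \<forall>b'\<in>{1,2,3}. \<forall>x x' u u' z. lies_in w L' b x \<longrightarrow> lies_in w L' b' x' \<longrightarrow>
        strict_prefix u (s b) \<longrightarrow> strict_prefix u' (s b') \<longrightarrow>
        vrun v L (c + e * x) u z \<longrightarrow> vrun v L (c + e * x') u' z \<longrightarrow> b = b' \<and> x = x' \<and> u = u') \<and>
     (\<forall>a\<in>{1,2,3}. L a = mval s L' a)"

lemma tower_run:
  assumes "tower v L w L' s c e" "b \<in> {1,2,3}" "lies_in w L' b x"
  shows "vrun v L (c + e * x) (s b) (c + e * (x + shift w L' b))"
  by (rule assms(1)[unfolded tower_def, THEN conjunct2, THEN conjunct1, rule_format, OF assms(2,3)])

lemma tower_disjoint:
  assumes "tower v L w L' s c e" "b \<in> {1,2,3}" "b' \<in> {1,2,3}" "lies_in w L' b x" "lies_in w L' b' x'"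
    "strict_prefix u (s b)" "strict_prefix u' (s b')" "vrun v L (c + e * x) u z" "vrun v L (c + e * x') u' z"
  shows "b = b' \<and> x = x' \<and> u = u'"
  by (rule assms(1)[unfolded tower_def, THEN conjunct2, THEN conjunct2, THEN conjunct1, rule_format, OF assms(2-)])

lemma tower_sign: "tower v L w L' s c e \<Longrightarrow> e = 1 \<or> e = - 1"
  unfolding tower_def by (elim conjE)

lemma tower_mval:
  assumes "tower v L w L' s c e" "a \<in> {1,2,3}"
  shows "L a = mval s L' a"
  by (rule assms(1)[unfolded tower_def, THEN conjunct2, THEN conjunct2, THEN conjunct2, rule_format, OF assms(2)])

lemma towerI:
  assumes "e = 1 \<or> e = - 1"
    and "\<And>b x. b \<in> {1,2,3} \<Longrightarrow> lies_in w L' b x \<Longrightarrow> vrun v L (c + e * x) (s b) (c + e * (x + shift w L' b))"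
    and "\<And>b b' x x' u u' z. b \<in> {1,2,3} \<Longrightarrow> b' \<in> {1,2,3} \<Longrightarrow> lies_in w L' b x \<Longrightarrow> lies_in w L' b' x' \<Longrightarrow>
        strict_prefix u (s b) \<Longrightarrow> strict_prefix u' (s b') \<Longrightarrow>
        vrun v L (c + e * x) u z \<Longrightarrow> vrun v L (c + e * x') u' z \<Longrightarrow> b = b' \<and> x = x' \<and> u = u'"
    and "\<And>a. a \<in> {1,2,3} \<Longrightarrow> L a = mval s L' a"
  shows "tower v L w L' s c e"
proof -
  have 1: "\<forall>b\<in>{1,2,3}. \<forall>x. lies_in w L' b x \<longrightarrow> vrun v L (c + e * x) (s b) (c + e * (x + shift w L' b))"
    by (intro ballI allI impI) (rule assms(2))
  have 2: "\<forall>b\<in>{1,2,3}. \<forall>b'\<in>{1,2,3}. \<forall>x x' u u' z. lies_in w L' b x \<longrightarrow> lies_in w L' b' x' \<longrightarrow>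
        strict_prefix u (s b) \<longrightarrow> strict_prefix u' (s b') \<longrightarrow>
        vrun v L (c + e * x) u z \<longrightarrow> vrun v L (c + e * x') u' z \<longrightarrow> b = b' \<and> x = x' \<and> u = u'"
    by (intro ballI allI impI) (rule assms(3))
  show ?thesis unfolding tower_def
    by (rule conjI[OF assms(1) conjI[OF 1 conjI[OF 2 ballI[OF assms(4)]]]])
qed

lemma tower_id: assumes "pos L" shows "tower v L v L (\<lambda>a. [a]) 0 1"
proof -
  have E: "u = []" if "strict_prefix u [b]" for u and b :: nat
    using that by (cases u) auto
  have D: "b = b' \<and> x = x' \<and> u = u'"
    if "b \<in> {1,2,3}" "b' \<in> {1,2,3}" "lies_in v L b x" "lies_in v L b' x'" "strict_prefix u [b]" "strict_prefix u' [b']"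
    "vrun v L (0 + 1 * x) u z" "vrun v L (0 + 1 * x') u' z" for b b' x x' u u' z
  proof -
    have "u = []" "u' = []" using E that(5,6) by blast+
    with that(7,8) have "x = x'" by simp
    with lies_in_unique[OF assms that(1,2)] that(3,4) \<open>u = []\<close> \<open>u' = []\<close> show ?thesis by blast
  qed
  have S: "vrun v L (0 + 1 * x) [b] (0 + 1 * (x + shift v L b))" if "b \<in> {1,2,3}" "lies_in v L b x" for b x
    using that by simp
  show ?thesis by (rule towerI[OF disjI1[OF refl] S D]) (auto simp: mval_def)
qed

lemma strict_prefix_append_cases:
  assumes "strict_prefix u (x @ y)"
  shows "strict_prefix u x \<or> (\<exists>u'. u = x @ u' \<and> strict_prefix u' y)"
  using assms by (induction x arbitrary: u) (auto simp: strict_prefix_def prefix_Cons)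

text \<open>Locates a floor of a composed tower: the prefix ends inside the image of one letter
  \<open>d\<close>, after the complete images of \<open>w0\<close>.\<close>

lemma strict_prefix_morph_word:
  assumes "strict_prefix u (morph_word s w)"
  shows "\<exists>w0 d w1 u1. w = w0 @ d # w1 \<and> u = morph_word s w0 @ u1 \<and> strict_prefix u1 (s d)"
  using assms
proof (induction w arbitrary: u)
  case (Cons a w)
  then have "strict_prefix u (s a) \<or> (\<exists>u'. u = s a @ u' \<and> strict_prefix u' (morph_word s w))"
    using strict_prefix_append_cases by simp
  then show ?case
  proof
    assume "strict_prefix u (s a)"
    then have "a # w = [] @ a # w \<and> u = morph_word s [] @ u \<and> strict_prefix u (s a)" by simp
    then show ?thesis by blast
  next
    assume "\<exists>u'. u = s a @ u' \<and> strict_prefix u' (morph_word s w)"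
    then obtain u' where u': "u = s a @ u'" "strict_prefix u' (morph_word s w)" by blast
    from Cons.IH[OF u'(2)] obtain w0 d w1 u1 where
      "w = w0 @ d # w1 \<and> u' = morph_word s w0 @ u1 \<and> strict_prefix u1 (s d)" by blast
    with u' have "a # w = (a # w0) @ d # w1 \<and> u = morph_word s (a # w0) @ u1 \<and> strict_prefix u1 (s d)" by simp
    then show ?thesis by blast
  qed
qed simp

lemma count_list_morph_word:
  assumes "set w \<subseteq> {1,2,3}"
  shows "count_list (morph_word s w) a =
    count_list w 1 * count_list (s 1) a + count_list w 2 * count_list (s 2) a + count_list w 3 * count_list (s 3) a"
  using assms by (induction w) (auto simp: algebra_simps)

lemma mval_mcomp:
  assumes "set (s 1) \<union> set (s 2) \<union> set (s 3) \<subseteq> {1,2,3}"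
  shows "mval (mcomp t s) L a = mval t (mval s L) a"
proof -
  have "count_list (mcomp t s b) a = count_list (s b) 1 * count_list (t 1) a + count_list (s b) 2 * count_list (t 2) a
      + count_list (s b) 3 * count_list (t 3) a" if "b \<in> {1,2,3}" for b
    unfolding mcomp_def by (rule count_list_morph_word) (use assms that in auto)
  then have "count_list (mcomp t s 1) a = count_list (s 1) 1 * count_list (t 1) a + count_list (s 1) 2 * count_list (t 2) a
      + count_list (s 1) 3 * count_list (t 3) a" "count_list (mcomp t s 2) a = count_list (s 2) 1 * count_list (t 1) a + count_list (s 2) 2 * count_list (t 2) a
      + count_list (s 2) 3 * count_list (t 3) a" "count_list (mcomp t s 3) a = count_list (s 3) 1 * count_list (t 1) a + count_list (s 3) 2 * count_list (t 2) a
      + count_list (s 3) 3 * count_list (t 3) a" by blast+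
  then show ?thesis by (simp add: mval_def algebra_simps)
qed

lemma lies_in_exists: "pos L \<Longrightarrow> a \<in> {1,2,3} \<Longrightarrow> \<exists>x. lies_in v L a x"
  by (rule exI[of _ "left v L a + L a / 2"]) (auto simp: pos_def)

lemma lies_in_range: "pos L \<Longrightarrow> a \<in> {1,2,3} \<Longrightarrow> lies_in v L a x \<Longrightarrow> 0 < x \<and> x < tot L"
  using left_range by blast

lemma induces_run:
  assumes "induces v L w L' s c e a" "b \<in> {1,2,3}" "lies_in w L' b x"
  shows "vrun v L (c + e * x) (s b) (c + e * (x + shift w L' b))"
  by (rule assms(1)[unfolded induces_def, THEN conjunct2, THEN conjunct2, THEN conjunct2, THEN conjunct2, THEN conjunct1, rule_format, OF assms(2,3)])

lemma induces_base:
  assumes "induces v L w L' s c e a" "0 < x" "x < tot L'"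
  shows "lies_in v L a (c + e * x)"
  using assms(1)[unfolded induces_def, THEN conjunct2, THEN conjunct2, THEN conjunct2, THEN conjunct1, rule_format, of x] assms(2,3) by blast

lemma induces_return_word:
  assumes "induces v L w L' s c e a" "b \<in> {1,2,3}"
  shows "\<exists>u. s b = a # u \<and> a \<notin> set u"
  by (rule assms(1)[unfolded induces_def, THEN conjunct2, THEN conjunct2, THEN conjunct1, rule_format, OF assms(2)])

lemma induces_sign: "induces v L w L' s c e a \<Longrightarrow> e = 1 \<or> e = - 1"
  unfolding induces_def by (elim conjE)

lemma induces_letter: "induces v L w L' s c e a \<Longrightarrow> a \<in> {1,2,3}"
  unfolding induces_def by (elim conjE)

lemma induces_codisc:
  assumes "induces v L w L' s c e a"
  obtains q u where "\<forall>i\<in>{1,2}. a \<notin> set (u i) \<and> vrun v L (codisc L (q i)) (u i) (c + e * codisc L' i)" "q ` {1,2} = {1,2::nat}"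
  using assms unfolding induces_def by (elim conjE exE)

lemma induces_disc:
  assumes "induces v L w L' s c e a"
  obtains q u where "\<forall>i\<in>{1,2}. u i \<noteq> [] \<and> vrun v L (c + e * disc w L' i) (u i) (disc v L (q i))" "q ` {1,2} = {1,2::nat}"
  using assms unfolding induces_def by (elim conjE exE)

lemma induces_letters:
  assumes "induces v L w L' s c e a" "pos L'" "b \<in> {1,2,3}"
  shows "set (s b) \<subseteq> {1,2,3}"
  using lies_in_exists[OF assms(2,3), of w] induces_run[OF assms(1,3)] run_letters by blast

lemma induces_tail:
  assumes "induces v L w L' s c e a" "b \<in> {1,2,3}" "s b = u @ d # u'" "u \<noteq> []"
  shows "d \<noteq> a"
proof -
  obtain r where "s b = a # r" "a \<notin> set r" using induces_return_word[OF assms(1,2)] by blast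
  with assms(3,4) show ?thesis by (cases u) auto
qed

text \<open>By backward determinism the longer run starts with a word \<open>r\<close> that leads
  from one base point to the other. At the second base point the letter read is \<open>a\<close>; if
  \<open>r\<close> were nonempty, the return word of \<open>b'\<close> would contain
  \<open>a\<close> a second time.\<close>

lemma induces_disjoint:
  assumes "induces v L w L' s c e a" "pos L" "pos L'"
    and b: "b \<in> {1,2,3}" "b' \<in> {1,2,3}" "lies_in w L' b x" "lies_in w L' b' x'"
    and w: "s b = w0 @ d # w1" "s b' = w0' @ d # w1'"
    and y: "vrun v L (c + e * x) w0 y" "vrun v L (c + e * x') w0' y" "lies_in v L d y"
    and le: "length w0 \<le> length w0'"
  shows "b = b' \<and> x = x' \<and> w0 = w0'"
proof -
  obtain r where r: "w0' = r @ w0" "vrun v L (c + e * x') r (c + e * x)"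
    using run_codet[OF backward_det_left[OF assms(2)] y(1,2) le] by blast
  note a = induces_letter[OF assms(1)] induces_sign[OF assms(1)]
  have base: "lies_in v L a (c + e * x)"
    using induces_base[OF assms(1)] lies_in_range[OF assms(3) b(1,3)] by blast
  have d: "d \<in> {1,2,3}" using induces_letters[OF assms(1,3) b(1)] w by auto
  \<comment> \<open>\<open>h\<close> is the letter of \<open>s b'\<close> just after
    \<open>r\<close>; it is \<open>d\<close> itself when \<open>w0\<close> is empty.\<close>
  obtain h w2 where h: "w0 @ d # w1' = h # w2" by (cases w0) auto
  have "h \<in> {1,2,3} \<and> lies_in v L h (c + e * x)"
    using h y(1,3) d by (cases w0) auto
  then have "h = a" using lies_in_unique[OF assms(2)] base a by blast
  have "r = []"
  proof (rule ccontr)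
    assume "r \<noteq> []"
    with induces_tail[OF assms(1) b(2), of r h w2] w(2) r(1) h \<open>h = a\<close> show False by simp
  qed
  with r have "c + e * x' = c + e * x" "w0 = w0'" by auto
  then have "x = x'" using a by auto
  with lies_in_unique[OF assms(3) b(1,2)] b(3,4) \<open>w0 = w0'\<close> show ?thesis by blast
qed

lemma morph_word_run:
  assumes sim: "\<And>b x. b \<in> {1,2,3} \<Longrightarrow> lies_in w L' b x \<Longrightarrow> vrun v L (c + e * x) (s b) (c + e * (x + shift w L' b))"
    and "vrun w L' x u y"
  shows "vrun v L (c + e * x) (morph_word s u) (c + e * y)"
  using assms(2)
proof (induction u arbitrary: x)
  case (Cons b u)
  then have b: "b \<in> {1,2,3}" "lies_in w L' b x" "vrun w L' (x + shift w L' b) u y" by auto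
  with sim[OF b(1,2)] Cons.IH[OF b(3)] show ?case unfolding morph_word_simps run_append by blast
qed simp

text \<open>A floor of the composed tower is a floor of the tower of \<open>t\<close> over a letter
  \<open>d\<close> of a return word. Uniqueness is applied twice: disjointness of the given tower
  recovers \<open>d\<close>, the point \<open>y\<close> and the inner height, then
  \<open>induces_disjoint\<close> recovers the base point and the position in the return
  word.\<close>

lemma tower_comp:
  assumes T: "tower v0 L0 v L t c e" and I: "induces v L w L' s c' e' a"
    and M: "\<forall>a\<in>{1,2,3}. L a = mval s L' a" and P: "pos L" "pos L'"
  shows "tower v0 L0 w L' (mcomp t s) (c + e * c') (e * e')"
proof -
  let ?f = "\<lambda>x. c + e * c' + e * e' * x"
  have f: "?f x = c + e * (c' + e' * x)" for x by (simp add: algebra_simps)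
  have e: "e = 1 \<or> e = - 1" "e' = 1 \<or> e' = - 1" by (rule tower_sign[OF T], rule induces_sign[OF I])
  have 1: "vrun v0 L0 (?f x) (mcomp t s b) (?f (x + shift w L' b))" if "b \<in> {1,2,3}" "lies_in w L' b x" for b x
    unfolding f mcomp_def
    by (rule morph_word_run[OF tower_run[OF T] induces_run[OF I that]])
  have decomp: "\<exists>w0 d w1 u1 y. s b = w0 @ d # w1 \<and> u = morph_word t w0 @ u1 \<and> strict_prefix u1 (t d) \<and> d \<in> {1,2,3} \<and>
      vrun v L (c' + e' * x) w0 y \<and> lies_in v L d y \<and> vrun v0 L0 (c + e * y) u1 z"
    if A: "b \<in> {1,2,3}" "lies_in w L' b x" "strict_prefix u (mcomp t s b)" "vrun v0 L0 (?f x) u z" for b x u z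
  proof -
    obtain w0 d w1 u1 where w: "s b = w0 @ d # w1" "u = morph_word t w0 @ u1" "strict_prefix u1 (t d)"
      using strict_prefix_morph_word A(3) unfolding mcomp_def by blast
    obtain y where y: "vrun v L (c' + e' * x) w0 y" "d \<in> {1,2,3}" "lies_in v L d y"
      using induces_run[OF I A(1,2)] unfolding w(1) run_append run.simps by blast
    have "vrun v0 L0 (?f x) (morph_word t w0) (c + e * y)"
      unfolding f by (rule morph_word_run[OF tower_run[OF T] y(1)])
    moreover obtain y' where "vrun v0 L0 (?f x) (morph_word t w0) y'" "vrun v0 L0 y' u1 z"
      using A(4) unfolding w(2) run_append by blast
    ultimately have "vrun v0 L0 (c + e * y) u1 z" using run_end_unique by metis
    with w y show ?thesis
      by (intro exI[of _ w0] exI[of _ d] exI[of _ w1] exI[of _ u1] exI[of _ y]) simp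
  qed
  have 2: "b = b' \<and> x = x' \<and> u = u'"
    if A: "b \<in> {1,2,3}" "b' \<in> {1,2,3}" "lies_in w L' b x" "lies_in w L' b' x'" "strict_prefix u (mcomp t s b)"
      "strict_prefix u' (mcomp t s b')" "vrun v0 L0 (?f x) u z" "vrun v0 L0 (?f x') u' z" for b b' x x' u u' z
  proof -
    obtain w0 d w1 u1 y where D: "s b = w0 @ d # w1" "u = morph_word t w0 @ u1" "strict_prefix u1 (t d)" "d \<in> {1,2,3}"
      "vrun v L (c' + e' * x) w0 y" "lies_in v L d y" "vrun v0 L0 (c + e * y) u1 z"
      using decomp[OF A(1,3,5,7)] by (elim exE conjE) (rule that; (intro conjI)?; assumption)
    obtain w0' d' w1' u1' y' where D': "s b' = w0' @ d' # w1'" "u' = morph_word t w0' @ u1'" "strict_prefix u1' (t d')" "d' \<in> {1,2,3}"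
      "vrun v L (c' + e' * x') w0' y'" "lies_in v L d' y'" "vrun v0 L0 (c + e * y') u1' z"
      using decomp[OF A(2,4,6,8)] by (elim exE conjE) (rule that; (intro conjI)?; assumption)
    have E: "d = d'" "y = y'" "u1 = u1'" using tower_disjoint[OF T D(4) D'(4) D(6) D'(6) D(3) D'(3) D(7) D'(7)] by blast+
    have "b = b' \<and> x = x' \<and> w0 = w0'"
    proof (cases "length w0 \<le> length w0'")
      case True
      show ?thesis by (rule induces_disjoint[OF I P A(1,2,3,4) D(1) D'(1)[folded E(1)] D(5) D'(5)[folded E(2)] D(6) True])
    next
      case False
      then have "length w0' \<le> length w0" by simp
      from induces_disjoint[OF I P A(2,1,4,3) D'(1) D(1)[unfolded E(1)] D'(5) D(5)[unfolded E(2)] D'(6) this] show ?thesis by blast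
    qed
    then show ?thesis unfolding D(2) D'(2) E(3) by blast
  qed
  have 3: "L0 a = mval (mcomp t s) L' a" if "a \<in> {1,2,3}" for a
  proof -
    have "L0 a = mval t L a" by (rule tower_mval[OF T that])
    also have "\<dots> = mval t (mval s L') a" using M by (simp add: mval_def[of t])
    also have "\<dots> = mval (mcomp t s) L' a"
      using induces_letters[OF I P(2)] by (intro mval_mcomp[symmetric]) auto
    finally show ?thesis .
  qed
  have 4: "e * e' = 1 \<or> e * e' = - 1" using e by auto
  show ?thesis by (rule towerI[OF 4 1 2 3])
qed

lemma tower_letters:
  assumes "tower v L w L' s c e" "pos L'" "b \<in> {1,2,3}"
  shows "set (s b) \<subseteq> {1,2,3}"
  using lies_in_exists[OF assms(2,3), of w] tower_run[OF assms(1,3)] run_letters by blast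

text \<open>Summing letter counts over the alphabet gives word lengths, so the floors of all towers
  together have the full length.\<close>

lemma tower_tot:
  assumes "tower v L w L' s c e" "pos L'"
  shows "tot L = real (length (s 1)) * L' 1 + real (length (s 2)) * L' 2 + real (length (s 3)) * L' 3"
proof -
  have len: "length u = count_list u 1 + count_list u 2 + count_list u 3" if "set u \<subseteq> {1,2,3}" for u :: "nat list"
    using that by (induction u) auto
  have L: "L 1 = mval s L' 1" "L 2 = mval s L' 2" "L 3 = mval s L' 3" using tower_mval[OF assms(1)] by auto
  show ?thesis unfolding tot_def L mval_def
    using len[OF tower_letters[OF assms, of 1]] len[OF tower_letters[OF assms, of 2]] len[OF tower_letters[OF assms, of 3]]
    by (simp add: algebra_simps)
qed

lemma sequence_tower:
  assumes E: "\<And>n. t n \<in> edge_labels (v n) (v (Suc n))" and P: "\<And>n. pos (\<Lambda> n)"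
    and M: "\<And>n. \<forall>a\<in>{1,2,3}. \<Lambda> n a = mval (t n) (\<Lambda> (Suc n)) a"
  shows "\<exists>c e. tower (v m) (\<Lambda> m) (v (m + n)) (\<Lambda> (m + n)) (mprod t m n) c e"
proof (induction n)
  case 0
  then show ?case using tower_id[OF P] by auto
next
  case (Suc n)
  then obtain c e where T: "tower (v m) (\<Lambda> m) (v (m + n)) (\<Lambda> (m + n)) (mprod t m n) c e" by blast
  obtain c' e' a where I: "induces (v (m + n)) (\<Lambda> (m + n)) (v (Suc (m + n))) (\<Lambda> (Suc (m + n))) (t (m + n)) c' e' a"
    using edge_induces[OF E P M] by blast
  from tower_comp[OF T I M P P] show ?case by auto
qed

section \<open>Languages and connections\<close>

lemma run_open_cylinder:
  assumes "run lo len tr x w y"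
  shows "\<exists>d>0. \<forall>x'. \<bar>x' - x\<bar> < d \<longrightarrow> (\<exists>y'. run lo len tr x' w y')"
  using assms
proof (induction w arbitrary: x)
  case Nil
  then show ?case by (intro exI[of _ 1]) auto
next
  case (Cons a w)
  have "run lo len tr (x + tr a) w y" using Cons.prems by simp
  from Cons.IH[OF this] obtain d where
    d: "d > 0" "\<forall>x'. \<bar>x' - (x + tr a)\<bar> < d \<longrightarrow> (\<exists>y'. run lo len tr x' w y')" by blast
  from Cons.prems have a: "a \<in> {1,2,3}" "lo a < x" "x < lo a + len a" by auto
  let ?d = "min d (min (x - lo a) (lo a + len a - x))"
  have "\<exists>y'. run lo len tr x' (a # w) y'" if "\<bar>x' - x\<bar> < ?d" for x'
  proof -
    have "\<bar>(x' + tr a) - (x + tr a)\<bar> < d" using that by simp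
    with d(2) obtain y' where "run lo len tr (x' + tr a) w y'" by blast
    moreover have "lo a < x'" "x' < lo a + len a" using that by linarith+
    ultimately show ?thesis using a by auto
  qed
  moreover have "?d > 0" using a d by simp
  ultimately show ?case by blast
qed

lemma disjoint_intervals_length:
  fixes lw len :: "'i \<Rightarrow> real"
  assumes "finite F" "disjoint_family_on (\<lambda>i. {lw i <..< lw i + len i}) F"
    and "\<And>i. i \<in> F \<Longrightarrow> 0 \<le> len i" "\<And>i. i \<in> F \<Longrightarrow> {lw i <..< lw i + len i} \<subseteq> {0<..<T}" "0 \<le> T"
  shows "(\<Sum>i\<in>F. len i) \<le> T"
proof -
  have "(\<Sum>i\<in>F. len i) = (\<Sum>i\<in>F. measure lborel {lw i <..< lw i + len i})"
    using assms(3) by (intro sum.cong) auto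
  also have "\<dots> = measure lborel (\<Union>i\<in>F. {lw i <..< lw i + len i})"
    using assms by (intro measure_finite_Union[symmetric]) (auto simp: emeasure_lborel_Ioo)
  also have "\<dots> \<le> measure lborel {0<..<T}"
    by (rule measure_mono_fmeasurable) (use assms in \<open>auto simp: fmeasurable_def\<close>)
  also have "\<dots> = T" using assms(5) by simp
  finally show ?thesis .
qed

text \<open>The levels of a tower below its top \<open>length w\<close> floors avoid the cylinder of a word \<open>w\<close> that does not
  occur in the tower words; all these sets are disjoint, so the cylinder is short.\<close>
lemma tower_cylinder_length:
  assumes T: "tower v L w L' s c e" and P: "pos L" "pos L'"
    and cyl: "\<And>x. p < x \<Longrightarrow> x < q \<Longrightarrow> \<exists>y. vrun v L x u y" and pq: "p \<le> q"
    and no: "\<And>b. b \<in> {1,2,3} \<Longrightarrow> \<not> sublist u (s b)"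
  shows "q - p \<le> real (length u) * tot L'"
proof -
  define \<delta> where "\<delta> b j = sum_list (map (shift v L) (take j (s b)))" for b j
  \<comment> \<open>Index \<open>(0, 0)\<close> stands for the cylinder and \<open>(b, j)\<close>
    for floor \<open>j\<close> of tower \<open>b\<close>. For a reflecting embedding the left end of
    a floor comes from the right end of the base.\<close>
  define lw where "lw i = (case i of (b, j) \<Rightarrow> if b = 0 then p else
    (if e = 1 then c + left w L' b + \<delta> b j else c - left w L' b - L' b + \<delta> b j))" for i
  define len where "len i = (case i of (b, j::nat) \<Rightarrow> if b = 0 then q - p else L' b)" for i
  \<comment> \<open>Only floors from which all letters of \<open>u\<close> could still be read
    inside the tower are kept.\<close>
  define G where "G = Sigma {1,2,3::nat} (\<lambda>b. {..<length (s b) - length u})"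
  let ?A = "\<lambda>i. {lw i <..< lw i + len i}"
  have e: "e = 1 \<or> e = - 1" by (rule tower_sign[OF T])
  have u: "u \<noteq> []" using no[of 1] by auto
  have level: "\<exists>x. lies_in w L' b x \<and> vrun v L (c + e * x) (take j (s b)) z \<and> (\<exists>y. vrun v L z (drop j (s b)) y)"
    if A: "(b, j) \<in> G" "z \<in> ?A (b, j)" for b j z
  proof -
    have b: "b \<in> {1,2,3}" "b \<noteq> 0" using A(1) unfolding G_def by auto
    define x where "x = e * (z - \<delta> b j - c)"
    have x: "lies_in w L' b x" "z = c + e * x + \<delta> b j"
      using A(2) e b(2) by (auto simp: x_def lw_def len_def)
    obtain z' y where z': "vrun v L (c + e * x) (take j (s b)) z'" "vrun v L z' (drop j (s b)) y"
      using run_take[OF tower_run[OF T b(1) x(1)]] by blast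
    have "z' = z" using run_end[OF z'(1)] x(2) unfolding \<delta>_def by simp
    with z' x show ?thesis by blast
  qed
  have cylz: "\<exists>y. vrun v L z u y" if "z \<in> ?A (0, j)" for z j
    using that cyl by (auto simp: lw_def len_def)
  have Gb: "b \<in> {1,2,3}" "j + length u < length (s b)" if "(b, j) \<in> G" for b j
    using that by (auto simp: G_def)
  have D1: "b = b' \<and> j = j'" if A: "(b, j) \<in> G" "(b', j') \<in> G" "z \<in> ?A (b, j)" "z \<in> ?A (b', j')" for b j b' j' z
  proof -
    obtain x where x: "lies_in w L' b x" "vrun v L (c + e * x) (take j (s b)) z" using level[OF A(1,3)] by blast
    obtain x' where x': "lies_in w L' b' x'" "vrun v L (c + e * x') (take j' (s b')) z" using level[OF A(2,4)] by blast
    have j: "j < length (s b)" "j' < length (s b')" using Gb(2) A by fastforce+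
    then have "strict_prefix (take j (s b)) (s b)" "strict_prefix (take j' (s b')) (s b')"
      by (auto simp: strict_prefix_def take_is_prefix)
    from tower_disjoint[OF T Gb(1)[OF A(1)] Gb(1)[OF A(2)] x(1) x'(1) this x(2) x'(2)]
    have E: "b = b'" "take j (s b) = take j' (s b')" by blast+
    have "length (take j (s b)) = j" "length (take j' (s b')) = j'" using j by simp_all
    with E show ?thesis by simp
  qed
  \<comment> \<open>A point shared with the cylinder would read \<open>u\<close> inside the tower
    word.\<close>
  have D2: False if A: "(b, j) \<in> G" "z \<in> ?A (b, j)" "z \<in> ?A (0, 0)" for b j z
  proof -
    obtain y where y: "vrun v L z (drop j (s b)) y" using level[OF A(1,2)] by blast
    obtain y' where y': "vrun v L z u y'" using cylz[OF A(3)] by blast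
    have "length u \<le> length (drop j (s b))" using Gb(2)[OF A(1)] by simp
    from run_det[OF forward_det_left[OF P(1)] y' y this] obtain r where "drop j (s b) = u @ r" by blast
    then have "s b = take j (s b) @ u @ r" by (metis append_take_drop_id)
    then have "sublist u (s b)" by (metis sublist_appendI)
    with no Gb(1)[OF A(1)] show False by blast
  qed
  have first: "0 < z \<and> z < tot L" if "vrun v L z (a # r) y" for z a r y
    using that lies_in_range[OF P(1)] by auto
  have "(\<Sum>i\<in>insert (0,0) G. len i) \<le> tot L"
  proof (rule disjoint_intervals_length[where lw = lw])
    show "finite (insert (0,0) G)" unfolding G_def by simp
    show "disjoint_family_on ?A (insert (0,0) G)"
      unfolding disjoint_family_on_def
    proof (intro ballI impI)
      fix i i' assume i: "i \<in> insert (0,0) G" "i' \<in> insert (0,0) G" "i \<noteq> i'"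
      obtain b j b' j' where ij: "i = (b, j)" "i' = (b', j')" by fastforce
      show "?A i \<inter> ?A i' = {}"
      proof (rule ccontr)
        assume "?A i \<inter> ?A i' \<noteq> {}"
        then obtain z where z: "z \<in> ?A i" "z \<in> ?A i'" by blast
        show False
        proof (cases "i \<in> G \<and> i' \<in> G")
          case True then show False using D1 z i(3) unfolding ij by blast
        next
          case False
          then show False using D2 z i unfolding ij by blast
        qed
      qed
    qed
    show "0 \<le> len i" if "i \<in> insert (0,0) G" for i
      using that P(2) pq by (auto simp: len_def G_def pos_def)
    show "?A i \<subseteq> {0<..<tot L}" if "i \<in> insert (0,0) G" for i
    proof
      fix z assume z: "z \<in> ?A i"
      obtain b j where ij: "i = (b, j)" by fastforce
      show "z \<in> {0<..<tot L}"
      proof (cases "i \<in> G")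
        case True
        have "drop j (s b) \<noteq> []" using Gb(2) True unfolding ij by fastforce
        moreover obtain y where "vrun v L z (drop j (s b)) y" using level z True unfolding ij by blast
        ultimately show ?thesis using first by (cases "drop j (s b)") auto
      next
        case False
        then have "i = (0,0)" using that by blast
        then obtain y where "vrun v L z u y" using cylz z by blast
        with u first show ?thesis by (cases u) auto
      qed
    qed
    show "0 \<le> tot L" using P(1) by (simp add: tot_def pos_def)
  qed
  moreover have "(\<Sum>i\<in>insert (0,0) G. len i) = (q - p) + (\<Sum>i\<in>G. len i)"
    by (subst sum.insert) (auto simp: G_def len_def)
  moreover have "(\<Sum>i\<in>G. len i) = (\<Sum>b\<in>{1,2,3}. \<Sum>j<length (s b) - length u. len (b, j))"
    unfolding G_def by (subst sum.Sigma) auto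
  moreover have "(\<Sum>b\<in>{1,2,3}. \<Sum>j<length (s b) - length u. len (b, j)) =
     real (length (s 1) - length u) * L' 1 + real (length (s 2) - length u) * L' 2 + real (length (s 3) - length u) * L' 3"
    by (simp add: len_def)
  \<comment> \<open>Subtraction of naturals truncates at 0 for towers lower than
    \<open>length u\<close>; the real difference is then nonpositive, so the bound still
    holds.\<close>
  moreover have "(real (length (s b)) - real (length u)) * L' b \<le> real (length (s b) - length u) * L' b" if "b \<in> {1,2,3}" for b
    by (rule mult_right_mono) (use that P(2) in \<open>auto simp: pos_def\<close>)
  from this[of 1] this[of 2] this[of 3] have
    "real (length (s 1)) * L' 1 + real (length (s 2)) * L' 2 + real (length (s 3)) * L' 3 - real (length u) * tot L'
     \<le> real (length (s 1) - length u) * L' 1 + real (length (s 2) - length u) * L' 2 + real (length (s 3) - length u) * L' 3"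
    by (simp add: tot_def algebra_simps)
  ultimately show ?thesis using tower_tot[OF T P(2)] by linarith
qed

lemma language_sequence:
  assumes E: "\<And>n. t n \<in> edge_labels (v n) (v (Suc n))" and P: "\<And>n. pos (\<Lambda> n)"
    and M: "\<And>n. \<forall>a\<in>{1,2,3}. \<Lambda> n a = mval (t n) (\<Lambda> (Suc n)) a"
    and lim: "\<And>\<epsilon>. \<epsilon> > 0 \<Longrightarrow> \<exists>n. tot (\<Lambda> n) < \<epsilon>"
  shows "(\<exists>x y. vrun (v 0) (\<Lambda> 0) x u y) \<longleftrightarrow> (\<exists>n. \<exists>b\<in>{1,2,3}. sublist u (mprod t 0 n b))"
proof
  assume "\<exists>x y. vrun (v 0) (\<Lambda> 0) x u y"
  then obtain x y where "vrun (v 0) (\<Lambda> 0) x u y" by blast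
  from run_open_cylinder[OF this] obtain d where d: "d > 0"
    "\<And>x'. \<bar>x' - x\<bar> < d \<Longrightarrow> \<exists>y'. vrun (v 0) (\<Lambda> 0) x' u y'" by blast
  \<comment> \<open>The extra 1 makes the final bound strictly smaller than \<open>d\<close> and
    avoids division by 0 for the empty word.\<close>
  have "d / (real (length u) + 1) > 0" using d by simp
  from lim[OF this] obtain n where n: "tot (\<Lambda> n) < d / (real (length u) + 1)" by blast
  from sequence_tower[where v = v and \<Lambda> = \<Lambda> and t = t and m = 0 and n = n, OF E P M] obtain c e
    where T: "tower (v 0) (\<Lambda> 0) (v n) (\<Lambda> n) (mprod t 0 n) c e" by auto
  show "\<exists>n. \<exists>b\<in>{1,2,3}. sublist u (mprod t 0 n b)"
  proof (rule ccontr)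
    assume "\<not> ?thesis"
    then have no: "\<not> sublist u (mprod t 0 n b)" if "b \<in> {1,2,3}" for b using that by blast
    have "(x + d) - x \<le> real (length u) * tot (\<Lambda> n)"
      by (rule tower_cylinder_length[OF T P P _ _ no]) (use d in auto)
    also have "\<dots> \<le> real (length u) * (d / (real (length u) + 1))"
      using n by (intro mult_left_mono) auto
    also have "\<dots> < d" using d(1) by (simp add: field_simps)
    finally show False by simp
  qed
next
  assume "\<exists>n. \<exists>b\<in>{1,2,3}. sublist u (mprod t 0 n b)"
  then obtain n b where b: "b \<in> {1,2,3}" "sublist u (mprod t 0 n b)" by blast
  from sequence_tower[where v = v and \<Lambda> = \<Lambda> and t = t and m = 0 and n = n, OF E P M] obtain c e
    where T: "tower (v 0) (\<Lambda> 0) (v n) (\<Lambda> n) (mprod t 0 n) c e" by auto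
  obtain x where x: "lies_in (v n) (\<Lambda> n) b x" using lies_in_exists[OF P b(1)] by blast
  obtain r r' where r: "mprod t 0 n b = r @ u @ r'" using b(2) unfolding sublist_def by blast
  show "\<exists>x y. vrun (v 0) (\<Lambda> 0) x u y"
    using tower_run[OF T b(1) x] unfolding r run_append by blast
qed

section \<open>Connections and their transport along an edge\<close>

definition connection_free :: "vertex \<Rightarrow> (nat \<Rightarrow> real) \<Rightarrow> bool" where
  "connection_free v L \<longleftrightarrow> (\<forall>i\<in>{1,2}. \<forall>j\<in>{1,2}. \<forall>u. \<not> vrun v L (codisc L i) u (disc v L j))"

text \<open>The image of a connection of the induced exchange is prolonged at both ends by the
  joining words of \<open>induces\<close> until it reaches marked points of
  \<open>L\<close>.\<close>

lemma connection_free_induced: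
  assumes I: "induces v L w L' s c e a" and nc: "connection_free v L"
  shows "connection_free w L'"
  unfolding connection_free_def
proof (intro ballI allI notI)
  fix i j u assume i: "i \<in> {1,2::nat}" "j \<in> {1,2::nat}" and u: "vrun w L' (codisc L' i) u (disc w L' j)"
  obtain q r where q: "\<forall>i\<in>{1,2}. a \<notin> set (r i) \<and> vrun v L (codisc L (q i)) (r i) (c + e * codisc L' i)" "q ` {1,2} = {1,2::nat}"
    by (rule induces_codisc[OF I])
  obtain q' r' where q': "\<forall>i\<in>{1,2}. r' i \<noteq> [] \<and> vrun v L (c + e * disc w L' i) (r' i) (disc v L (q' i))" "q' ` {1,2} = {1,2::nat}"
    by (rule induces_disc[OF I])
  have "vrun v L (c + e * codisc L' i) (morph_word s u) (c + e * disc w L' j)"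
    by (rule morph_word_run[OF induces_run[OF I] u])
  then have "vrun v L (codisc L (q i)) (r i @ morph_word s u @ r' j) (disc v L (q' j))"
    unfolding run_append using q(1) q'(1) i by blast
  moreover have "q i \<in> {1,2}" "q' j \<in> {1,2}" using q(2) q'(2) i by blast+
  ultimately show False using nc unfolding connection_free_def by blast
qed

text \<open>Return words are peeled off the run one at a time. If less than a full return word
  remains, its end point lies in the base although the next return has not happened, so nothing
  remains at all. The index \<open>j'\<close> may differ from \<open>j\<close> because the induced
  orbit stops at the first discontinuity that it meets.\<close>

lemma desubstitute_connection:
  assumes I: "induces v L w L' s c e a" and P: "pos L" "pos L'"
    and "0 < x" "x < tot L'" "j \<in> {1,2}" "vrun v L (c + e * x) u (c + e * disc w L' j)"
  shows "\<exists>u' j'. j' \<in> {1,2} \<and> vrun w L' x u' (disc w L' j') \<and> length u' \<le> length u"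
  using assms(4-)
proof (induction "length u" arbitrary: u x rule: less_induct)
  case less
  from less.prems(1,2) show ?case
  proof (cases rule: interior_cases[of x L' w])
    case (1 i)
    then show ?thesis by (intro exI[of _ "[]"] exI[of _ i]) simp
  next
    case (2 b)
    have run: "vrun v L (c + e * x) (s b) (c + e * (x + shift w L' b))"
      using induces_run[OF I 2(1)] 2(2,3) by blast
    obtain r where r: "s b = a # r" "a \<notin> set r" using induces_return_word[OF I 2(1)] by blast
    show ?thesis
    proof (cases "length (s b) \<le> length u")
      case True
      from run_det[OF forward_det_left[OF P(1)] run less.prems(4) True] obtain u1 where
        u1: "u = s b @ u1" "vrun v L (c + e * (x + shift w L' b)) u1 (c + e * disc w L' j)" by blast
      have "0 < x + shift w L' b" "x + shift w L' b < tot L'" using left_range[OF P(2) 2(1)] 2(2,3) by blast+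
      from less.hyps[OF _ this less.prems(3) u1(2)] obtain u' j' where
        u': "j' \<in> {1,2}" "vrun w L' (x + shift w L' b) u' (disc w L' j')" "length u' \<le> length u1"
        using u1(1) r by auto
      have "vrun w L' x (b # u') (disc w L' j')" using u'(2) 2 by simp
      moreover have "length (b # u') \<le> length u" using u'(3) u1(1) r by simp
      ultimately show ?thesis using u'(1) by blast
    next
      case False
      then have le: "length u \<le> length (s b)" by simp
      from run_det[OF forward_det_left[OF P(1)] less.prems(4) run le] obtain u1 where
        u1: "s b = u @ u1" "vrun v L (c + e * disc w L' j) u1 (c + e * (x + shift w L' b))" by blast
      obtain h u2 where h: "u1 = h # u2" using False u1(1) by (cases u1) auto
      have "h \<in> {1,2,3}" "lies_in v L h (c + e * disc w L' j)" using u1(2) h by auto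
      moreover have "lies_in v L a (c + e * disc w L' j)"
        using induces_base[OF I] disc_range[OF P(2) less.prems(3)] by blast
      ultimately have "h = a" using lies_in_unique[OF P(1)] induces_letter[OF I] by blast
      then have "u = []" using induces_tail[OF I 2(1)] u1(1) h by blast
      then have "x = disc w L' j" using less.prems(4) induces_sign[OF I] by auto
      then show ?thesis using less.prems(3) by (intro exI[of _ "[]"] exI[of _ j]) simp
    qed
  qed
qed

text \<open>Both joining words are contained in the connection. The terminal one cannot reach back
  beyond the start, as no nonempty run ends at a codiscontinuity; the initial one avoids
  \<open>a\<close>, while the end point left after cutting the terminal word lies in the interval of
  \<open>a\<close>. The rest desubstitutes, and the nonempty terminal word makes the result strictly
  shorter.\<close>

lemma connection_descends:
  assumes I: "induces v L w L' s c e a" and P: "pos L" "pos L'"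
    and ij: "i \<in> {1,2}" "j \<in> {1,2}" and u: "vrun v L (codisc L i) u (disc v L j)"
  shows "\<exists>i'\<in>{1,2}. \<exists>j'\<in>{1,2}. \<exists>u'. vrun w L' (codisc L' i') u' (disc w L' j') \<and> length u' < length u"
proof -
  obtain q r where q: "\<forall>i\<in>{1,2}. a \<notin> set (r i) \<and> vrun v L (codisc L (q i)) (r i) (c + e * codisc L' i)" "q ` {1,2} = {1,2::nat}"
    by (rule induces_codisc[OF I])
  obtain q' r' where q': "\<forall>i\<in>{1,2}. r' i \<noteq> [] \<and> vrun v L (c + e * disc w L' i) (r' i) (disc v L (q' i))" "q' ` {1,2} = {1,2::nat}"
    by (rule induces_disc[OF I])
  obtain i' where i': "i' \<in> {1,2}" "q i' = i" using q(2) ij by (metis imageE)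
  obtain j' where j': "j' \<in> {1,2}" "q' j' = j" using q'(2) ij by (metis imageE)
  have s: "a \<notin> set (r i')" "vrun v L (codisc L i) (r i') (c + e * codisc L' i')" using q(1) i' by auto
  have t: "r' j' \<noteq> []" "vrun v L (c + e * disc w L' j') (r' j') (disc v L j)" using q'(1) j' by auto
  have "length (r' j') \<le> length u"
  proof (rule ccontr)
    assume A: "\<not> ?thesis"
    then have "length u \<le> length (r' j')" by simp
    from run_codet[OF backward_det_left[OF P(1)] u t(2) this] obtain x where
      x: "r' j' = x @ u" "vrun v L (c + e * disc w L' j') x (codisc L i)" by blast
    then obtain x' h where h: "x = x' @ [h]" using A by (cases x rule: rev_cases) auto
    obtain z where "vrun v L z [h] (codisc L i)" using x(2) unfolding h run_append by blast
    then have "h \<in> {1,2,3}" "lies_in v L h z" "codisc L i = z + shift v L h" by simp_all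
    then show False using codisc_not_interior[OF P(1) ij(1), of h v] by simp
  qed
  from run_codet[OF backward_det_left[OF P(1)] t(2) u this] obtain u1 where
    u1: "u = u1 @ r' j'" "vrun v L (codisc L i) u1 (c + e * disc w L' j')" by blast
  have "length (r i') \<le> length u1"
  proof (rule ccontr)
    assume A: "\<not> ?thesis"
    then have "length u1 \<le> length (r i')" by simp
    from run_det[OF forward_det_left[OF P(1)] u1(2) s(2) this] obtain x where
      x: "r i' = u1 @ x" "vrun v L (c + e * disc w L' j') x (c + e * codisc L' i')" by blast
    then obtain x' h where h: "x = h # x'" using A by (cases x) auto
    with x(2) have "h \<in> {1,2,3}" "lies_in v L h (c + e * disc w L' j')" by auto
    moreover have "lies_in v L a (c + e * disc w L' j')"
      using induces_base[OF I] disc_range[OF P(2) j'(1)] by blast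
    ultimately have "h = a" using lies_in_unique[OF P(1)] induces_letter[OF I] by blast
    then show False using s(1) x(1) h by simp
  qed
  from run_det[OF forward_det_left[OF P(1)] s(2) u1(2) this] obtain u2 where
    u2: "u1 = r i' @ u2" "vrun v L (c + e * codisc L' i') u2 (c + e * disc w L' j')" by blast
  have "0 < codisc L' i'" "codisc L' i' < tot L'" using codisc_range[OF P(2) i'(1)] by blast+
  from desubstitute_connection[OF I P this j'(1) u2(2)] obtain u' k where
    "k \<in> {1,2}" "vrun w L' (codisc L' i') u' (disc w L' k)" "length u' \<le> length u2" by blast
  moreover have "length u2 < length u" using u1(1) u2(1) t(1) by simp
  ultimately show ?thesis using i'(1) by (intro bexI[of _ i'] bexI[of _ k] exI[of _ u']) auto
qed

lemma sequence_connection_free: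
  assumes E: "\<And>n. t n \<in> edge_labels (v n) (v (Suc n))" and P: "\<And>n. pos (\<Lambda> n)"
    and M: "\<And>n. \<forall>a\<in>{1,2,3}. \<Lambda> n a = mval (t n) (\<Lambda> (Suc n)) a"
  shows "connection_free (v n) (\<Lambda> n)"
proof -
  have "\<not> vrun (v n) (\<Lambda> n) (codisc (\<Lambda> n) i) u (disc (v n) (\<Lambda> n) j)" if "i \<in> {1,2}" "j \<in> {1,2}" for n i j u
    using that
  proof (induction "length u" arbitrary: n i j u rule: less_induct)
    case less
    obtain c e a where I: "induces (v n) (\<Lambda> n) (v (Suc n)) (\<Lambda> (Suc n)) (t n) c e a"
      using edge_induces[OF E P M] by blast
    show ?case
    proof
      assume "vrun (v n) (\<Lambda> n) (codisc (\<Lambda> n) i) u (disc (v n) (\<Lambda> n) j)"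
      from connection_descends[OF I P P less.prems this] less.hyps show False by blast
    qed
  qed
  then show ?thesis unfolding connection_free_def by blast
qed

section \<open>Every connection-free exchange has an outgoing edge\<close>

lemma floor_multiple:
  fixes y s :: real
  assumes "0 < s" "s < y" "\<And>k::nat. k \<ge> 1 \<Longrightarrow> y \<noteq> real k * s"
  obtains k where "k \<ge> 1" "real k * s < y" "y < real k * s + s"
proof -
  define k where "k = nat \<lfloor>y / s\<rfloor>"
  have "1 \<le> \<lfloor>y / s\<rfloor>" using assms by (simp add: le_floor_iff)
  then have k: "k \<ge> 1" "real k \<le> y / s" "y / s < real k + 1" unfolding k_def by linarith+
  have "real k * s \<le> y" "y < (real k + 1) * s" using k assms(1) by (simp_all add: field_simps)
  with assms(3)[OF k(1)] show ?thesis by (intro that[OF k(1)]) (auto simp: algebra_simps)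
qed

lemma connection_free_run:
  assumes "connection_free v L" "i \<in> {1,2}" "j \<in> {1,2}"
  shows "\<not> vrun v L (codisc L i) u (disc v L j)"
  using assms unfolding connection_free_def by blast

text \<open>The empty run counts as a connection. The resulting inequalities are what makes the
  comparisons of lengths strict.\<close>

lemma connection_free_neq:
  assumes "connection_free v L" "i \<in> {1,2}" "j \<in> {1,2}"
  shows "codisc L i \<noteq> disc v L j"
  using connection_free_run[OF assms, of "[]"] by simp

definition vec3 :: "real \<Rightarrow> real \<Rightarrow> real \<Rightarrow> nat \<Rightarrow> real" where
  "vec3 x y z = (\<lambda>i. if i = 1 then x else if i = 2 then y else z)"

lemma vec3_simps [simp]: "vec3 x y z 1 = x" "vec3 x y z 2 = y" "vec3 x y z 3 = z"
  by (simp_all add: vec3_def)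

text \<open>\<open>L'\<close> is found by inverting the incidence matrix, and the case inequalities,
  with the choice of \<open>k\<close>, say that it is positive. Every boundary case is a coincidence
  of marked points or, where a block of 3s occurs, a connection of length
  \<open>k - 1\<close>.\<close>

lemma edge_exists:
  assumes nc: "connection_free v L" and P: "pos L"
  shows "\<exists>s w L'. s \<in> edge_labels v w \<and> pos L' \<and> (\<forall>a\<in>{1,2,3}. L a = mval s L' a)"
proof (cases v)
  case V32
  have "L 2 + L 3 \<noteq> L 1" "L 2 \<noteq> L 1" "L 3 \<noteq> L 1"
    using connection_free_neq[OF nc, of 2 1] connection_free_neq[OF nc, of 1 1] connection_free_neq[OF nc, of 2 2]
    by (auto simp: V32 codisc_def)
  then consider "L 1 > L 2 + L 3" | "L 1 < L 2 + L 3" "L 2 < L 1" "L 3 < L 1" | "L 2 < L 1" "L 1 < L 3"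
    | "L 3 < L 1" "L 1 < L 2" | "L 1 < L 2" "L 1 < L 3" by linarith
  then show ?thesis
  proof cases
    case 1
    with P show ?thesis unfolding V32
      by (intro exI[of _ "mk3 [1] [1,2] [1,3]"] exI[of _ V32] exI[of _ "vec3 (L 1 - L 2 - L 3) (L 2) (L 3)"])
        (auto simp: edge_labels_V32_V32 pos_def mval_def)
  next
    case 2
    with P show ?thesis unfolding V32
      by (intro exI[of _ "mk3 [1,3,2] [1,3] [1,2]"] exI[of _ V32] exI[of _ "vec3 (L 2 + L 3 - L 1) (L 1 - L 2) (L 1 - L 3)"])
        (auto simp: edge_labels_V32_V32 pos_def mval_def)
  next
    case 3
    with P show ?thesis unfolding V32
      by (intro exI[of _ "mk3 [3,1] [3] [3,2,1]"] exI[of _ V33] exI[of _ "vec3 (L 1 - L 2) (L 3 - L 1) (L 2)"])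
        (auto simp: edge_labels_V32_V33 pos_def mval_def)
  next
    case 4
    with P show ?thesis unfolding V32
      by (intro exI[of _ "mk3 [2] [2,1] [2,1,3]"] exI[of _ V33] exI[of _ "vec3 (L 2 - L 1) (L 1 - L 3) (L 3)"])
        (auto simp: edge_labels_V32_V33 pos_def mval_def)
  next
    case 5
    \<comment> \<open>If \<open>L 3\<close> were \<open>k\<close> steps of size \<open>L 1\<close>,
      the orbit of the second codiscontinuity would descend through interval 3 and hit the second
      discontinuity after \<open>k - 1\<close> steps.\<close>
    have "L 3 \<noteq> real k * L 1" if k: "k \<ge> 1" for k :: nat
    proof
      assume L3: "L 3 = real k * L 1"
      obtain m where m: "k = Suc m" using k by (cases k) auto
      have "vrun V32 L (codisc L 2) (replicate m 3) (disc V32 L 2)"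
        by (rule run_replicate_down[where s = "L 1"])
          (use P 5 L3 in \<open>auto simp: pos_def codisc_def m algebra_simps\<close>)
      then show False using connection_free_run[OF nc, of 2 2] V32 by simp
    qed
    then obtain k where "k \<ge> 1" "real k * L 1 < L 3" "L 3 < real k * L 1 + L 1"
      using floor_multiple[of "L 1" "L 3"] P 5 unfolding pos_def by blast
    with P 5 show ?thesis unfolding V32
      by (intro exI[of _ "mk3 [2] (2 # 1 # replicate k 3) (2 # 1 # 3 # replicate k 3)"] exI[of _ V33]
          exI[of _ "vec3 (L 2 - L 1) (L 1 - (L 3 - real k * L 1)) (L 3 - real k * L 1)"])
        (auto simp: edge_labels_V32_V33 pos_def mval_def algebra_simps)
  qed
next
  case V33
  have "L 2 \<noteq> L 1" "L 2 + L 3 \<noteq> L 1" "L 2 \<noteq> L 1 + L 3"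
    using connection_free_neq[OF nc, of 1 1] connection_free_neq[OF nc, of 2 1] connection_free_neq[OF nc, of 1 2]
    by (auto simp: V33 codisc_def)
  then consider "L 1 > L 2 + L 3" | "L 2 > L 1 + L 3" | "L 2 < L 1" "L 1 < L 2 + L 3" | "L 1 < L 2" "L 2 < L 1 + L 3"
    by linarith
  then show ?thesis
  proof cases
    case 1
    with P show ?thesis unfolding V33
      by (intro exI[of _ "mk3 [1] [1,2] [1,3]"] exI[of _ V33] exI[of _ "vec3 (L 1 - L 2 - L 3) (L 2) (L 3)"])
        (auto simp: edge_labels_V33_V33 pos_def mval_def)
  next
    case 2
    with P show ?thesis unfolding V33
      by (intro exI[of _ "mk3 [2,1] [2] [2,3]"] exI[of _ V33] exI[of _ "vec3 (L 1) (L 2 - L 1 - L 3) (L 3)"])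
        (auto simp: edge_labels_V33_V33 pos_def mval_def)
  next
    case 3
    have "L 3 \<noteq> real k * (L 1 - L 2)" if k: "k \<ge> 1" for k :: nat
    proof
      assume L3: "L 3 = real k * (L 1 - L 2)"
      obtain m where m: "k = Suc m" using k by (cases k) auto
      have "vrun V33 L (codisc L 2) (replicate m 3) (disc V33 L 1)"
        by (rule run_replicate_down[where s = "L 1 - L 2"])
          (use P 3 L3 in \<open>auto simp: pos_def codisc_def m algebra_simps\<close>)
      then show False using connection_free_run[OF nc, of 2 1] V33 by simp
    qed
    then obtain k where "k \<ge> 1" "real k * (L 1 - L 2) < L 3" "L 3 < real k * (L 1 - L 2) + (L 1 - L 2)"
      using floor_multiple[of "L 1 - L 2" "L 3"] P 3 unfolding pos_def by auto
    with P 3 show ?thesis unfolding V33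
      by (intro exI[of _ "mk3 [1,2] (1 # replicate k 3) (1 # 3 # replicate k 3)"] exI[of _ V33]
          exI[of _ "vec3 (L 2) (L 1 - L 2 - (L 3 - real k * (L 1 - L 2))) (L 3 - real k * (L 1 - L 2))"])
        (auto simp: edge_labels_V33_V33 pos_def mval_def algebra_simps)
  next
    case 4
    \<comment> \<open>Here interval 3 moves up, so the orbit of the first codiscontinuity would
      climb to the second discontinuity.\<close>
    have "L 3 \<noteq> real k * (L 2 - L 1)" if k: "k \<ge> 1" for k :: nat
    proof
      assume L3: "L 3 = real k * (L 2 - L 1)"
      obtain m where m: "k = Suc m" using k by (cases k) auto
      have "vrun V33 L (codisc L 1) (replicate m 3) (disc V33 L 2)"
        by (rule run_replicate_up[where s = "L 2 - L 1"])
          (use P 4 L3 in \<open>auto simp: pos_def codisc_def m algebra_simps\<close>)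
      then show False using connection_free_run[OF nc, of 1 2] V33 by simp
    qed
    then obtain k where "k \<ge> 1" "real k * (L 2 - L 1) < L 3" "L 3 < real k * (L 2 - L 1) + (L 2 - L 1)"
      using floor_multiple[of "L 2 - L 1" "L 3"] P 4 unfolding pos_def by auto
    with P 4 show ?thesis unfolding V33
      by (intro exI[of _ "mk3 [2,1] (2 # replicate k 3) (2 # 3 # replicate k 3)"] exI[of _ V33]
          exI[of _ "vec3 (L 1) (L 2 - L 1 - (L 3 - real k * (L 2 - L 1))) (L 3 - real k * (L 2 - L 1))"])
        (auto simp: edge_labels_V33_V33 pos_def mval_def algebra_simps)
  qed
qed

section \<open>Primitivity\<close>

text \<open>The set \<open>B\<close> of letters whose image under a product of edge labels contains a given letter evolves by
  \<open>preimage\<close>. As long as \<open>B\<close> is not full, \<open>rank\<close> drops, or \<open>B\<close> is fixed and the length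
  of its letter \<open>witness B\<close> does not change.\<close>
definition rank :: "vertex \<Rightarrow> nat set \<Rightarrow> nat" where
  "rank v B = (case v of V32 \<Rightarrow> if 1 \<in> B then 8 else 9
     | V33 \<Rightarrow> if 1 \<in> B \<and> 2 \<in> B then 6 else if 1 \<notin> B \<and> 2 \<notin> B then 5 else if 2 \<in> B \<and> 3 \<notin> B then 4 else 3)"

definition preimage :: "morph \<Rightarrow> nat set \<Rightarrow> nat set" where
  "preimage s B = {b \<in> {1,2,3}. set (s b) \<inter> B \<noteq> {}}"

definition witness :: "nat set \<Rightarrow> nat" where
  "witness B = (if 2 \<in> B then 2 else if 1 \<in> B then 1 else 3)"

lemma in_preimage: "b \<in> {1,2,3} \<Longrightarrow> b \<in> preimage s B \<longleftrightarrow> (\<exists>c\<in>set (s b). c \<in> B)"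
  by (auto simp: preimage_def)

lemma preimage_subset: "preimage s B \<subseteq> {1,2,3}"
  by (auto simp: preimage_def)

lemma subset3_eqI: "A \<subseteq> {1,2,3::nat} \<Longrightarrow> B \<subseteq> {1,2,3} \<Longrightarrow> (1 \<in> A \<longleftrightarrow> 1 \<in> B) \<Longrightarrow> (2 \<in> A \<longleftrightarrow> 2 \<in> B) \<Longrightarrow> (3 \<in> A \<longleftrightarrow> 3 \<in> B) \<Longrightarrow> A = B"
  by blast

text \<open>All values of \<open>rank\<close> at V33 lie below those at V32, because that passage is
  irreversible. Inside V32 only the eta label changes a set whose preimage stays incomplete, by
  putting 1 into it; inside V33 only the zeta labels do, turning {3} into {2,3} and {2} into {1}.
  Otherwise the set is fixed and avoids the letter of the inducing interval, so
  \<open>witness B\<close> names an interval that is not cut, while the total loses at least its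
  length.\<close>

lemma rank_step:
  assumes E: "s \<in> edge_labels v w" and P: "pos L'" and M: "\<forall>a\<in>{1,2,3}. L a = mval s L' a"
    and B: "B \<subseteq> {1,2,3}" "B \<noteq> {}" "B \<noteq> {1,2,3}"
  shows "preimage s B = {1,2,3} \<or> rank w (preimage s B) < rank v B \<or>
    preimage s B = B \<and> w = v \<and> L (witness B) = L' (witness B) \<and> tot L' + L' (witness B) \<le> tot L"
proof -
  have L: "L 1 = mval s L' 1" "L 2 = mval s L' 2" "L 3 = mval s L' 3" using M by auto
  define C where "C = preimage s B"
  have C: "C \<subseteq> {1,2,3}" unfolding C_def by (rule preimage_subset)
  have m: "1 \<in> C \<longleftrightarrow> (\<exists>c\<in>set (s 1). c \<in> B)" "2 \<in> C \<longleftrightarrow> (\<exists>c\<in>set (s 2). c \<in> B)" "3 \<in> C \<longleftrightarrow> (\<exists>c\<in>set (s 3). c \<in> B)"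
    unfolding C_def by (rule in_preimage; simp)+
  have ne: "1 \<in> B \<or> 2 \<in> B \<or> 3 \<in> B" using B by blast
  have nf: "1 \<notin> B \<or> 2 \<notin> B \<or> 3 \<notin> B" using B by blast
  have full: "C = {1,2,3} \<longleftrightarrow> 1 \<in> C \<and> 2 \<in> C \<and> 3 \<in> C" using C by blast
  have same: "C = B \<longleftrightarrow> (1 \<in> C \<longleftrightarrow> 1 \<in> B) \<and> (2 \<in> C \<longleftrightarrow> 2 \<in> B) \<and> (3 \<in> C \<longleftrightarrow> 3 \<in> B)"
    using subset3_eqI[OF C B(1)] by blast
  have "(1 \<in> C \<and> 2 \<in> C \<and> 3 \<in> C) \<or> rank w C < rank v B \<or>
    ((1 \<in> C \<longleftrightarrow> 1 \<in> B) \<and> (2 \<in> C \<longleftrightarrow> 2 \<in> B) \<and> (3 \<in> C \<longleftrightarrow> 3 \<in> B)) \<and> w = v \<and> L (witness B) = L' (witness B) \<and> tot L' + L' (witness B) \<le> tot L"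
    using E
    by (cases rule: edge_labels_cases; cases "1 \<in> B"; cases "2 \<in> B"; cases "3 \<in> B")
      (use ne nf m L P in \<open>simp_all add: rank_def witness_def tot_def mval_def pos_def\<close>)
  then show ?thesis unfolding C_def[symmetric] full same .
qed

lemma preimage_nonempty:
  assumes E: "s \<in> edge_labels v w" and B: "B \<subseteq> {1,2,3}" "B \<noteq> {}"
  shows "preimage s B \<noteq> {}"
proof -
  have ne: "1 \<in> B \<or> 2 \<in> B \<or> 3 \<in> B" using B by blast
  have "1 \<in> preimage s B \<or> 2 \<in> preimage s B \<or> 3 \<in> preimage s B"
    unfolding in_preimage[of 1, simplified] in_preimage[of 2, simplified] in_preimage[of 3, simplified]
    using E by (cases rule: edge_labels_cases) (use ne in auto)
  then show ?thesis by blast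
qed

lemma edge_letters:
  assumes "s \<in> edge_labels v w" "b \<in> {1,2,3}"
  shows "set (s b) \<subseteq> {1,2,3} \<and> s b \<noteq> []"
  using assms(1) by (cases rule: edge_labels_cases) (use assms(2) in auto)

lemma nonincreasing_nat_stabilizes:
  fixes f :: "nat \<Rightarrow> nat"
  assumes "\<And>n. f (Suc n) \<le> f n"
  shows "\<exists>m. \<forall>n\<ge>m. f n = f m"
proof -
  define r where "r = (LEAST x. x \<in> range f)"
  have "r \<in> range f" unfolding r_def by (rule LeastI) auto
  then obtain m where m: "f m = r" by auto
  have "f n = f m" if "n \<ge> m" for n
  proof -
    have "f n \<le> f m" by (rule lift_Suc_antimono_le[of f, OF assms that])
    moreover have "r \<le> f n" unfolding r_def by (rule Least_le) auto
    ultimately show ?thesis using m by simp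
  qed
  then show ?thesis by blast
qed

lemma set_morph_word: "set (morph_word s w) = (\<Union>b\<in>set w. set (s b))"
  by (auto simp: morph_word_def)

text \<open>One letter \<open>a\<close> is treated at a time, and for all large \<open>m'\<close>,
  so that the three bounds can be combined. The product grows on the right, hence the set of letters
  whose image contains \<open>a\<close> evolves by preimages.\<close>

lemma positive_word_products:
  assumes E: "\<And>n. t n \<in> edge_labels (v n) (v (Suc n))" and P: "\<And>n. pos (\<Lambda> n)"
    and M: "\<And>n. \<forall>a\<in>{1,2,3}. \<Lambda> n a = mval (t n) (\<Lambda> (Suc n)) a" and a: "a \<in> {1,2,3}"
  shows "\<exists>m. \<forall>m'\<ge>m. \<forall>b\<in>{1,2,3}. a \<in> set (mprod t n m' b)"
proof -
  define B where "B m = {b \<in> {1,2,3}. a \<in> set (mprod t n m b)}" for m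
  have sub: "B m \<subseteq> {1,2,3}" for m by (auto simp: B_def)
  have step: "B (Suc m) = preimage (t (n + m)) (B m)" for m
  proof -
    have "b \<in> B (Suc m) \<longleftrightarrow> b \<in> preimage (t (n + m)) (B m)" if b: "b \<in> {1,2,3}" for b
    proof -
      have "set (t (n + m) b) \<subseteq> {1,2,3}" using edge_letters[OF E b] by blast
      then show ?thesis using b unfolding in_preimage[OF b] by (auto simp: B_def mcomp_def set_morph_word)
    qed
    then show ?thesis using sub preimage_subset by blast
  qed
  have B0: "B 0 = {a}" using a by (auto simp: B_def)
  have ne: "B m \<noteq> {}" for m
    by (induction m) (use B0 preimage_nonempty[OF E sub] in \<open>auto simp: step\<close>)
  have persist: "B (Suc m) = {1,2,3}" if "B m = {1,2,3}" for m
  proof -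
    have "set (t (n + m) b) \<inter> {1,2,3} \<noteq> {}" if "b \<in> {1,2,3}" for b
      using edge_letters[OF E[of "n + m"] that] by (metis Int_absorb2 set_empty)
    then show ?thesis unfolding step that preimage_def by blast
  qed
  have "\<exists>m. B m = {1,2,3}"
  proof (rule ccontr)
    assume "\<not> ?thesis"
    then have nf: "B m \<noteq> {1,2,3}" for m by blast
    let ?r = "\<lambda>m. rank (v (n + m)) (B m)"
    have alt: "?r (Suc m) < ?r m \<or> B (Suc m) = B m \<and> v (Suc (n + m)) = v (n + m) \<and>
        \<Lambda> (n + m) (witness (B m)) = \<Lambda> (Suc (n + m)) (witness (B m)) \<and>
        tot (\<Lambda> (Suc (n + m))) + \<Lambda> (Suc (n + m)) (witness (B m)) \<le> tot (\<Lambda> (n + m))" for m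
      using rank_step[OF E[of "n + m"] P M sub ne nf, of m] nf[of "Suc m"] unfolding step by auto
    then have "?r (Suc m) \<le> ?r m" for m by (metis add_Suc_right less_imp_le order_refl)
    then obtain m0 where m0: "\<And>m. m \<ge> m0 \<Longrightarrow> ?r m = ?r m0" using nonincreasing_nat_stabilizes[of ?r] by blast
    have stuck: "B (Suc m) = B m \<and>
        \<Lambda> (n + m) (witness (B m)) = \<Lambda> (Suc (n + m)) (witness (B m)) \<and>
        tot (\<Lambda> (Suc (n + m))) + \<Lambda> (Suc (n + m)) (witness (B m)) \<le> tot (\<Lambda> (n + m))" if "m \<ge> m0" for m
      using alt[of m] m0[OF that] m0[of "Suc m"] that by auto
    let ?b = "witness (B m0)"
    let ?e = "\<Lambda> (n + m0) ?b"
    have B: "B (m0 + j) = B m0 \<and> \<Lambda> (n + m0 + j) ?b = ?e" for j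
    proof (induction j)
      case (Suc j)
      with stuck[of "m0 + j"] show ?case by (simp add: add.assoc)
    qed simp
    have dec: "tot (\<Lambda> (n + m0 + j)) + real j * ?e \<le> tot (\<Lambda> (n + m0))" for j
    proof (induction j)
      case (Suc j)
      with stuck[of "m0 + j"] B[of j] B[of "Suc j"] show ?case by (simp add: add.assoc algebra_simps)
    qed simp
    have pos: "?e > 0" using P[of "n + m0"] by (auto simp: witness_def pos_def)
    obtain j where "tot (\<Lambda> (n + m0)) < real j * ?e" using reals_Archimedean3[OF pos] by blast
    moreover have "tot (\<Lambda> (n + m0 + j)) > 0" using P[of "n + m0 + j"] by (auto simp: pos_def tot_def)
    ultimately show False using dec[of j] by linarith
  qed
  then obtain m where m: "B m = {1,2,3}" by blast
  have "B m' = {1,2,3}" if "m' \<ge> m" for m'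
    using that by (induction m' rule: dec_induct) (use m persist in auto)
  then show ?thesis unfolding B_def by blast
qed

lemma primitive_tail:
  assumes E: "\<And>n. t n \<in> edge_labels (v n) (v (Suc n))" and P: "\<And>n. pos (\<Lambda> n)"
    and M: "\<And>n. \<forall>a\<in>{1,2,3}. \<Lambda> n a = mval (t n) (\<Lambda> (Suc n)) a"
  shows "primitive_seq t"
  unfolding primitive_seq_def
proof
  fix n
  obtain m1 where m1: "\<forall>m'\<ge>m1. \<forall>b\<in>{1,2,3}. 1 \<in> set (mprod t n m' b)" using positive_word_products[of t v \<Lambda> 1 n, OF E P M] by blast
  obtain m2 where m2: "\<forall>m'\<ge>m2. \<forall>b\<in>{1,2,3}. 2 \<in> set (mprod t n m' b)" using positive_word_products[of t v \<Lambda> 2 n, OF E P M] by blast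
  obtain m3 where m3: "\<forall>m'\<ge>m3. \<forall>b\<in>{1,2,3}. 3 \<in> set (mprod t n m' b)" using positive_word_products[of t v \<Lambda> 3 n, OF E P M] by blast
  obtain m where m: "m \<ge> m1" "m \<ge> m2" "m \<ge> m3" "m > 0"
    by (rule that[of "Suc (m1 + m2 + m3)"]) auto
  have "\<forall>b\<in>{1,2,3}. \<forall>a\<in>{1,2,3}. a \<in> set (mprod t n m b)"
    using m1[rule_format, OF m(1)] m2[rule_format, OF m(2)] m3[rule_format, OF m(3)] by simp
  then show "\<exists>N>n. \<forall>b\<in>{1,2,3}. \<forall>a\<in>{1,2,3}. a \<in> set (mprod t n (N - n) b)"
    by (intro exI[of _ "n + m"]) (simp add: m(4))
qed

lemma mval_mprod:
  assumes E: "\<And>n. t n \<in> edge_labels (v n) (v (Suc n))"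
    and M: "\<And>n. \<forall>a\<in>{1,2,3}. \<Lambda> n a = mval (t n) (\<Lambda> (Suc n)) a" and a: "a \<in> {1,2,3}"
  shows "\<Lambda> n a = mval (mprod t n m) (\<Lambda> (n + m)) a"
proof (induction m)
  case 0
  then show ?case using a by (auto simp: mval_def)
next
  case (Suc m)
  have "mval (mprod t n m) (\<Lambda> (n + m)) a = mval (mprod t n m) (mval (t (n + m)) (\<Lambda> (Suc (n + m)))) a"
    using M[of "n + m"] by (simp add: mval_def[of "mprod t n m"])
  also have "\<dots> = mval (mprod t n (Suc m)) (\<Lambda> (n + Suc m)) a"
    using edge_letters[OF E[of "n + m"]] by (simp add: mval_mcomp)
  finally show ?case using Suc by simp
qed

lemma mval_ge_tot:
  assumes "\<forall>b\<in>{1,2,3}. a \<in> set (s b)" "0 \<le> L 1" "0 \<le> L 2" "0 \<le> L 3"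
  shows "tot L \<le> mval s L a"
proof -
  have "1 \<le> real (count_list (s b) a)" if "b \<in> {1,2,3}" for b
    using assms(1) that count_list_0_iff[of "s b" a] by (metis One_nat_def Suc_leI neq0_conv of_nat_1 of_nat_le_iff)
  then have "1 * L b \<le> real (count_list (s b) a) * L b" if "b \<in> {1,2,3}" for b
    using assms that by (intro mult_right_mono) auto
  from this[of 1] this[of 2] this[of 3] show ?thesis by (simp add: tot_def mval_def)
qed

text \<open>A positive block makes each of the three lengths at level \<open>n\<close> at least the
  total at level \<open>N\<close>, so the total shrinks threefold, in particular by half.\<close>

lemma tot_to_zero:
  assumes E: "\<And>n. t n \<in> edge_labels (v n) (v (Suc n))" and P: "\<And>n. pos (\<Lambda> n)"
    and M: "\<And>n. \<forall>a\<in>{1,2,3}. \<Lambda> n a = mval (t n) (\<Lambda> (Suc n)) a" and prim: "primitive_seq t" and e: "0 < \<epsilon>"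
  shows "\<exists>n. tot (\<Lambda> n) < \<epsilon>"
proof -
  have half: "\<exists>N. tot (\<Lambda> N) \<le> tot (\<Lambda> n) / 2" for n
  proof -
    obtain N where N: "N > n" "\<forall>b\<in>{1,2,3}. \<forall>a\<in>{1,2,3}. a \<in> set (mprod t n (N - n) b)"
      using prim unfolding primitive_seq_def by blast
    have "tot (\<Lambda> N) \<le> \<Lambda> n a" if "a \<in> {1,2,3}" for a
    proof -
      have "tot (\<Lambda> N) \<le> mval (mprod t n (N - n)) (\<Lambda> N) a"
        by (rule mval_ge_tot) (use N that P[of N] in \<open>auto simp: pos_def\<close>)
      then show ?thesis using mval_mprod[of t v \<Lambda> a n "N - n", OF E M that] N(1) by simp
    qed
    from this[of 1] this[of 2] this[of 3] have "3 * tot (\<Lambda> N) \<le> tot (\<Lambda> n)" by (simp add: tot_def[of "\<Lambda> n"])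
    moreover have "0 < tot (\<Lambda> N)" using P[of N] by (simp add: pos_def tot_def)
    ultimately show ?thesis by (intro exI[of _ N]) simp
  qed
  have "\<exists>n. tot (\<Lambda> n) \<le> tot (\<Lambda> 0) / 2 ^ k" for k
  proof (induction k)
    case (Suc k)
    then obtain n where "tot (\<Lambda> n) \<le> tot (\<Lambda> 0) / 2 ^ k" by blast
    then have "tot (\<Lambda> n) / 2 \<le> tot (\<Lambda> 0) / 2 ^ k / 2" by (rule divide_right_mono) simp
    moreover obtain N where "tot (\<Lambda> N) \<le> tot (\<Lambda> n) / 2" using half by blast
    ultimately have "tot (\<Lambda> N) \<le> tot (\<Lambda> 0) / 2 ^ k / 2" by (rule order_trans[rotated])
    then show ?case by (intro exI[of _ N]) (simp add: mult.commute)
  qed auto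
  moreover obtain k where "tot (\<Lambda> 0) / 2 ^ k < \<epsilon>"
  proof -
    obtain k :: nat where "tot (\<Lambda> 0) / \<epsilon> < 2 ^ k" using real_arch_pow[of 2] by auto
    then show ?thesis using e by (intro that[of k]) (simp add: field_simps)
  qed
  ultimately show ?thesis by (meson le_less_trans)
qed

section \<open>Lengths for a given sequence of edges\<close>

lemma compact_PiE_UNIV:
  fixes S :: "'i \<Rightarrow> 'b::topological_space set"
  assumes "\<And>i. compact (S i)"
  shows "compact (PiE UNIV S)"
proof -
  have "compactin (product_topology (\<lambda>i. euclidean) UNIV) (PiE UNIV S)"
    using assms by (simp add: compactin_PiE)
  then show ?thesis by (simp add: euclidean_product_topology)
qed

lemma mval_nonneg: "0 \<le> L 1 \<Longrightarrow> 0 \<le> L 2 \<Longrightarrow> 0 \<le> L 3 \<Longrightarrow> 0 \<le> mval s L a"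
  by (simp add: mval_def)

text \<open>No letter has an empty image, so pulling lengths back counts each of them at least
  once.\<close>

lemma tot_mval_ge:
  assumes E: "s \<in> edge_labels v w" and L: "0 \<le> L 1" "0 \<le> L 2" "0 \<le> L 3"
  shows "tot L \<le> tot (mval s L)"
  using E by (cases rule: edge_labels_cases) (use L in \<open>auto simp: tot_def mval_def\<close>)

text \<open>Unit lengths are placed at level \<open>N\<close> and pulled back; the induction shifts
  the sequence and prepends a level. The bound by \<open>tot (g 0)\<close>, valid at all levels,
  becomes the bound 1 after normalization and supplies compactness.\<close>

lemma finite_length_sequence:
  assumes "\<And>n. t n \<in> edge_labels (v n) (v (Suc n))"
  shows "\<exists>g :: nat \<Rightarrow> nat \<Rightarrow> real. (\<forall>n a. 0 \<le> g n a \<and> g n a \<le> tot (g 0)) \<and> tot (g 0) > 0 \<and>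
    (\<forall>n<N. \<forall>a\<in>{1,2,3}. g n a = mval (t n) (g (Suc n)) a)"
  using assms
proof (induction N arbitrary: t v)
  case 0
  show ?case
    \<comment> \<open>The zero values at other levels and letters keep the uniform bound valid for
      all arguments.\<close>
    by (rule exI[of _ "\<lambda>n a. if n = 0 \<and> a \<in> {1,2,3} then 1 else 0"]) (auto simp: tot_def)
next
  case (Suc N)
  obtain g :: "nat \<Rightarrow> nat \<Rightarrow> real" where g: "\<And>n a. 0 \<le> g n a" "\<And>n a. g n a \<le> tot (g 0)" "tot (g 0) > 0"
    "\<And>n a. n < N \<Longrightarrow> a \<in> {1,2,3} \<Longrightarrow> g n a = mval (t (Suc n)) (g (Suc n)) a"
    using Suc.IH[of "\<lambda>n. t (Suc n)" "\<lambda>n. v (Suc n)", OF Suc.prems] by blast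
  define h where "h n = (case n of 0 \<Rightarrow> (\<lambda>a. if a \<in> {1,2,3} then mval (t 0) (g 0) a else 0) | Suc m \<Rightarrow> g m)" for n
  have h0: "tot (h 0) = tot (mval (t 0) (g 0))" by (simp add: h_def tot_def)
  have ge: "tot (g 0) \<le> tot (h 0)" unfolding h0 by (rule tot_mval_ge[OF Suc.prems]) (use g in auto)
  have nn: "0 \<le> mval (t 0) (g 0) a" for a by (rule mval_nonneg) (use g in auto)
  have "0 \<le> h n a \<and> h n a \<le> tot (h 0)" for n a
  proof (cases n)
    case 0
    have "mval (t 0) (g 0) a \<le> tot (h 0)" if "a \<in> {1,2,3}"
      unfolding h0 unfolding tot_def using nn[of 1] nn[of 2] nn[of 3] that by auto
    then show ?thesis using nn[of a] ge g(3) 0 by (auto simp: h_def)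
  next
    case (Suc m)
    then show ?thesis using g(1)[of m a] g(2)[of m a] ge by (auto simp: h_def)
  qed
  moreover have "tot (h 0) > 0" using ge g(3) by simp
  moreover have "h n a = mval (t n) (h (Suc n)) a" if "n < Suc N" "a \<in> {1,2,3}" for n a
    using that g(4) by (cases n) (auto simp: h_def)
  ultimately show ?case by blast
qed

text \<open>Tychonoff: after division by the total at level 0, the finite solutions lie in a product
  of unit intervals, where the equations of each level are closed conditions with the finite
  intersection property.\<close>

lemma nonneg_length_sequence:
  assumes E: "\<And>n. t n \<in> edge_labels (v n) (v (Suc n))"
  shows "\<exists>\<Lambda> :: nat \<Rightarrow> nat \<Rightarrow> real. (\<forall>n a. 0 \<le> \<Lambda> n a) \<and> tot (\<Lambda> 0) = 1 \<and>
    (\<forall>n. \<forall>a\<in>{1,2,3}. \<Lambda> n a = mval (t n) (\<Lambda> (Suc n)) a)"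
proof -
  define K :: "(nat \<Rightarrow> nat \<Rightarrow> real) set" where "K = PiE UNIV (\<lambda>_. PiE UNIV (\<lambda>_. {0..1}))"
  define C :: "nat \<Rightarrow> (nat \<Rightarrow> nat \<Rightarrow> real) set" where
    "C n = {g. tot (g 0) = 1} \<inter> (\<Inter>a\<in>{1,2,3}. {g. g n a = mval (t n) (g (Suc n)) a})" for n
  have cont: "continuous_on UNIV (\<lambda>g :: nat \<Rightarrow> nat \<Rightarrow> real. g n a)" for n a
    by (rule continuous_on_product_then_coordinatewise[OF continuous_on_product_coordinates])
  have "K \<inter> (\<Inter>n\<in>UNIV. C n) \<noteq> {}"
  proof (rule compact_imp_fip_image)
    show "compact K" unfolding K_def by (intro compact_PiE_UNIV) simp
    show "closed (C n)" for n
      unfolding C_def tot_def mval_def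
      by (intro closed_Int closed_INT ballI closed_Collect_eq continuous_intros cont)
    fix I :: "nat set" assume "finite I"
    then obtain N where N: "\<And>n. n \<in> I \<Longrightarrow> n < N" by (meson finite_nat_set_iff_bounded)
    obtain g :: "nat \<Rightarrow> nat \<Rightarrow> real" where g: "\<And>n a. 0 \<le> g n a" "\<And>n a. g n a \<le> tot (g 0)" "tot (g 0) > 0"
      "\<And>n a. n < N \<Longrightarrow> a \<in> {1,2,3} \<Longrightarrow> g n a = mval (t n) (g (Suc n)) a"
      using finite_length_sequence[of t v N, OF E] by blast
    define h where "h n a = g n a / tot (g 0)" for n a
    have "h \<in> K" using g by (auto simp: K_def h_def)
    moreover have "tot (h 0) = 1" using g(3) by (simp add: h_def tot_def add_divide_distrib[symmetric])
    moreover have "h n a = mval (t n) (h (Suc n)) a" if "n < N" "a \<in> {1,2,3}" for n a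
      using g(4)[OF that] by (simp add: h_def mval_def add_divide_distrib)
    ultimately have "h \<in> K \<inter> (\<Inter>n\<in>I. C n)" using N by (auto simp: C_def)
    then show "K \<inter> (\<Inter>n\<in>I. C n) \<noteq> {}" by blast
  qed
  then obtain g where g: "g \<in> K" "\<And>n. g \<in> C n" by blast
  show ?thesis
  proof (intro exI[of _ g] conjI allI ballI)
    show "0 \<le> g n a" for n a using g(1) unfolding K_def by (auto simp: PiE_iff)
    show "tot (g 0) = 1" using g(2)[of 0] unfolding C_def by blast
    show "g n a = mval (t n) (g (Suc n)) a" if "a \<in> {1,2,3}" for n a using g(2)[of n] that unfolding C_def by blast
  qed
qed

text \<open>The limit may have vanishing entries. No level vanishes completely, since level 0 is its
  image and has total 1; a positive block of matrices then makes every single entry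
  positive.\<close>

lemma positive_length_sequence:
  assumes E: "\<And>n. t n \<in> edge_labels (v n) (v (Suc n))" and prim: "primitive_seq t"
  shows "\<exists>\<Lambda>. (\<forall>n. pos (\<Lambda> n)) \<and> (\<forall>n. \<forall>a\<in>{1,2,3}. \<Lambda> n a = mval (t n) (\<Lambda> (Suc n)) a)"
proof -
  obtain \<Lambda> :: "nat \<Rightarrow> nat \<Rightarrow> real" where \<Lambda>: "\<And>n a. 0 \<le> \<Lambda> n a" "tot (\<Lambda> 0) = 1"
    "\<And>n. \<forall>a\<in>{1,2,3}. \<Lambda> n a = mval (t n) (\<Lambda> (Suc n)) a"
    using nonneg_length_sequence[of t v, OF E] by blast
  have tpos: "tot (\<Lambda> N) > 0" for N
  proof (rule ccontr)
    assume "\<not> ?thesis"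
    then have z: "\<Lambda> N 1 = 0" "\<Lambda> N 2 = 0" "\<Lambda> N 3 = 0"
      using \<Lambda>(1)[of N 1] \<Lambda>(1)[of N 2] \<Lambda>(1)[of N 3] by (auto simp: tot_def)
    have "\<Lambda> 0 a = 0" if "a \<in> {1,2,3}" for a
      using mval_mprod[of t v \<Lambda> a 0 N, OF E \<Lambda>(3) that] z by (simp add: mval_def)
    then show False using \<Lambda>(2) by (simp add: tot_def)
  qed
  have "\<Lambda> n a > 0" if "a \<in> {1,2,3}" for n a
  proof -
    obtain N where N: "N > n" "\<forall>b\<in>{1,2,3}. \<forall>a\<in>{1,2,3}. a \<in> set (mprod t n (N - n) b)"
      using prim unfolding primitive_seq_def by blast
    have "tot (\<Lambda> N) \<le> mval (mprod t n (N - n)) (\<Lambda> N) a"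
      by (rule mval_ge_tot) (use N that \<Lambda>(1) in auto)
    then show ?thesis using mval_mprod[of t v \<Lambda> a n "N - n", OF E \<Lambda>(3) that] N(1) tpos[of N] by simp
  qed
  then show ?thesis using \<Lambda>(3) by (intro exI[of _ \<Lambda>]) (auto simp: pos_def)
qed

section \<open>Half-open three-interval exchanges\<close>

lemma atLeastAtMost_1_3: "{1..3::nat} = {1,2,3}"
  by auto

definition lft :: "real \<Rightarrow> (nat \<Rightarrow> real) \<Rightarrow> (nat \<Rightarrow> nat) \<Rightarrow> nat \<Rightarrow> real" where
  "lft l lam p a = iet_pt l lam p (inv p a - 1)"

lemma permutes3:
  assumes "p permutes {1..3::nat}"
  shows "p 1 \<in> {1,2,3}" "p 2 \<in> {1,2,3}" "p 3 \<in> {1,2,3}" "p 1 \<noteq> p 2" "p 1 \<noteq> p 3" "p 2 \<noteq> p 3"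
proof -
  have "p ` {1,2,3} = {1,2,3}" using permutes_image[OF assms] unfolding atLeastAtMost_1_3 .
  then show "p 1 \<in> {1,2,3}" "p 2 \<in> {1,2,3}" "p 3 \<in> {1,2,3}" by blast+
  have "inj p" using assms by (rule permutes_inj)
  then show "p 1 \<noteq> p 2" "p 1 \<noteq> p 3" "p 2 \<noteq> p 3" by (simp_all add: inj_eq)
qed

lemma permutes3_cases:
  assumes "p permutes {1..3::nat}" "a \<in> {1,2,3}"
  shows "a = p 1 \<or> a = p 2 \<or> a = p 3"
proof -
  have "p ` {1,2,3} = {1,2,3}" using permutes_image[OF assms(1)] unfolding atLeastAtMost_1_3 .
  then show ?thesis using assms(2) by blast
qed

lemma iet_pt_values:
  assumes "p permutes {1..3::nat}"
  shows "iet_pt l lam p 0 = l" "iet_pt l lam p 1 = l + lam (p 1)" "iet_pt l lam p 2 = l + lam (p 1) + lam (p 2)"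
    "iet_pt l lam p 3 = l + lam (p 1) + lam (p 2) + lam (p 3)"
proof -
  have s: "{1..2::nat} = {1,2}" by auto
  show "iet_pt l lam p 0 = l" "iet_pt l lam p 1 = l + lam (p 1)" "iet_pt l lam p 2 = l + lam (p 1) + lam (p 2)"
    "iet_pt l lam p 3 = l + lam (p 1) + lam (p 2) + lam (p 3)"
    using permutes3[OF assms] by (simp_all add: iet_pt_def s atLeastAtMost_1_3)
qed

lemma lft_values:
  assumes "p permutes {1..3::nat}"
  shows "lft l lam p (p 1) = l" "lft l lam p (p 2) = l + lam (p 1)" "lft l lam p (p 3) = l + lam (p 1) + lam (p 2)"
  using iet_pt_values[OF assms, of l lam] permutes_inverses(2)[OF assms] by (simp_all add: lft_def One_nat_def [symmetric])

lemma in_I_iff: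
  assumes "p permutes {1..3::nat}"
  shows "in_I 3 l lam p a x \<longleftrightarrow> a \<in> {1,2,3} \<and> lft l lam p a \<le> x \<and> x < lft l lam p a + lam a"
proof -
  have I: "in_I 3 l lam p a x \<longleftrightarrow>
      (p 1 = a \<and> l \<le> x \<and> x < l + lam (p 1)) \<or> (p 2 = a \<and> l + lam (p 1) \<le> x \<and> x < l + lam (p 1) + lam (p 2)) \<or>
      (p 3 = a \<and> l + lam (p 1) + lam (p 2) \<le> x \<and> x < l + lam (p 1) + lam (p 2) + lam (p 3))"
    unfolding in_I_def atLeastAtMost_1_3 by (simp add: iet_pt_values[OF assms] One_nat_def [symmetric])
  show ?thesis
  proof (cases "a \<in> {1,2,3}")
    case True
    note n = permutes3(4-6)[OF assms]
    from permutes3_cases[OF assms True] show ?thesis unfolding I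
      by (elim disjE) (use True n in \<open>simp_all add: lft_values[OF assms]\<close>)
  next
    case False
    then show ?thesis unfolding I using permutes3(1-3)[OF assms] by blast
  qed
qed

section \<open>The half-open map of a 3-interval exchange and its orbits\<close>

locale iet3 =
  fixes l r :: real and lam :: "nat \<Rightarrow> real" and p0 p1 :: "nat \<Rightarrow> nat"
  assumes iet: "is_IET 3 l r lam p0 p1"
begin

abbreviation "T \<equiv> iet_map 3 l lam p0 p1"
abbreviation "src \<equiv> lft l lam p0"
abbreviation "tgt \<equiv> lft l lam p1"
abbreviation "mu \<equiv> iet_pt l lam p0"
abbreviation "nu \<equiv> iet_pt l lam p1"
abbreviation "orun \<equiv> run src lam (\<lambda>a. tgt a - src a)"

lemma perms: "p0 permutes {1..3}" "p1 permutes {1..3}"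
  using iet by (auto simp: is_IET_def)

lemma lam_pos: "a \<in> {1,2,3} \<Longrightarrow> 0 < lam a"
  using iet unfolding is_IET_def atLeastAtMost_1_3 by blast

lemma lam_sum: "lam 1 + lam 2 + lam 3 = r - l"
  using iet unfolding is_IET_def atLeastAtMost_1_3 by simp

lemma lam_sum_perm: "p permutes {1..3} \<Longrightarrow> lam (p 1) + lam (p 2) + lam (p 3) = r - l"
  using sum.permute[of p "{1..3}" lam] lam_sum unfolding atLeastAtMost_1_3 by simp

lemma partition:
  assumes "p permutes {1..3}" "l \<le> x" "x < r"
  shows "\<exists>a\<in>{1,2,3}. lft l lam p a \<le> x \<and> x < lft l lam p a + lam a"
proof -
  have "lft l lam p (p 1) \<le> x \<and> x < lft l lam p (p 1) + lam (p 1) \<or> lft l lam p (p 2) \<le> x \<and> x < lft l lam p (p 2) + lam (p 2) \<or>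
    lft l lam p (p 3) \<le> x \<and> x < lft l lam p (p 3) + lam (p 3)"
    unfolding lft_values[OF assms(1)] using assms lam_sum_perm[OF assms(1)] by linarith
  then show ?thesis using permutes3(1-3)[OF assms(1)] by blast
qed

lemma partition_range:
  assumes "p permutes {1..3}" "a \<in> {1,2,3}"
  shows "l \<le> lft l lam p a" "lft l lam p a + lam a \<le> r"
proof -
  note L = lam_pos[OF permutes3(1)[OF assms(1)]] lam_pos[OF permutes3(2)[OF assms(1)]] lam_pos[OF permutes3(3)[OF assms(1)]]
    lam_sum_perm[OF assms(1)]
  show "l \<le> lft l lam p a" "lft l lam p a + lam a \<le> r"
    using permutes3_cases[OF assms] L by (elim disjE; simp add: lft_values[OF assms(1)])+
qed

lemma partition_unique:
  assumes "p permutes {1..3}" "a \<in> {1,2,3}" "b \<in> {1,2,3}" "lft l lam p a \<le> x" "x < lft l lam p a + lam a"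
    "lft l lam p b \<le> x" "x < lft l lam p b + lam b"
  shows "a = b"
proof -
  note L = lam_pos[OF permutes3(1)[OF assms(1)]] lam_pos[OF permutes3(2)[OF assms(1)]] lam_pos[OF permutes3(3)[OF assms(1)]]
  show ?thesis
    using permutes3_cases[OF assms(1,2)] permutes3_cases[OF assms(1,3)] L assms(4-)
    by (elim disjE) (simp_all add: lft_values[OF assms(1)])
qed

lemma T_eq:
  assumes "a \<in> {1,2,3}" "src a \<le> x" "x < src a + lam a"
  shows "T x = x + (tgt a - src a)"
proof -
  have a: "in_I 3 l lam p0 a x" using assms by (simp add: in_I_iff[OF perms(1)])
  have "b = a" if "in_I 3 l lam p0 b x" for b
    using that partition_unique[OF perms(1) _ assms(1) _ _ assms(2,3)] unfolding in_I_iff[OF perms(1)] by blast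
  then have "(SOME a. in_I 3 l lam p0 a x) = a" using a by (intro some_equality)
  moreover have "\<exists>a. in_I 3 l lam p0 a x" using a by blast
  ultimately show ?thesis unfolding iet_map_def by (simp add: Let_def lft_def)
qed

lemma T_src: "a \<in> {1,2,3} \<Longrightarrow> T (src a) = tgt a"
  using T_eq[of a "src a"] lam_pos[of a] by simp

lemma T_range:
  assumes "l \<le> x" "x < r"
  shows "l \<le> T x" "T x < r"
proof -
  obtain a where a: "a \<in> {1,2,3}" "src a \<le> x" "x < src a + lam a" using partition[OF perms(1) assms] by blast
  show "l \<le> T x" "T x < r" using T_eq[OF a] a partition_range[OF perms(2) a(1)] by simp_all
qed

lemma T_pow_range:
  assumes "l \<le> x" "x < r"
  shows "l \<le> (T ^^ n) x \<and> (T ^^ n) x < r"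
  by (induction n) (use assms T_range in auto)

lemma T_inj:
  assumes x: "l \<le> x" "x < r" and y: "l \<le> y" "y < r" and e: "T x = T y"
  shows "x = y"
proof -
  obtain a where a: "a \<in> {1,2,3}" "src a \<le> x" "x < src a + lam a" using partition[OF perms(1) x] by blast
  obtain b where b: "b \<in> {1,2,3}" "src b \<le> y" "y < src b + lam b" using partition[OF perms(1) y] by blast
  have "a = b"
    by (rule partition_unique[OF perms(2) a(1) b(1), of "T x"])
      (use T_eq[OF a] a(2,3) T_eq[OF b] b(2,3) e in linarith)+
  then have "T y = y + (tgt a - src a)" using T_eq[OF b] by simp
  then show ?thesis using T_eq[OF a] e by linarith
qed

lemma T_pow_inj:
  assumes x: "l \<le> x" "x < r" and y: "l \<le> y" "y < r" and e: "(T ^^ n) x = (T ^^ n) y"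
  shows "x = y"
  using e
proof (induction n)
  case (Suc n)
  then have "T ((T ^^ n) x) = T ((T ^^ n) y)" by simp
  then have "(T ^^ n) x = (T ^^ n) y"
    by (rule T_inj[OF conjunct1[OF T_pow_range[OF x]] conjunct2[OF T_pow_range[OF x]]
          conjunct1[OF T_pow_range[OF y]] conjunct2[OF T_pow_range[OF y]]])
  then show ?case by (rule Suc.IH)
qed simp

lemma T_pow_cancel:
  assumes x: "l \<le> x" "x < r" and y: "l \<le> y" "y < r" and e: "(T ^^ n) x = (T ^^ m) y" and "n \<le> m"
  shows "x = (T ^^ (m - n)) y"
proof (rule T_pow_inj[OF x, of _ n])
  have "(T ^^ m) y = (T ^^ n) ((T ^^ (m - n)) y)"
    using \<open>n \<le> m\<close> funpow_add[of n "m - n" T] by simp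
  with e show "(T ^^ n) x = (T ^^ n) ((T ^^ (m - n)) y)" by (rule trans)
qed (use T_pow_range[OF y, of "m - n"] in blast)+

lemma orun_T: "orun x w y \<Longrightarrow> y = (T ^^ length w) x \<and> (\<forall>k<length w. in_I 3 l lam p0 (w ! k) ((T ^^ k) x))"
proof (induction w arbitrary: x)
  case (Cons a w)
  then have a: "a \<in> {1,2,3}" "src a < x" "x < src a + lam a" "orun (x + (tgt a - src a)) w y" by auto
  have Tx: "T x = x + (tgt a - src a)" using a by (intro T_eq) auto
  have IH: "y = (T ^^ length w) (T x)" "\<forall>k<length w. in_I 3 l lam p0 (w ! k) ((T ^^ k) (T x))"
    unfolding Tx by (rule conjunct1[OF Cons.IH[OF a(4)]], rule conjunct2[OF Cons.IH[OF a(4)]])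
  have "in_I 3 l lam p0 ((a # w) ! k) ((T ^^ k) x)" if "k < length (a # w)" for k
  proof (cases k)
    case 0
    then show ?thesis using a by (simp add: in_I_iff[OF perms(1)])
  next
    case (Suc j)
    then show ?thesis using IH(2) that by (simp add: funpow_swap1)
  qed
  then show ?case using IH(1) by (simp add: funpow_swap1)
qed simp

text \<open>The intervals are closed on the left, so moving a point slightly to the right keeps its
  itinerary and pushes it off all end points. This lets half-open cylinders be replaced by open
  ones.\<close>

lemma orun_perturb:
  assumes "\<forall>k<length w. in_I 3 l lam p0 (w ! k) ((T ^^ k) x)"
  shows "\<exists>d>0. \<forall>e. 0 < e \<and> e < d \<longrightarrow> (\<exists>y. orun (x + e) w y)"
  using assms
proof (induction w arbitrary: x)
  case Nil
  then show ?case by (intro exI[of _ 1]) auto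
next
  case (Cons a w)
  have a: "a \<in> {1,2,3}" "src a \<le> x" "x < src a + lam a"
    using Cons.prems[rule_format, of 0] by (simp_all add: in_I_iff[OF perms(1)])
  have "\<forall>k<length w. in_I 3 l lam p0 (w ! k) ((T ^^ k) (T x))"
  proof (intro allI impI)
    fix k assume "k < length w"
    then show "in_I 3 l lam p0 (w ! k) ((T ^^ k) (T x))"
      using Cons.prems[rule_format, of "Suc k"] by (simp add: funpow_swap1)
  qed
  from Cons.IH[OF this] obtain d where d: "d > 0" "\<And>e. 0 < e \<Longrightarrow> e < d \<Longrightarrow> \<exists>y. orun (T x + e) w y" by blast
  have "\<exists>y. orun (x + e) (a # w) y" if "0 < e" "e < min d (src a + lam a - x)" for e
  proof -
    obtain y where "orun (T x + e) w y" using d(2) \<open>0 < e\<close> \<open>e < _\<close> by auto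
    moreover have "T x + e = x + e + (tgt a - src a)" using T_eq[OF a] by simp
    ultimately have "orun (x + e) (a # w) y" using a \<open>0 < e\<close> \<open>e < _\<close> by simp
    then show ?thesis by blast
  qed
  moreover have "min d (src a + lam a - x) > 0" using d(1) a by simp
  ultimately show ?case by blast
qed

lemma admissible_iff_orun: "iet_admissible 3 l lam p0 p1 w \<longleftrightarrow> (\<exists>x y. orun x w y)"
proof
  assume "iet_admissible 3 l lam p0 p1 w"
  then obtain x where "\<forall>k<length w. in_I 3 l lam p0 (w ! k) ((T ^^ k) x)" unfolding iet_admissible_def by blast
  from orun_perturb[OF this] obtain d where d: "d > 0" "\<forall>e. 0 < e \<and> e < d \<longrightarrow> (\<exists>y. orun (x + e) w y)" by blast
  then have "\<exists>y. orun (x + d / 2) w y" by simp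
  then show "\<exists>x y. orun x w y" by blast
next
  assume "\<exists>x y. orun x w y"
  then show "iet_admissible 3 l lam p0 p1 w" unfolding iet_admissible_def using orun_T by blast
qed

text \<open>Keane's condition is that this never happens: \<open>i = j\<close> accounts for the
  infinite orbits, \<open>i \<noteq> j\<close> for the disjoint ones. Only forward iterates appear,
  which removes the two-sided orbits from all later arguments.\<close>

definition linked :: "nat \<Rightarrow> bool" where
  "linked n \<longleftrightarrow> n \<ge> 1 \<and> (\<exists>i\<in>{1,2}. \<exists>j\<in>{1,2}. (T ^^ n) (mu i) = mu j)"

lemma mu_range: "i \<in> {1,2} \<Longrightarrow> l < mu i \<and> mu i < r"
  using iet_pt_values(2,3)[OF perms(1), of l lam] lam_pos[OF permutes3(1)[OF perms(1)]] lam_pos[OF permutes3(2)[OF perms(1)]]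
    lam_pos[OF permutes3(3)[OF perms(1)]] lam_sum_perm[OF perms(1)] by auto

lemma nu_range: "i \<in> {1,2} \<Longrightarrow> l < nu i \<and> nu i < r"
  using iet_pt_values(2,3)[OF perms(2), of l lam] lam_pos[OF permutes3(1)[OF perms(2)]] lam_pos[OF permutes3(2)[OF perms(2)]]
    lam_pos[OF permutes3(3)[OF perms(2)]] lam_sum_perm[OF perms(2)] by auto

lemma mu_neq: "mu 1 \<noteq> mu 2"
  using iet_pt_values(2,3)[OF perms(1), of l lam] lam_pos[OF permutes3(2)[OF perms(1)]] by auto

abbreviation "orb \<equiv> iet_orbit 3 l r lam p0 p1"

lemma orb_iff: "z \<in> orb y \<longleftrightarrow> (\<exists>n. z = (T ^^ n) y) \<or> (l \<le> z \<and> z < r \<and> (\<exists>n. (T ^^ n) z = y))"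
  by (auto simp: iet_orbit_def)

lemma regular_imp_not_linked:
  assumes "iet_regular 3 l r lam p0 p1"
  shows "\<not> linked n"
proof
  assume "linked n"
  then obtain i j where n: "n \<ge> 1" "i \<in> {1,2}" "j \<in> {1,2}" "(T ^^ n) (mu i) = mu j"
    unfolding linked_def by blast
  have ij: "i \<in> {1..<3}" "j \<in> {1..<3}" using n by auto
  note R = mu_range[OF n(2)]
  show False
  proof (cases "i = j")
    case True
    have per: "(T ^^ n) (mu i) = mu i" using n True by simp
    have "orb (mu i) \<subseteq> (\<lambda>m. (T ^^ m) (mu i)) ` {..<n}"
    proof
      fix z assume "z \<in> orb (mu i)"
      then have "(\<exists>m. z = (T ^^ m) (mu i)) \<or> (l \<le> z \<and> z < r \<and> (\<exists>k. (T ^^ k) z = mu i))"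
        unfolding orb_iff .
      then have "\<exists>m. z = (T ^^ m) (mu i)"
      proof (elim disjE conjE exE)
        fix k assume z: "l \<le> z" "z < r" and k: "(T ^^ k) z = mu i"
        \<comment> \<open>A backward orbit point of a periodic point is also a forward one:
          \<open>k * n\<close> is a multiple of the period and at least \<open>k\<close>, so
          \<open>T ^^ k\<close> can be cancelled.\<close>
        have "(T ^^ (k * n)) (mu i) = mu i" using funpow_mod_eq[OF per, of "k * n"] by simp
        then have "(T ^^ k) z = (T ^^ (k * n)) (mu i)" using k by simp
        from T_pow_cancel[OF z _ _ this] R n(1) have "z = (T ^^ (k * n - k)) (mu i)" by simp
        then show ?thesis by blast
      qed blast
      then obtain m where "z = (T ^^ m) (mu i)" by blast
      then have "z = (T ^^ (m mod n)) (mu i)" using funpow_mod_eq[OF per] by simp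
      moreover have "m mod n < n" using n by simp
      ultimately show "z \<in> (\<lambda>m. (T ^^ m) (mu i)) ` {..<n}" by blast
    qed
    then have "finite (orb (mu i))" by (rule finite_subset) simp
    with assms ij show False unfolding iet_regular_def by blast
  next
    case False
    have "mu j \<in> orb (mu i)" unfolding orb_iff using n(4)[symmetric] by blast
    moreover have "mu j \<in> orb (mu j)" unfolding orb_iff by (intro disjI1 exI[of _ 0]) simp
    ultimately show False using assms ij False unfolding iet_regular_def by blast
  qed
qed

lemma linkedI:
  assumes "i \<in> {1,2}" "j \<in> {1,2}" "(T ^^ n) (mu i) = mu j" "n \<noteq> 0 \<or> i \<noteq> j"
  shows "\<exists>n. linked n"
proof -
  have "n \<noteq> 0" using assms mu_neq by (cases n) auto
  then show ?thesis using assms unfolding linked_def by (intro exI[of _ n]) auto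
qed

text \<open>A point common to two orbits lies forward or backward on each. In all four combinations,
  composing or cancelling iterates exhibits one marked point as a forward image of the
  other.\<close>

lemma not_linked_imp_regular:
  assumes nc: "\<And>n. \<not> linked n"
  shows "iet_regular 3 l r lam p0 p1"
proof -
  have two: "{1..<3::nat} = {1,2}" by auto
  have inf: "infinite (orb (mu i))" if i: "i \<in> {1,2}" for i
  proof
    assume "finite (orb (mu i))"
    moreover have "range (\<lambda>n. (T ^^ n) (mu i)) \<subseteq> orb (mu i)" by (auto simp: orb_iff)
    ultimately have "finite (range (\<lambda>n. (T ^^ n) (mu i)))" by (rule finite_subset[rotated])
    then have "\<not> inj (\<lambda>n. (T ^^ n) (mu i))" using finite_imageD infinite_UNIV_nat by blast
    then obtain n m where nm: "n < m" "(T ^^ n) (mu i) = (T ^^ m) (mu i)"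
      unfolding inj_def by (metis nat_neq_iff)
    have "mu i = (T ^^ (m - n)) (mu i)"
      by (rule T_pow_cancel) (use mu_range[OF i] nm in auto)
    then have "\<exists>n. linked n" using i nm(1) by (intro linkedI[of i i "m - n"]) auto
    with nc show False by blast
  qed
  have disj: False if ij: "i \<in> {1,2}" "j \<in> {1,2}" "i \<noteq> j" and z: "z \<in> orb (mu i)" "z \<in> orb (mu j)" for i j z
  proof -
    have mem: "(\<exists>n. z = (T ^^ n) (mu k)) \<or> (l \<le> z \<and> z < r \<and> (\<exists>n. (T ^^ n) z = mu k))" if "z \<in> orb (mu k)" for k
      using that unfolding orb_iff .
    have comp: "(T ^^ n) ((T ^^ m) x) = (T ^^ (n + m)) x" for n m x by (simp add: funpow_add)
    have cc: "\<exists>n. linked n" if "k \<in> {1,2}" "k' \<in> {1,2}" "k \<noteq> k'" "(T ^^ n) (mu k) = (T ^^ m) (mu k')" "n \<le> m" for n m k k'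
    proof -
      have "mu k = (T ^^ (m - n)) (mu k')"
        by (rule T_pow_cancel[OF _ _ _ _ that(4,5)]) (use mu_range[OF that(1)] mu_range[OF that(2)] in auto)
      then show ?thesis using that by (intro linkedI[of k' k "m - n"]) auto
    qed
    have bb: "\<exists>n. linked n" if "k \<in> {1,2}" "k' \<in> {1,2}" "k \<noteq> k'" "(T ^^ n) z = mu k" "(T ^^ m) z = mu k'" "n \<le> m" for n m k k'
    proof -
      have "(T ^^ (m - n)) (mu k) = mu k'" using that(4-6) comp[of "m - n" n z] by simp
      then show ?thesis using that by (intro linkedI[of k k' "m - n"]) auto
    qed
    from mem[OF z(1)] mem[OF z(2)] have "\<exists>n. linked n"
    proof (elim disjE exE conjE)
      fix n m assume "z = (T ^^ n) (mu i)" "z = (T ^^ m) (mu j)"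
      then have e: "(T ^^ n) (mu i) = (T ^^ m) (mu j)" by simp
      show ?thesis
      proof (cases "n \<le> m")
        case True then show ?thesis by (rule cc[OF ij(1,2,3) e])
      next
        case False then show ?thesis using cc[OF ij(2,1) _ e[symmetric]] ij(3) by simp
      qed
    next
      fix n m assume "z = (T ^^ n) (mu i)" "(T ^^ m) z = mu j"
      then show ?thesis using ij by (intro linkedI[of i j "m + n"]) (auto simp: funpow_add)
    next
      fix n m assume "(T ^^ n) z = mu i" "z = (T ^^ m) (mu j)"
      then show ?thesis using ij by (intro linkedI[of j i "n + m"]) (auto simp: funpow_add)
    next
      fix n m assume e: "(T ^^ n) z = mu i" "(T ^^ m) z = mu j"
      show ?thesis
      proof (cases "n \<le> m")
        case True then show ?thesis by (rule bb[OF ij(1,2,3) e])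
      next
        case False then show ?thesis using bb[OF ij(2,1) _ e(2,1)] ij(3) by simp
      qed
    qed
    with nc show False by blast
  qed
  show ?thesis unfolding iet_regular_def two using inf disj by blast
qed

lemma src_mu: "src (p0 1) = l" "src (p0 2) = mu 1" "src (p0 3) = mu 2"
  by (simp_all add: lft_values[OF perms(1)] iet_pt_values[OF perms(1)])

lemma tgt_nu: "tgt (p1 1) = l" "tgt (p1 2) = nu 1" "tgt (p1 3) = nu 2"
  by (simp_all add: lft_values[OF perms(2)] iet_pt_values[OF perms(2)])

lemma src_ends:
  assumes "a \<in> {1,2,3}"
  shows "src a \<in> {l, mu 1, mu 2}"
  using permutes3_cases[OF perms(1) assms] by (elim disjE) (simp_all add: src_mu)

lemma tgt_ends:
  assumes "a \<in> {1,2,3}"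
  shows "tgt a \<in> {l, nu 1, nu 2}"
  using permutes3_cases[OF perms(2) assms] by (elim disjE) (simp_all add: tgt_nu)

text \<open>Off the left end points, half-open and open intervals agree.\<close>

lemma orun_avoiding:
  assumes "l \<le> x" "x < r" "\<And>m. m < n \<Longrightarrow> (T ^^ m) x \<notin> {l, mu 1, mu 2}"
  shows "\<exists>u. orun x u ((T ^^ n) x)"
  using assms(3)
proof (induction n)
  case 0
  have "orun x [] ((T ^^ 0) x)" by simp
  then show ?case by blast
next
  case (Suc n)
  then obtain u where u: "orun x u ((T ^^ n) x)" by (meson less_SucI)
  let ?y = "(T ^^ n) x"
  have y: "l \<le> ?y" "?y < r" using T_pow_range[OF assms(1,2)] by auto
  obtain a where a: "a \<in> {1,2,3}" "src a \<le> ?y" "?y < src a + lam a" using partition[OF perms(1) y] by blast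
  have "src a \<noteq> ?y" using Suc.prems[of n] src_ends[OF a(1)] by auto
  then have "orun ?y [a] ((T ^^ Suc n) x)" using a T_eq[OF a] by simp
  with u have "orun x (u @ [a]) ((T ^^ Suc n) x)" unfolding run_append by blast
  then show ?case by blast
qed

text \<open>The difficulty is the end point \<open>l\<close>. As the first letters differ, its
  preimage is a discontinuity and its image a codiscontinuity, so the points \<open>mu\<close> and
  \<open>nu\<close> are one or two steps apart. A link of minimal length meets no discontinuity on
  the way, hence not \<open>l\<close> either after its first step, and so contains an open run from
  a \<open>nu\<close> to a \<open>mu\<close>.\<close>

lemma linked_iff_orun:
  assumes irr: "p0 1 \<noteq> p1 1"
  shows "(\<exists>n. linked n) \<longleftrightarrow> (\<exists>i\<in>{1,2}. \<exists>j\<in>{1,2}. \<exists>u. orun (nu i) u (mu j))"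
proof -
  have lr: "l < r" using iet by (simp add: is_IET_def)
  have F1: "\<exists>k\<in>{1,2}. T (mu k) = l"
  proof -
    have T1: "T (src (p1 1)) = l" using T_src[OF permutes3(1)[OF perms(2)]] unfolding tgt_nu(1) .
    consider "p1 1 = p0 2" | "p1 1 = p0 3" using permutes3_cases[OF perms(1) permutes3(1)[OF perms(2)]] irr by metis
    then show ?thesis
    proof cases
      case 1
      then have "T (mu 1) = l" using T1 src_mu(2) by metis
      then show ?thesis by blast
    next
      case 2
      then have "T (mu 2) = l" using T1 src_mu(3) by metis
      then show ?thesis by blast
    qed
  qed
  have F2: "T l \<in> nu ` {1,2}"
  proof -
    have T0: "T l = tgt (p0 1)" using T_src[OF permutes3(1)[OF perms(1)]] unfolding src_mu(1) .
    consider "p0 1 = p1 2" | "p0 1 = p1 3" using permutes3_cases[OF perms(2) permutes3(1)[OF perms(1)]] irr by metis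
    then show ?thesis
    proof cases
      case 1
      then have "T l = nu 1" using T0 tgt_nu(2) by metis
      then show ?thesis by blast
    next
      case 2
      then have "T l = nu 2" using T0 tgt_nu(3) by metis
      then show ?thesis by blast
    qed
  qed
  have F3: "T (mu i) = l \<or> T (mu i) \<in> nu ` {1,2}" if "i \<in> {1,2}" for i
  proof -
    have "T (mu 1) = tgt (p0 2)" using T_src[OF permutes3(2)[OF perms(1)]] unfolding src_mu(2) .
    moreover have "T (mu 2) = tgt (p0 3)" using T_src[OF permutes3(3)[OF perms(1)]] unfolding src_mu(3) .
    moreover have "tgt (p0 2) \<in> {l, nu 1, nu 2}" "tgt (p0 3) \<in> {l, nu 1, nu 2}"
      using tgt_ends permutes3(2,3)[OF perms(1)] by blast+
    moreover have "i = 1 \<or> i = 2" using that by blast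
    ultimately have "T (mu i) \<in> {l, nu 1, nu 2}" by metis
    then show ?thesis by blast
  qed
  have F4: "\<exists>k\<in>{1,2}. nu i = T (mu k) \<or> nu i = T (T (mu k))" if "i \<in> {1,2}" for i
  proof -
    obtain a where a: "a \<in> {1,2,3}" "nu i = tgt a"
    proof -
      from \<open>i \<in> {1,2}\<close> consider "i = 1" | "i = 2" by blast
      then show thesis
        by cases (use that tgt_nu(2,3) permutes3(2,3)[OF perms(2)] in metis)+
    qed
    have "nu i = T (src a)" unfolding a(2) T_src[OF a(1)] ..
    moreover have "src a = l \<or> src a = mu 1 \<or> src a = mu 2" using src_ends[OF a(1)] by blast
    moreover obtain k where "k \<in> {1,2}" "T (mu k) = l" using F1 by blast
    ultimately show ?thesis by (metis insertCI)
  qed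
  show ?thesis
  proof
    assume "\<exists>i\<in>{1,2}. \<exists>j\<in>{1,2}. \<exists>u. orun (nu i) u (mu j)"
    then obtain i j u where ij: "i \<in> {1,2}" "j \<in> {1,2}" "orun (nu i) u (mu j)" by blast
    have e: "mu j = (T ^^ length u) (nu i)" using orun_T[OF ij(3)] by blast
    obtain k where k: "k \<in> {1,2}" "nu i = T (mu k) \<or> nu i = T (T (mu k))" using F4[OF ij(1)] by blast
    from k(2) have "(T ^^ Suc (length u)) (mu k) = mu j \<or> (T ^^ Suc (Suc (length u))) (mu k) = mu j"
      using e by (auto simp: funpow_swap1)
    then show "\<exists>n. linked n" using linkedI[OF k(1) ij(2)] by blast
  next
    assume "\<exists>n. linked n"
    define n where "n = (LEAST n. linked n)"
    have n: "linked n" unfolding n_def by (rule LeastI_ex) fact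
    have least: "\<not> linked m" if "m < n" for m using that not_less_Least unfolding n_def by blast
    obtain i j where ij: "n \<ge> 1" "i \<in> {1,2}" "j \<in> {1,2}" "(T ^^ n) (mu i) = mu j"
      using n unfolding linked_def by blast
    have no_mu: "(T ^^ m) (mu i) \<noteq> mu k" if "1 \<le> m" "m < n" "k \<in> {1,2}" for m k
      using least[OF that(2)] that ij unfolding linked_def by blast
    \<comment> \<open>\<open>d\<close> is 1, or 2 when the first step lands on \<open>l\<close>; the
      remaining \<open>q\<close> steps will form the run.\<close>
    obtain q d where q: "n = q + d" "d \<ge> 1" "(T ^^ d) (mu i) \<in> nu ` {1,2}"
    proof -
      have one: "(T ^^ 1) (mu i) = T (mu i)" by (simp add: One_nat_def)
      from F3[OF ij(2)] consider "T (mu i) \<in> nu ` {1,2}" | "T (mu i) = l" by blast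
      then show thesis
      proof cases
        case 1
        with one have "(T ^^ 1) (mu i) \<in> nu ` {1,2}" by metis
        then show thesis using ij(1) by (intro that[of "n - 1" 1]) simp_all
      next
        case 2
        have "n \<noteq> 1"
        proof
          assume "n = 1"
          then have "mu j = l" using one 2 ij(4) by metis
          then show False using mu_range[OF ij(3)] by simp
        qed
        moreover have "(T ^^ 2) (mu i) = T l" using 2 by (simp add: numeral_2_eq_2)
        then have "(T ^^ 2) (mu i) \<in> nu ` {1,2}" using F2 by metis
        ultimately show thesis using ij(1) by (intro that[of "n - 2" 2]) simp_all
      qed
    qed
    obtain k where k: "k \<in> {1,2}" "(T ^^ d) (mu i) = nu k" using q(3) by blast
    have pw: "(T ^^ m) (nu k) = (T ^^ (m + d)) (mu i)" for m using k(2) by (simp add: funpow_add)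
    have "(T ^^ m) (nu k) \<notin> {l, mu 1, mu 2}" if "m < q" for m
    proof -
      have "(T ^^ m) (nu k) \<noteq> mu 1" "(T ^^ m) (nu k) \<noteq> mu 2"
        unfolding pw by (rule no_mu; use that q in simp)+
      \<comment> \<open>The only preimage of \<open>l\<close> is a \<open>mu k'\<close>, so reaching
        \<open>l\<close> would mean having passed a discontinuity, against minimality; at
        \<open>m = 0\<close> the point is interior.\<close>
      moreover have "(T ^^ m) (nu k) \<noteq> l"
      proof
        assume A: "(T ^^ m) (nu k) = l"
        obtain k' where k': "k' \<in> {1,2}" "T (mu k') = l" using F1 by blast
        have "m \<noteq> 0"
        proof
          assume "m = 0"
          then have "nu k = l" using A by simp
          then show False using nu_range[OF k(1)] by simp
        qed
        then obtain m' where m': "m = Suc m'" using not0_implies_Suc by blast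
        have "T ((T ^^ m') (nu k)) = l" using A unfolding m' by simp
        then have "T ((T ^^ m') (nu k)) = T (mu k')" unfolding k'(2) .
        then have "(T ^^ m') (nu k) = mu k'"
          using T_pow_range[of "nu k" m'] nu_range[OF k(1)] mu_range[OF k'(1)] by (intro T_inj[of "(T ^^ m') (nu k)"]) linarith+
        moreover have "(T ^^ (m' + d)) (mu i) \<noteq> mu k'" by (rule no_mu[OF _ _ k'(1)]) (use that q m' in simp_all)
        ultimately show False unfolding pw by blast
      qed
      ultimately show ?thesis by blast
    qed
    then obtain u where "orun (nu k) u ((T ^^ q) (nu k))"
      using orun_avoiding[of "nu k" q] nu_range[OF k(1)] by auto
    moreover have "(T ^^ q) (nu k) = mu j" unfolding pw using q(1) ij(4) by simp
    ultimately show "\<exists>i\<in>{1,2}. \<exists>j\<in>{1,2}. \<exists>u. orun (nu i) u (mu j)" using k(1) ij(3) by auto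
  qed
qed

end

section \<open>Normal forms\<close>

definition relabel :: "nat \<Rightarrow> nat \<Rightarrow> nat \<Rightarrow> nat \<Rightarrow> nat" where
  "relabel a b c = (\<lambda>i. if i = 1 then a else if i = 2 then b else c)"

lemma relabel_simps [simp]: "relabel a b c 1 = a" "relabel a b c 2 = b" "relabel a b c 3 = c"
  by (simp_all add: relabel_def)

context iet3
begin

text \<open>\<open>v\<close>, \<open>L\<close> is the interval exchange up to the affine map \<open>x \<mapsto> c + e * x\<close> and the relabelling \<open>p\<close>.\<close>
definition normal_form :: "vertex \<Rightarrow> (nat \<Rightarrow> real) \<Rightarrow> (nat \<Rightarrow> nat) \<Rightarrow> real \<Rightarrow> real \<Rightarrow> bool" where
  "normal_form v L p c e \<longleftrightarrow> (e = 1 \<or> e = - 1) \<and> p ` {1,2,3} = {1,2,3} \<and> pos L \<and>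
     (\<forall>b\<in>{1,2,3}. \<forall>x. lies_in v L b x \<longleftrightarrow> src (p b) < c + e * x \<and> c + e * x < src (p b) + lam (p b)) \<and>
     (\<forall>b\<in>{1,2,3}. tgt (p b) - src (p b) = e * shift v L b) \<and>
     (\<lambda>i. c + e * disc v L i) ` {1,2} = mu ` {1,2} \<and> (\<lambda>i. c + e * codisc L i) ` {1,2} = nu ` {1,2}"

lemma normal_form_run:
  assumes N: "normal_form v L p c e" and w: "set w \<subseteq> {1,2,3}"
  shows "vrun v L x w y \<longleftrightarrow> orun (c + e * x) (map p w) (c + e * y)"
proof (rule run_affine[OF _ _ _ w])
  show "e = 1 \<or> e = - 1" using N unfolding normal_form_def by (elim conjE)
  show "lies_in v L b x \<longleftrightarrow> p b \<in> {1,2,3} \<and> src (p b) < c + e * x \<and> c + e * x < src (p b) + lam (p b)"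
    if "b \<in> {1,2,3}" for b x
  proof -
    have "p b \<in> {1,2,3}" using N that unfolding normal_form_def by blast
    then show ?thesis
      using N[unfolded normal_form_def, THEN conjunct2, THEN conjunct2, THEN conjunct2, THEN conjunct1, rule_format, OF that] by blast
  qed
  show "tgt (p b) - src (p b) = e * shift v L b" if "b \<in> {1,2,3}" for b
    by (rule N[unfolded normal_form_def, THEN conjunct2, THEN conjunct2, THEN conjunct2, THEN conjunct2, THEN conjunct1, rule_format, OF that])
qed

lemma normal_form_surj:
  assumes "normal_form v L p c e"
  shows "\<exists>x. y = c + e * x"
proof -
  have "e = 1 \<or> e = - 1" using assms unfolding normal_form_def by (elim conjE)
  then have "y = c + e * (e * (y - c))" by auto
  then show ?thesis by blast
qed

lemma normal_form_word:
  assumes "normal_form v L p c e" "set w' \<subseteq> {1,2,3}"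
  shows "\<exists>w. set w \<subseteq> {1,2,3} \<and> w' = map p w"
proof -
  have "p ` {1,2,3} = {1,2,3}" using assms(1) unfolding normal_form_def by (elim conjE)
  then have "\<forall>a\<in>set w'. \<exists>b. b \<in> {1,2,3} \<and> a = p b" using assms(2) by blast
  then obtain q where q: "\<And>a. a \<in> set w' \<Longrightarrow> q a \<in> {1,2,3} \<and> a = p (q a)" by metis
  then have "w' = map p (map q w')" by (simp add: map_idI)
  then show ?thesis using q by (intro exI[of _ "map q w'"]) auto
qed

lemma normal_form_admissible:
  assumes N: "normal_form v L p c e"
  shows "iet_admissible 3 l lam p0 p1 w' \<longleftrightarrow> (\<exists>w. w' = map p w \<and> (\<exists>x y. vrun v L x w y))"
proof
  assume "iet_admissible 3 l lam p0 p1 w'"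
  then obtain x' y' where r: "orun x' w' y'" unfolding admissible_iff_orun by blast
  obtain x y where xy: "x' = c + e * x" "y' = c + e * y" using normal_form_surj[OF N] by metis
  obtain w where w: "set w \<subseteq> {1,2,3}" "w' = map p w" using normal_form_word[OF N run_letters[OF r]] by blast
  have "vrun v L x w y" unfolding normal_form_run[OF N w(1)] using r xy w by simp
  with w show "\<exists>w. w' = map p w \<and> (\<exists>x y. vrun v L x w y)" by blast
next
  assume "\<exists>w. w' = map p w \<and> (\<exists>x y. vrun v L x w y)"
  then obtain w x y where w: "w' = map p w" "vrun v L x w y" by blast
  then have "orun (c + e * x) w' (c + e * y)" using normal_form_run[OF N run_letters[OF w(2)]] by blast
  then show "iet_admissible 3 l lam p0 p1 w'" unfolding admissible_iff_orun by blast
qed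

lemma normal_form_connection_free:
  assumes N: "normal_form v L p c e"
  shows "connection_free v L \<longleftrightarrow> \<not> (\<exists>i\<in>{1,2}. \<exists>j\<in>{1,2}. \<exists>u. orun (nu i) u (mu j))"
proof -
  have D: "(\<lambda>i. c + e * disc v L i) ` {1,2} = mu ` {1,2}"
    using N unfolding normal_form_def by (elim conjE)
  have C: "(\<lambda>i. c + e * codisc L i) ` {1,2} = nu ` {1,2}"
    using N unfolding normal_form_def by (elim conjE)
  have "(\<exists>i\<in>{1,2}. \<exists>j\<in>{1,2}. \<exists>u. orun (nu i) u (mu j)) \<longleftrightarrow> (\<exists>y\<in>nu ` {1,2}. \<exists>z\<in>mu ` {1,2}. \<exists>u. orun y u z)"
    by simp
  also have "\<dots> \<longleftrightarrow> (\<exists>i\<in>{1,2}. \<exists>j\<in>{1,2}. \<exists>u. orun (c + e * codisc L i) u (c + e * disc v L j))"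
    unfolding D[symmetric] C[symmetric] by simp
  also have "\<dots> \<longleftrightarrow> (\<exists>i\<in>{1,2}. \<exists>j\<in>{1,2}. \<exists>u. vrun v L (codisc L i) u (disc v L j))"
  proof -
    have "(\<exists>u. orun (c + e * x) u (c + e * y)) \<longleftrightarrow> (\<exists>u. vrun v L x u y)" for x y
    proof
      assume "\<exists>u. orun (c + e * x) u (c + e * y)"
      then obtain u' where r: "orun (c + e * x) u' (c + e * y)" by blast
      obtain u where "set u \<subseteq> {1,2,3}" "u' = map p u" using normal_form_word[OF N run_letters[OF r]] by blast
      then show "\<exists>u. vrun v L x u y" using normal_form_run[OF N] r by blast
    next
      assume "\<exists>u. vrun v L x u y"
      then obtain u where r: "vrun v L x u y" by blast
      then show "\<exists>u. orun (c + e * x) u (c + e * y)" using normal_form_run[OF N run_letters[OF r]] by blast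
    qed
    then show ?thesis by simp
  qed
  finally show ?thesis unfolding connection_free_def by blast
qed

lemma normal_form_regular:
  assumes "normal_form v L p c e" "p0 1 \<noteq> p1 1"
  shows "iet_regular 3 l r lam p0 p1 \<longleftrightarrow> connection_free v L"
  using normal_form_connection_free[OF assms(1)] linked_iff_orun[OF assms(2)]
    regular_imp_not_linked not_linked_imp_regular by blast

lemma normal_form_V32:
  assumes p: "p1 1 = p0 2" "p1 2 = p0 3" "p1 3 = p0 1"
    and L: "L 1 = lam (p0 1)" "L 2 = lam (p0 2)" "L 3 = lam (p0 3)"
  shows "normal_form V32 L (relabel (p0 1) (p0 2) (p0 3)) l 1"
proof -
  have P: "0 < lam (p0 1)" "0 < lam (p0 2)" "0 < lam (p0 3)" using lam_pos permutes3(1-3)[OF perms(1)] by blast+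
  have I: "relabel (p0 1) (p0 2) (p0 3) ` {1,2,3} = {1,2,3}"
    using permutes_image[OF perms(1)] unfolding atLeastAtMost_1_3 by simp
  note V = lft_values[OF perms(1), of l lam] lft_values[OF perms(2), of l lam, unfolded p]
    iet_pt_values(2,3)[OF perms(1), of l lam] iet_pt_values(2,3)[OF perms(2), of l lam, unfolded p]
  show ?thesis unfolding normal_form_def I by (auto simp: V L pos_def P codisc_def)
qed

text \<open>Reflection reverses both orders: top \<open>p0 3\<close>, \<open>p0 2\<close>,
  \<open>p0 1\<close> and bottom \<open>p0 2\<close>, \<open>p0 1\<close>, \<open>p0 3\<close> read
  1 2 3 and 2 3 1 in the new labels.\<close>

lemma normal_form_V32_flip:
  assumes p: "p1 1 = p0 3" "p1 2 = p0 1" "p1 3 = p0 2"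
    and L: "L 1 = lam (p0 3)" "L 2 = lam (p0 2)" "L 3 = lam (p0 1)"
  shows "normal_form V32 L (relabel (p0 3) (p0 2) (p0 1)) r (- 1)"
proof -
  have P: "0 < lam (p0 1)" "0 < lam (p0 2)" "0 < lam (p0 3)" using lam_pos permutes3(1-3)[OF perms(1)] by blast+
  have I: "relabel (p0 3) (p0 2) (p0 1) ` {1,2,3} = {1,2,3}"
    using permutes_image[OF perms(1)] unfolding atLeastAtMost_1_3 by auto
  have r: "r = l + lam (p0 1) + lam (p0 2) + lam (p0 3)" using lam_sum_perm[OF perms(1)] by simp
  note V = lft_values[OF perms(1), of l lam] lft_values[OF perms(2), of l lam, unfolded p]
    iet_pt_values(2,3)[OF perms(1), of l lam] iet_pt_values(2,3)[OF perms(2), of l lam, unfolded p]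
  show ?thesis unfolding normal_form_def I by (auto simp: V L r pos_def P codisc_def)
qed

text \<open>The letter in the middle of both orders is called 3; this gives the reversal the bottom
  order 2 3 1 shared with V32.\<close>

lemma normal_form_V33:
  assumes p: "p1 1 = p0 3" "p1 2 = p0 2" "p1 3 = p0 1"
    and L: "L 1 = lam (p0 1)" "L 2 = lam (p0 3)" "L 3 = lam (p0 2)"
  shows "normal_form V33 L (relabel (p0 1) (p0 3) (p0 2)) l 1"
proof -
  have P: "0 < lam (p0 1)" "0 < lam (p0 2)" "0 < lam (p0 3)" using lam_pos permutes3(1-3)[OF perms(1)] by blast+
  have I: "relabel (p0 1) (p0 3) (p0 2) ` {1,2,3} = {1,2,3}"
    using permutes_image[OF perms(1)] unfolding atLeastAtMost_1_3 by auto
  note V = lft_values[OF perms(1), of l lam] lft_values[OF perms(2), of l lam, unfolded p]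
    iet_pt_values(2,3)[OF perms(1), of l lam] iet_pt_values(2,3)[OF perms(2), of l lam, unfolded p]
  show ?thesis unfolding normal_form_def I by (auto simp: V L pos_def P codisc_def)
qed

text \<open>Equal last letters make \<open>mu 2\<close> a fixed point; equal first letters, once the
  last ones differ, send \<open>mu 2\<close> to \<open>mu 1\<close>. Either is a link of length
  1.\<close>

lemma regular_irreducible:
  assumes R: "iet_regular 3 l r lam p0 p1"
  shows "p0 1 \<noteq> p1 1 \<and> p0 3 \<noteq> p1 3"
proof -
  note ne = permutes3(4-6)[OF perms(1)] permutes3(4-6)[OF perms(2)]
  note V = lft_values[OF perms(2), of l lam] iet_pt_values(2,3)[OF perms(1), of l lam]
  have T2: "T (mu 2) = tgt (p0 3)" using T_src[OF permutes3(3)[OF perms(1)]] unfolding src_mu(3) .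
  have T1: "T (mu 1) = tgt (p0 2)" using T_src[OF permutes3(2)[OF perms(1)]] unfolding src_mu(2) .
  have nl: "T (mu i) \<noteq> mu j" if "i \<in> {1,2}" "j \<in> {1,2}" for i j
    using regular_imp_not_linked[OF R, of 1] that unfolding linked_def by (auto simp: One_nat_def)
  have 3: "p0 3 \<noteq> p1 3"
  proof
    assume A: "p0 3 = p1 3"
    have "lam (p0 1) + lam (p0 2) = lam (p1 1) + lam (p1 2)"
      using lam_sum_perm[OF perms(1)] lam_sum_perm[OF perms(2)] A by simp
    then have "tgt (p1 3) = mu 2" unfolding V by simp
    then have "T (mu 2) = mu 2" using T2 A by simp
    then show False using nl by blast
  qed
  moreover have "p0 1 \<noteq> p1 1"
  proof
    assume A: "p0 1 = p1 1"
    have "p0 3 = p1 2" using permutes3_cases[OF perms(2) permutes3(3)[OF perms(1)]] 3 A ne by metis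
    moreover have "tgt (p1 2) = mu 1" unfolding V A by simp
    ultimately have "T (mu 2) = mu 1" using T2 by simp
    then show False using nl by blast
  qed
  ultimately show ?thesis by blast
qed

text \<open>Of the six bottom orders relative to the top, distinct first and distinct last letters
  leave three: the two cyclic rotations, which are reflections of each other, and the
  reversal.\<close>

lemma regular_normal_form:
  assumes R: "iet_regular 3 l r lam p0 p1"
  shows "\<exists>v L a b d c e. {a, b, d} = {1,2,3} \<and> normal_form v L (relabel a b d) c e \<and> connection_free v L"
proof -
  note irr = regular_irreducible[OF R]
  note ne = permutes3(4-6)[OF perms(1)] permutes3(4-6)[OF perms(2)]
  note cs = permutes3_cases[OF perms(1) permutes3(1)[OF perms(2)]] permutes3_cases[OF perms(1) permutes3(2)[OF perms(2)]]
    permutes3_cases[OF perms(1) permutes3(3)[OF perms(2)]]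
  have I: "{p0 1, p0 2, p0 3} = {1,2,3}" using permutes_image[OF perms(1)] unfolding atLeastAtMost_1_3 by simp
  consider "p1 1 = p0 2" "p1 2 = p0 3" "p1 3 = p0 1" | "p1 1 = p0 3" "p1 2 = p0 1" "p1 3 = p0 2"
    | "p1 1 = p0 3" "p1 2 = p0 2" "p1 3 = p0 1"
    using cs irr ne by metis
  then show ?thesis
  proof cases
    case 1
    have N: "normal_form V32 (vec3 (lam (p0 1)) (lam (p0 2)) (lam (p0 3))) (relabel (p0 1) (p0 2) (p0 3)) l 1"
      by (rule normal_form_V32[OF 1]) simp_all
    then show ?thesis using normal_form_regular[OF N] R irr I by blast
  next
    case 2
    have N: "normal_form V32 (vec3 (lam (p0 3)) (lam (p0 2)) (lam (p0 1))) (relabel (p0 3) (p0 2) (p0 1)) r (- 1)"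
      by (rule normal_form_V32_flip[OF 2]) simp_all
    moreover have "{p0 3, p0 2, p0 1} = {1,2,3}" using I by blast
    ultimately show ?thesis using normal_form_regular[OF N] R irr by blast
  next
    case 3
    have N: "normal_form V33 (vec3 (lam (p0 1)) (lam (p0 3)) (lam (p0 2))) (relabel (p0 1) (p0 3) (p0 2)) l 1"
      by (rule normal_form_V33[OF 3]) simp_all
    moreover have "{p0 1, p0 3, p0 2} = {1,2,3}" using I by blast
    ultimately show ?thesis using normal_form_regular[OF N] R irr by blast
  qed
qed

end

section \<open>The characterization\<close>

lemma perm3_in_Sigma3: "{a, b, c} = {1, 2, 3} \<Longrightarrow> perm3 a b c \<in> Sigma3"
  unfolding Sigma3_def by blast

lemma edge_label_in_Sigma3_S3_Sigma3:
  assumes "s \<in> edge_labels v w"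
  shows "s \<in> Sigma3_S3_Sigma3"
proof -
  have I: "mcomp p (mcomp m q) \<in> Sigma3_S3_Sigma3" if "p \<in> Sigma3" "m \<in> S3" "q \<in> Sigma3" for p m q
    using that unfolding Sigma3_S3_Sigma3_def by blast
  have P: "perm3 1 2 3 \<in> Sigma3" "perm3 2 1 3 \<in> Sigma3" "perm3 1 3 2 \<in> Sigma3" "perm3 3 2 1 \<in> Sigma3" "perm3 3 1 2 \<in> Sigma3"
    by (rule perm3_in_Sigma3; blast)+
  have M: "m_alpha \<in> S3" "m_beta \<in> S3" "m_gamma \<in> S3" "m_eta \<in> S3" "\<And>k. k \<ge> 1 \<Longrightarrow> m_delta k \<in> S3" "\<And>k. k \<ge> 1 \<Longrightarrow> m_zeta k \<in> S3"
    unfolding S3_def by blast+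
  note D = edge_morph_defs mcomp_mk3 morph_word_replicate_singleton Suc_eq_plus1 [symmetric]
  from assms show ?thesis
  proof (cases rule: edge_labels_cases)
    case 1 with I[OF P(1) M(1) P(1)] show ?thesis by (simp add: D)
  next
    case 2 with I[OF P(3) M(4) P(4)] show ?thesis by (simp add: D)
  next
    case 3 with I[OF P(5) M(2) P(2)] show ?thesis by (simp add: D)
  next
    case 4 with I[OF P(2) M(3) P(1)] show ?thesis by (simp add: D)
  next
    case (5 k) with I[OF P(2) M(5) P(1), of k] show ?thesis by (simp add: D)
  next
    case 6 with I[OF P(1) M(1) P(1)] show ?thesis by (simp add: D)
  next
    case 7 with I[OF P(2) M(1) P(2)] show ?thesis by (simp add: D)
  next
    case (8 k) with I[OF P(1) M(6) P(2), of k] show ?thesis by (simp add: D)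
  next
    case (9 k) with I[OF P(2) M(6) P(2), of k] show ?thesis by (simp add: D)
  qed
qed

section \<open>Prepending the initial permutation to a directive sequence\<close>

lemma morph_word_mcomp: "morph_word (mcomp s t) w = morph_word s (morph_word t w)"
  by (induction w) (auto simp: mcomp_def)

lemma mcomp_apply: "mcomp s t a = morph_word s (t a)"
  by (simp add: mcomp_def)

lemma mcomp_assoc: "mcomp (mcomp s t) u = mcomp s (mcomp t u)"
proof
  show "mcomp (mcomp s t) u x = mcomp s (mcomp t u) x" for x
    by (simp only: mcomp_apply morph_word_mcomp)
qed

text \<open>Directive sequences carry the permutation at index 0 and edge labels from index 1 on, so
  the sequence of labels proper is \<open>\<lambda>n. s (Suc n)\<close>.\<close>

definition prepend :: "morph \<Rightarrow> (nat \<Rightarrow> morph) \<Rightarrow> nat \<Rightarrow> morph" where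
  "prepend q s = (\<lambda>n. if n = 0 then q else s n)"

lemma mprod_prepend_Suc: "mprod (prepend q s) (Suc n) m = mprod (\<lambda>n. s (Suc n)) n m"
  by (induction m) (simp_all add: prepend_def)

lemma mprod_prepend_0: "mprod (prepend q s) 0 (Suc m) = mcomp q (mprod (\<lambda>n. s (Suc n)) 0 m)"
proof (induction m)
  case 0
  show ?case by (simp add: prepend_def mcomp_def fun_eq_iff morph_word_def)
next
  case (Suc m)
  have "mprod (prepend q s) 0 (Suc (Suc m)) = mcomp (mcomp q (mprod (\<lambda>n. s (Suc n)) 0 m)) (s (Suc m))"
    unfolding Suc[symmetric] by (simp add: prepend_def)
  then show ?case by (simp add: mcomp_assoc)
qed

lemma mprod_letters:
  assumes "\<And>n b. b \<in> {1,2,3} \<Longrightarrow> set (t n b) \<subseteq> {1,2,3}" "b \<in> {1,2,3}"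
  shows "set (mprod t n m b) \<subseteq> {1,2,3}"
  using assms(2)
proof (induction m arbitrary: b)
  case (Suc m)
  then have "set (t (n + m) b) \<subseteq> {1,2,3}" by (intro assms(1))
  with Suc.IH show ?case by (auto simp: mcomp_def set_morph_word)
qed auto

lemma morph_word_perm3: "set w \<subseteq> {1,2,3} \<Longrightarrow> morph_word (perm3 a b c) w = map (relabel a b c) w"
  by (induction w) (auto simp: perm3_def)

lemma relabel_image: "relabel a b c ` {1,2,3} = {a,b,c}"
  by simp

lemma language_prepend:
  assumes abc: "{a, b, c} = {1,2,3}" and lt: "\<And>n b. b \<in> {1,2,3} \<Longrightarrow> set (s (Suc n) b) \<subseteq> {1,2,3}"
  shows "(\<exists>n. \<exists>x\<in>{1,2,3}. sublist u (mprod (prepend (perm3 a b c) s) 0 n x)) \<longleftrightarrow>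
    (\<exists>w. u = map (relabel a b c) w \<and> (\<exists>n. \<exists>x\<in>{1,2,3}. sublist w (mprod (\<lambda>n. s (Suc n)) 0 n x)))"
proof -
  let ?t = "\<lambda>n. s (Suc n)" and ?p = "relabel a b c"
  have step: "mprod (prepend (perm3 a b c) s) 0 (Suc n) x = map ?p (mprod ?t 0 n x)" if "x \<in> {1,2,3}" for n x
    unfolding mprod_prepend_0 mcomp_def[of "perm3 a b c"]
    by (rule morph_word_perm3, rule mprod_letters[OF lt that])
  show ?thesis
  proof
    assume "\<exists>n. \<exists>x\<in>{1,2,3}. sublist u (mprod (prepend (perm3 a b c) s) 0 n x)"
    then obtain n x where x: "x \<in> {1,2,3}" "sublist u (mprod (prepend (perm3 a b c) s) 0 n x)" by blast
    have "\<exists>n. \<exists>y\<in>{1,2,3}. sublist u (map ?p (mprod ?t 0 n y))"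
    proof (cases n)
      \<comment> \<open>The empty product is the identity, so \<open>u\<close> is a factor of a
        single letter to which no permutation was applied; that letter is written as the image of
        another.\<close>
      case 0
      have "x \<in> ?p ` {1,2,3}" using x(1) abc unfolding relabel_image by simp
      then obtain y where "y \<in> {1,2,3}" "x = ?p y" by blast
      then show ?thesis using x(2) 0 by (intro exI[of _ 0] bexI[of _ y]) simp_all
    next
      case (Suc m)
      then show ?thesis using x step[OF x(1), of m] by metis
    qed
    then show "\<exists>w. u = map ?p w \<and> (\<exists>n. \<exists>x\<in>{1,2,3}. sublist w (mprod ?t 0 n x))"
      using sublist_map_rightE by blast
  next
    assume "\<exists>w. u = map ?p w \<and> (\<exists>n. \<exists>x\<in>{1,2,3}. sublist w (mprod ?t 0 n x))"
    then obtain w n x where w: "u = map ?p w" "x \<in> {1,2,3}" "sublist w (mprod ?t 0 n x)" by blast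
    then have "sublist u (mprod (prepend (perm3 a b c) s) 0 (Suc n) x)"
      unfolding step[OF w(2)] w(1) by (intro map_mono_sublist)
    with w(2) show "\<exists>n. \<exists>x\<in>{1,2,3}. sublist u (mprod (prepend (perm3 a b c) s) 0 n x)" by blast
  qed
qed

lemma primitive_prepend:
  assumes abc: "{a, b, c} = {1,2,3}" and lt: "\<And>n b. b \<in> {1,2,3} \<Longrightarrow> set (s (Suc n) b) \<subseteq> {1,2,3}"
  shows "primitive_seq (prepend (perm3 a b c) s) \<longleftrightarrow> primitive_seq (\<lambda>n. s (Suc n))"
proof
  let ?t = "\<lambda>n. s (Suc n)"
  assume A: "primitive_seq (prepend (perm3 a b c) s)"
  show "primitive_seq ?t"
    unfolding primitive_seq_def
  proof
    fix n
    obtain N where N: "N > Suc n" "\<forall>b'\<in>{1,2,3}. \<forall>a'\<in>{1,2,3}. a' \<in> set (mprod (prepend (perm3 a b c) s) (Suc n) (N - Suc n) b')"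
      using A unfolding primitive_seq_def by blast
    have "N - 1 - n = N - Suc n" by simp
    then show "\<exists>N>n. \<forall>b\<in>{1,2,3}. \<forall>a\<in>{1,2,3}. a \<in> set (mprod ?t n (N - n) b)"
      using N unfolding mprod_prepend_Suc by (intro exI[of _ "N - 1"]) simp
  qed
next
  let ?t = "\<lambda>n. s (Suc n)" and ?p = "relabel a b c"
  assume A: "primitive_seq ?t"
  show "primitive_seq (prepend (perm3 a b c) s)"
    unfolding primitive_seq_def
  proof
    fix n
    show "\<exists>N>n. \<forall>b'\<in>{1,2,3}. \<forall>a'\<in>{1,2,3}. a' \<in> set (mprod (prepend (perm3 a b c) s) n (N - n) b')"
    proof (cases n)
      case 0
      obtain N where N: "\<forall>b'\<in>{1,2,3}. \<forall>a'\<in>{1,2,3}. a' \<in> set (mprod ?t 0 (N - 0) b')"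
        using A unfolding primitive_seq_def by blast
      have "a' \<in> set (mprod (prepend (perm3 a b c) s) 0 (Suc N) b')" if "b' \<in> {1,2,3}" "a' \<in> {1,2,3}" for a' b'
      proof -
        have "{1,2,3} \<subseteq> set (mprod ?t 0 N b')" using N[unfolded diff_zero] that(1) by blast
        moreover have "a' \<in> ?p ` {1,2,3}" using that(2) abc unfolding relabel_image by simp
        ultimately have "a' \<in> set (map ?p (mprod ?t 0 N b'))" unfolding set_map by blast
        also have "map ?p (mprod ?t 0 N b') = mprod (prepend (perm3 a b c) s) 0 (Suc N) b'"
          unfolding mprod_prepend_0 mcomp_def[of "perm3 a b c"]
          by (rule morph_word_perm3[symmetric], rule mprod_letters[OF lt that(1)])
        finally show ?thesis .
      qed
      then show ?thesis using 0 by (intro exI[of _ "Suc N"]) (simp del: mprod.simps)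
    next
      case (Suc m)
      obtain N where N: "N > m" "\<forall>b'\<in>{1,2,3}. \<forall>a'\<in>{1,2,3}. a' \<in> set (mprod ?t m (N - m) b')"
        using A unfolding primitive_seq_def by blast
      then show ?thesis unfolding Suc by (intro exI[of _ "Suc N"]) (simp add: mprod_prepend_Suc)
    qed
  qed
qed

text \<open>Both sides consist of the bi-infinite words with all factors in one language; that the
  letters lie in the alphabet follows from admissibility of one-letter factors.\<close>

lemma natural_coding_eq_shift:
  assumes p: "p0 permutes {1..3}"
    and L: "\<And>u. iet_admissible 3 l lam p0 p1 u \<longleftrightarrow> (\<exists>N. \<exists>a\<in>{1,2,3}. sublist u (mprod t 0 N a))"
  shows "natural_coding 3 l lam p0 p1 = shift_of_seq t"
proof -
  have "x i \<in> {1..3}" if "\<And>i m. iet_admissible 3 l lam p0 p1 (factor_at x i m)" for x i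
  proof -
    have "factor_at x i 1 = [x i]" by (simp add: factor_at_def One_nat_def)
    then have "iet_admissible 3 l lam p0 p1 [x i]" using that[of i 1] by simp
    then obtain y where "in_I 3 l lam p0 (x i) y" unfolding iet_admissible_def by auto
    then show ?thesis unfolding in_I_iff[OF p] atLeastAtMost_1_3 by blast
  qed
  then show ?thesis unfolding natural_coding_def shift_of_seq_def L[symmetric] by blast
qed

text \<open>Unlike \<open>relabel\<close>, the identity outside 1 to 3, as \<open>permutes\<close>
  demands.\<close>

definition perm_of :: "nat \<Rightarrow> nat \<Rightarrow> nat \<Rightarrow> nat \<Rightarrow> nat" where
  "perm_of a b c i = (if i = 1 then a else if i = 2 then b else if i = 3 then c else i)"

lemma perm_of_simps [simp]: "perm_of a b c 1 = a" "perm_of a b c 2 = b" "perm_of a b c 3 = c"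
  by (simp_all add: perm_of_def)

lemma perm_of_permutes:
  assumes "{a, b, c} = {1,2,3}"
  shows "perm_of a b c permutes {1..3}"
proof (rule bij_imp_permutes)
  have im: "perm_of a b c ` {1..3} = {1..3}" unfolding atLeastAtMost_1_3 using assms by simp
  have "inj_on (perm_of a b c) {1..3}" by (rule eq_card_imp_inj_on) (simp_all only: im finite_atLeastAtMost)
  with im show "bij_betw (perm_of a b c) {1..3} {1..3}" by (simp add: bij_betw_def)
qed (auto simp: perm_of_def)

lemma distinct_of_set3:
  assumes "{a, b, c} = {1,2,3::nat}"
  shows "a \<noteq> b" "a \<noteq> c" "b \<noteq> c"
  using permutes3(4-6)[OF perm_of_permutes[OF assms]] by simp_all

section \<open>The two implications\<close>

lemma regular_IET_imp_sequence:
  assumes iet: "is_IET 3 l r lam p0 p1" and R: "iet_regular 3 l r lam p0 p1"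
  shows "\<exists>q s v. q \<in> Sigma3 \<and> (\<forall>n\<ge>1. s n \<in> Sigma3_S3_Sigma3 \<and> s n \<in> edge_labels (v n) (v (Suc n))) \<and>
    primitive_seq (prepend q s) \<and> natural_coding 3 l lam p0 p1 = shift_of_seq (prepend q s)"
proof -
  interpret iet3 l r lam p0 p1 by unfold_locales (rule iet)
  obtain v0 L0 a b d c e where abd: "{a, b, d} = {1,2,3}" and N: "normal_form v0 L0 (relabel a b d) c e"
    and nc: "connection_free v0 L0"
    using regular_normal_form[OF R] by blast
  have P0: "pos L0" using N unfolding normal_form_def by (elim conjE)
  \<comment> \<open>Renormalization by dependent choice: connection-freeness and positivity persist
    and yield the next edge; the clause for index 0 pins the starting vertex and lengths.\<close>
  let ?P = "\<lambda>n (x :: vertex \<times> (nat \<Rightarrow> real)). connection_free (fst x) (snd x) \<and> pos (snd x) \<and> (n = (0::nat) \<longrightarrow> x = (v0, L0))"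
  let ?Q = "\<lambda>(n::nat) x y. \<exists>s\<in>edge_labels (fst x) (fst y). \<forall>a\<in>{1,2,3}. snd x a = mval s (snd y) a"
  have "\<exists>f. \<forall>n. ?P n (f n) \<and> ?Q n (f n) (f (Suc n))"
  proof (rule dependent_nat_choice)
    show "\<exists>x. ?P 0 x" by (rule exI[of _ "(v0, L0)"]) (simp add: nc P0)
  next
    fix x n assume P: "?P n x"
    from edge_exists[of "fst x" "snd x"] P obtain s w L' where
      s: "s \<in> edge_labels (fst x) w" "pos L'" "\<forall>a\<in>{1,2,3}. snd x a = mval s L' a" by blast
    obtain c' e' a' where "induces (fst x) (snd x) w L' s c' e' a'" using edge_induces[OF s] by blast
    from connection_free_induced[OF this] P s show "\<exists>y. ?P (Suc n) y \<and> ?Q n x y"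
      by (intro exI[of _ "(w, L')"]) auto
  qed
  then obtain f where f: "\<And>n. ?P n (f n)" "\<And>n. ?Q n (f n) (f (Suc n))" by blast
  define V where "V n = fst (f n)" for n
  define \<Lambda> where "\<Lambda> n = snd (f n)" for n
  have "\<forall>n. \<exists>s. s \<in> edge_labels (V n) (V (Suc n)) \<and> (\<forall>a\<in>{1,2,3}. \<Lambda> n a = mval s (\<Lambda> (Suc n)) a)"
    using f(2) unfolding V_def \<Lambda>_def by blast
  then obtain t where t: "\<And>n. t n \<in> edge_labels (V n) (V (Suc n))" "\<And>n. \<forall>a\<in>{1,2,3}. \<Lambda> n a = mval (t n) (\<Lambda> (Suc n)) a"
    by metis
  have P: "pos (\<Lambda> n)" for n using f(1) unfolding \<Lambda>_def by blast
  have 0: "V 0 = v0" "\<Lambda> 0 = L0" using f(1)[of 0] by (simp_all add: V_def \<Lambda>_def)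
  \<comment> \<open>Labels are numbered from 1, so the edge \<open>s n\<close> starts at
    \<open>V (n - 1)\<close>.\<close>
  define s where "s n = t (n - 1)" for n
  have st: "(\<lambda>n. s (Suc n)) = t" by (simp add: s_def)
  have lt: "set (s (Suc n) b) \<subseteq> {1,2,3}" if "b \<in> {1,2,3}" for n b
    using edge_letters[OF t(1) that] by (simp add: s_def)
  have prim: "primitive_seq t" by (rule primitive_tail[where t = t and v = V and \<Lambda> = \<Lambda>, OF t(1) P t(2)])
  have "primitive_seq (prepend (perm3 a b d) s)"
    using primitive_prepend[where s = s, OF abd lt] prim unfolding st by blast
  moreover have "natural_coding 3 l lam p0 p1 = shift_of_seq (prepend (perm3 a b d) s)"
  proof (rule natural_coding_eq_shift[OF perms(1)])
    fix u
    have "iet_admissible 3 l lam p0 p1 u \<longleftrightarrow> (\<exists>w. u = map (relabel a b d) w \<and> (\<exists>x y. vrun v0 L0 x w y))"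
      by (rule normal_form_admissible[OF N])
    also have "\<dots> \<longleftrightarrow> (\<exists>w. u = map (relabel a b d) w \<and> (\<exists>n. \<exists>x\<in>{1,2,3}. sublist w (mprod t 0 n x)))"
      using language_sequence[where t = t and v = V and \<Lambda> = \<Lambda>, OF t(1) P t(2) tot_to_zero[where t = t and v = V and \<Lambda> = \<Lambda>, OF t(1) P t(2) prim]] unfolding 0 by blast
    also have "\<dots> \<longleftrightarrow> (\<exists>n. \<exists>x\<in>{1,2,3}. sublist u (mprod (prepend (perm3 a b d) s) 0 n x))"
      using language_prepend[where s = s, OF abd lt] unfolding st by blast
    finally show "iet_admissible 3 l lam p0 p1 u \<longleftrightarrow> (\<exists>n. \<exists>x\<in>{1,2,3}. sublist u (mprod (prepend (perm3 a b d) s) 0 n x))" .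
  qed
  moreover have "s n \<in> edge_labels (V (n - 1)) (V (Suc n - 1))" if "n \<ge> 1" for n
    using t(1)[of "n - 1"] that by (simp add: s_def)
  then have "\<forall>n\<ge>1. s n \<in> Sigma3_S3_Sigma3 \<and> s n \<in> edge_labels (V (n - 1)) (V (Suc n - 1))"
    using edge_label_in_Sigma3_S3_Sigma3 by blast
  ultimately show ?thesis using perm3_in_Sigma3[OF abd]
    by (intro exI[of _ "perm3 a b d"] exI[of _ s] exI[of _ "\<lambda>n. V (n - 1)"]) blast
qed

lemma sequence_imp_regular_IET:
  assumes q: "q \<in> Sigma3" and s: "\<forall>n\<ge>1. s n \<in> edge_labels (v n) (v (Suc n))" and prim: "primitive_seq (prepend q s)"
  shows "\<exists>l r lam p0 p1. is_IET 3 l r lam p0 p1 \<and> iet_regular 3 l r lam p0 p1 \<and>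
    shift_of_seq (prepend q s) = natural_coding 3 l lam p0 p1"
proof -
  obtain a b d where abd: "{a, b, d} = {1,2,3}" and q': "q = perm3 a b d" using q unfolding Sigma3_def by blast
  define t where "t n = s (Suc n)" for n
  define V where "V n = v (Suc n)" for n
  have st: "(\<lambda>n. s (Suc n)) = t" by (simp add: t_def fun_eq_iff)
  have E: "t n \<in> edge_labels (V n) (V (Suc n))" for n using s by (simp add: t_def V_def)
  have lt: "set (s (Suc n) b) \<subseteq> {1,2,3}" if "b \<in> {1,2,3}" for n b
    using edge_letters[OF E that] by (simp add: t_def)
  have primt: "primitive_seq t" using prim primitive_prepend[where s = s, OF abd lt] unfolding q' st by blast
  obtain \<Lambda> where P: "\<And>n. pos (\<Lambda> n)" and M: "\<And>n. \<forall>a\<in>{1,2,3}. \<Lambda> n a = mval (t n) (\<Lambda> (Suc n)) a"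
    using positive_length_sequence[where t = t and v = V, OF E primt] by blast
  have nc: "connection_free (V 0) (\<Lambda> 0)" by (rule sequence_connection_free[where t = t and v = V and \<Lambda> = \<Lambda>, OF E P M])
  note ne = distinct_of_set3[OF abd]
  define lam where "lam x = (if x = a then \<Lambda> 0 1 else if x = b then \<Lambda> 0 2 else \<Lambda> 0 3)" for x
  have lam: "lam a = \<Lambda> 0 1" "lam b = \<Lambda> 0 2" "lam d = \<Lambda> 0 3" using ne by (simp_all add: lam_def)
  \<comment> \<open>The letters 1, 2, 3 of the normal form are named \<open>a\<close>,
    \<open>b\<close>, \<open>d\<close>: top order 1 2 3 or 1 3 2 according to the vertex, bottom
    order 2 3 1 in both cases.\<close>
  define p0 where "p0 = (case V 0 of V32 \<Rightarrow> perm_of a b d | V33 \<Rightarrow> perm_of a d b)"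
  define p1 where "p1 = (case V 0 of V32 \<Rightarrow> perm_of b d a | V33 \<Rightarrow> perm_of b d a)"
  have pp: "p0 permutes {1..3}" "p1 permutes {1..3}"
    unfolding p0_def p1_def by (cases "V 0"; simp; rule perm_of_permutes; use abd in blast)+
  have "is_IET 3 0 (tot (\<Lambda> 0)) lam p0 p1"
  proof -
    have "0 < lam i" for i using P[of 0] by (simp add: lam_def pos_def)
    moreover have "(\<Sum>i=1..3. lam i) = tot (\<Lambda> 0)"
      unfolding atLeastAtMost_1_3 abd[symmetric] using ne lam by (simp add: tot_def)
    moreover have "0 < tot (\<Lambda> 0)" using P[of 0] by (simp add: tot_def pos_def)
    ultimately show ?thesis unfolding is_IET_def using pp by simp
  qed
  then interpret iet3 0 "tot (\<Lambda> 0)" lam p0 p1 by unfold_locales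
  have N: "normal_form (V 0) (\<Lambda> 0) (relabel a b d) 0 1"
  proof (cases "V 0")
    case V32
    then have "p0 = perm_of a b d" "p1 = perm_of b d a" by (simp_all add: p0_def p1_def)
    then show ?thesis using normal_form_V32[of "\<Lambda> 0"] lam unfolding V32 by simp
  next
    case V33
    then have "p0 = perm_of a d b" "p1 = perm_of b d a" by (simp_all add: p0_def p1_def)
    then show ?thesis using normal_form_V33[of "\<Lambda> 0"] lam unfolding V33 by simp
  qed
  have irr: "p0 1 \<noteq> p1 1" using ne by (cases "V 0") (simp_all add: p0_def p1_def)
  have "iet_regular 3 0 (tot (\<Lambda> 0)) lam p0 p1" using normal_form_regular[OF N irr] nc by blast
  moreover have "natural_coding 3 0 lam p0 p1 = shift_of_seq (prepend q s)"
  proof (rule natural_coding_eq_shift[OF pp(1)])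
    fix u
    have "iet_admissible 3 0 lam p0 p1 u \<longleftrightarrow> (\<exists>w. u = map (relabel a b d) w \<and> (\<exists>x y. vrun (V 0) (\<Lambda> 0) x w y))"
      by (rule normal_form_admissible[OF N])
    also have "\<dots> \<longleftrightarrow> (\<exists>w. u = map (relabel a b d) w \<and> (\<exists>n. \<exists>x\<in>{1,2,3}. sublist w (mprod t 0 n x)))"
      using language_sequence[where t = t and v = V and \<Lambda> = \<Lambda>, OF E P M tot_to_zero[where t = t and v = V and \<Lambda> = \<Lambda>, OF E P M primt]] by blast
    also have "\<dots> \<longleftrightarrow> (\<exists>n. \<exists>x\<in>{1,2,3}. sublist u (mprod (prepend q s) 0 n x))"
      using language_prepend[where s = s, OF abd lt] unfolding st q' by blast
    finally show "iet_admissible 3 0 lam p0 p1 u \<longleftrightarrow> (\<exists>n. \<exists>x\<in>{1,2,3}. sublist u (mprod (prepend q s) 0 n x))" .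
  qed
  ultimately show ?thesis using iet by metis
qed

theorem theorem6p11:
  fixes X :: "(int \<Rightarrow> nat) set"
  assumes "shift_space X"
  shows "(\<exists>l r lam p0 p1. is_IET 3 l r lam p0 p1 \<and> iet_regular 3 l r lam p0 p1 \<and>
            X = natural_coding 3 l lam p0 p1)
         \<longleftrightarrow>
         (\<exists>pi0 sigma v. pi0 \<in> Sigma3 \<and>
            (\<forall>n\<ge>1. sigma n \<in> Sigma3_S3_Sigma3 \<and> sigma n \<in> edge_labels (v n) (v (Suc n))) \<and>
            primitive_seq (\<lambda>n. if n = 0 then pi0 else sigma n) \<and>
            X = shift_of_seq (\<lambda>n. if n = 0 then pi0 else sigma n))"
  unfolding prepend_def[symmetric]
proof
  assume "\<exists>l r lam p0 p1. is_IET 3 l r lam p0 p1 \<and> iet_regular 3 l r lam p0 p1 \<and> X = natural_coding 3 l lam p0 p1"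
  then show "\<exists>pi0 sigma v. pi0 \<in> Sigma3 \<and>
      (\<forall>n\<ge>1. sigma n \<in> Sigma3_S3_Sigma3 \<and> sigma n \<in> edge_labels (v n) (v (Suc n))) \<and>
      primitive_seq (prepend pi0 sigma) \<and> X = shift_of_seq (prepend pi0 sigma)"
    using regular_IET_imp_sequence by metis
next
  assume "\<exists>pi0 sigma v. pi0 \<in> Sigma3 \<and>
      (\<forall>n\<ge>1. sigma n \<in> Sigma3_S3_Sigma3 \<and> sigma n \<in> edge_labels (v n) (v (Suc n))) \<and>
      primitive_seq (prepend pi0 sigma) \<and> X = shift_of_seq (prepend pi0 sigma)"
  then obtain q s v where "q \<in> Sigma3" "\<forall>n\<ge>1. s n \<in> edge_labels (v n) (v (Suc n))" "primitive_seq (prepend q s)"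
    "X = shift_of_seq (prepend q s)" by blast
  from sequence_imp_regular_IET[OF this(1-3)] this(4)
  show "\<exists>l r lam p0 p1. is_IET 3 l r lam p0 p1 \<and> iet_regular 3 l r lam p0 p1 \<and> X = natural_coding 3 l lam p0 p1"
    by metis
qed

end
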